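(* Let $\mathcal{A}$ be a first order structure. If the first order theory of $\mathcal{A}$ extended by the least fixed-point operator is decidable, then every fixed-point formula in $\mathcal{A}$ is first order definable, i.e. for every formula $\mu X[\overline{y}].\,\phi(X,\overline{y})$ there is a first order formula defining the same set in $\mathcal{A}$.
   Context: The first order theory of $\mathcal{A}$ extended by the least fixed-point operator (first order $\mu$-calculus) is the set of sentences true in $\mathcal{A}$ of the logic obtained by adding to first order logic formulas $\mu X[\overline{y}].\,\phi(X,\overline{y})$, where $X$ is a relation variable of arity equal to the length of $\overline{y}$ occurring only positively in $\phi$. Its interpretation is the least relation $X^*$ with $X^*(\overline{y})\Leftrightarrow\phi(X^*,\overline{y})$; it is the union of the stages $X_0=\emptyset$, $X_{\alpha+1}(\overline{y})=\phi(X_\alpha,\overline{y})$, $X_\lambda=\bigcup_{\alpha<\lambda}X_\alpha$ for limit $\lambda$. *)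

theory Defs
  imports Main "HOL-Library.Nat_Bijection"
begin

section \<open>General recursive functions and decidable sets\<close>

text \<open>
  Kleene's total recursive functions: minimisation is only applied to functions for which the
  search always succeeds. In \<open>recursive n f\<close> only the values of \<open>f\<close> on lists of length \<open>n\<close> matter.
\<close>

inductive recursive :: "nat \<Rightarrow> (nat list \<Rightarrow> nat) \<Rightarrow> bool" where
  zero: "recursive n (\<lambda>_. 0)"
| succ: "recursive 1 (\<lambda>xs. Suc (hd xs))"
| proj: "i < n \<Longrightarrow> recursive n (\<lambda>xs. xs ! i)"
| comp: "recursive (length gs) f \<Longrightarrow> \<forall>g\<in>set gs. recursive n g \<Longrightarrow>
    recursive n (\<lambda>xs. f (map (\<lambda>g. g xs) gs))"
| prim_rec: "recursive n g \<Longrightarrow> recursive (Suc (Suc n)) h \<Longrightarrow>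
    recursive (Suc n) (\<lambda>xs. rec_nat (g (tl xs)) (\<lambda>k r. h (k # r # tl xs)) (hd xs))"
| minimise: "recursive (Suc n) f \<Longrightarrow> \<forall>xs. length xs = n \<longrightarrow> (\<exists>k. f (k # xs) = 0) \<Longrightarrow>
    recursive n (\<lambda>xs. LEAST k. f (k # xs) = 0)"

definition decidable :: "nat set \<Rightarrow> bool" where
  "decidable S \<longleftrightarrow> (\<exists>f. recursive 1 f \<and> (\<forall>n. f [n] = (if n \<in> S then 1 else 0)))"

section \<open>Syntax of the first order mu-calculus\<close>

datatype tm = Var nat | Fun nat "tm list"

text \<open>
  \<open>RVar X ts\<close> applies the relation variable \<open>X\<close>; relation and individual variables are separate.
  The remaining connectives and the universal quantifier are the usual abbreviations.
\<close>

datatype fm =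
    Eq tm tm
  | Rel nat "tm list"
  | RVar nat "tm list"
  | Neg fm
  | And fm fm
  | Exists nat fm
  | Mu nat "nat list" fm

text \<open>
  A structure comes with its signature: the domains of \<open>fun_arity\<close> and \<open>rel_arity\<close> are the symbols
  of the language, identified with natural numbers so that decidability of a theory makes sense.
  The universe is the whole type \<open>'a\<close>, and interpretations only matter on argument lists of
  the right length.
\<close>

record 'a fo_structure =
  fun_arity :: "nat \<rightharpoonup> nat"
  rel_arity :: "nat \<rightharpoonup> nat"
  fun_interp :: "nat \<Rightarrow> 'a list \<Rightarrow> 'a"
  rel_interp :: "nat \<Rightarrow> 'a list set"

fun wf_tm :: "'a fo_structure \<Rightarrow> tm \<Rightarrow> bool" where
  "wf_tm A (Var x) \<longleftrightarrow> True"
| "wf_tm A (Fun f ts) \<longleftrightarrow> fun_arity A f = Some (length ts) \<and> (\<forall>t\<in>set ts. wf_tm A t)"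

text \<open>\<open>polarity True X \<phi>\<close> (\<open>polarity False X \<phi>\<close>): all free occurrences of \<open>X\<close> in \<open>\<phi>\<close> are under
  an even (odd) number of negations.\<close>

primrec polarity :: "bool \<Rightarrow> nat \<Rightarrow> fm \<Rightarrow> bool" where
  "polarity b X (Eq s t) \<longleftrightarrow> True"
| "polarity b X (Rel r ts) \<longleftrightarrow> True"
| "polarity b X (RVar Y ts) \<longleftrightarrow> (X = Y \<longrightarrow> b)"
| "polarity b X (Neg \<phi>) \<longleftrightarrow> polarity (\<not> b) X \<phi>"
| "polarity b X (And \<phi> \<psi>) \<longleftrightarrow> polarity b X \<phi> \<and> polarity b X \<psi>"
| "polarity b X (Exists x \<phi>) \<longleftrightarrow> polarity b X \<phi>"
| "polarity b X (Mu Y ys \<phi>) \<longleftrightarrow> X = Y \<or> polarity b X \<phi>"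

abbreviation only_positive :: "nat \<Rightarrow> fm \<Rightarrow> bool" where
  "only_positive \<equiv> polarity True"

text \<open>
  \<open>wf_fm A \<Gamma> \<phi>\<close>: \<open>\<phi>\<close> is a formula in the language of \<open>A\<close> whose free relation variables are in the
  domain of \<open>\<Gamma>\<close>, which records their arities.
\<close>

primrec wf_fm :: "'a fo_structure \<Rightarrow> (nat \<rightharpoonup> nat) \<Rightarrow> fm \<Rightarrow> bool" where
  "wf_fm A \<Gamma> (Eq s t) \<longleftrightarrow> wf_tm A s \<and> wf_tm A t"
| "wf_fm A \<Gamma> (Rel r ts) \<longleftrightarrow> rel_arity A r = Some (length ts) \<and> (\<forall>t\<in>set ts. wf_tm A t)"
| "wf_fm A \<Gamma> (RVar X ts) \<longleftrightarrow> \<Gamma> X = Some (length ts) \<and> (\<forall>t\<in>set ts. wf_tm A t)"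
| "wf_fm A \<Gamma> (Neg \<phi>) \<longleftrightarrow> wf_fm A \<Gamma> \<phi>"
| "wf_fm A \<Gamma> (And \<phi> \<psi>) \<longleftrightarrow> wf_fm A \<Gamma> \<phi> \<and> wf_fm A \<Gamma> \<psi>"
| "wf_fm A \<Gamma> (Exists x \<phi>) \<longleftrightarrow> wf_fm A \<Gamma> \<phi>"
| "wf_fm A \<Gamma> (Mu X ys \<phi>) \<longleftrightarrow>
    distinct ys \<and> only_positive X \<phi> \<and> wf_fm A (\<Gamma>(X \<mapsto> length ys)) \<phi>"

text \<open>First order formulas: no fixed points and no relation variables.\<close>

primrec first_order :: "fm \<Rightarrow> bool" where
  "first_order (Eq s t) \<longleftrightarrow> True"
| "first_order (Rel r ts) \<longleftrightarrow> True"
| "first_order (RVar X ts) \<longleftrightarrow> False"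
| "first_order (Neg \<phi>) \<longleftrightarrow> first_order \<phi>"
| "first_order (And \<phi> \<psi>) \<longleftrightarrow> first_order \<phi> \<and> first_order \<psi>"
| "first_order (Exists x \<phi>) \<longleftrightarrow> first_order \<phi>"
| "first_order (Mu X ys \<phi>) \<longleftrightarrow> False"

primrec fv_tm :: "tm \<Rightarrow> nat set" where
  "fv_tm (Var x) = {x}"
| "fv_tm (Fun f ts) = \<Union> (set (map fv_tm ts))"

text \<open>
  \<open>Mu X ys \<phi>\<close> says that the current values of \<open>ys\<close> belong to the fixed point, so \<open>ys\<close> are free in it.
\<close>

primrec fv :: "fm \<Rightarrow> nat set" where
  "fv (Eq s t) = fv_tm s \<union> fv_tm t"
| "fv (Rel r ts) = (\<Union>t\<in>set ts. fv_tm t)"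
| "fv (RVar X ts) = (\<Union>t\<in>set ts. fv_tm t)"
| "fv (Neg \<phi>) = fv \<phi>"
| "fv (And \<phi> \<psi>) = fv \<phi> \<union> fv \<psi>"
| "fv (Exists x \<phi>) = fv \<phi> - {x}"
| "fv (Mu X ys \<phi>) = set ys \<union> fv \<phi>"

section \<open>Semantics\<close>

primrec eval :: "'a fo_structure \<Rightarrow> (nat \<Rightarrow> 'a) \<Rightarrow> tm \<Rightarrow> 'a" where
  "eval A e (Var x) = e x"
| "eval A e (Fun f ts) = fun_interp A f (map (eval A e) ts)"

definition upds :: "(nat \<Rightarrow> 'a) \<Rightarrow> nat list \<Rightarrow> 'a list \<Rightarrow> nat \<Rightarrow> 'a" where
  "upds e ys as = (\<lambda>x. case map_of (zip ys as) x of None \<Rightarrow> e x | Some a \<Rightarrow> a)"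

text \<open>\<open>R\<close> interprets the relation variables and \<open>e\<close> the individual variables.\<close>

primrec sat :: "'a fo_structure \<Rightarrow> (nat \<Rightarrow> 'a list set) \<Rightarrow> (nat \<Rightarrow> 'a) \<Rightarrow> fm \<Rightarrow> bool" where
  "sat A R e (Eq s t) \<longleftrightarrow> eval A e s = eval A e t"
| "sat A R e (Rel r ts) \<longleftrightarrow> map (eval A e) ts \<in> rel_interp A r"
| "sat A R e (RVar X ts) \<longleftrightarrow> map (eval A e) ts \<in> R X"
| "sat A R e (Neg \<phi>) \<longleftrightarrow> \<not> sat A R e \<phi>"
| "sat A R e (And \<phi> \<psi>) \<longleftrightarrow> sat A R e \<phi> \<and> sat A R e \<psi>"
| "sat A R e (Exists x \<phi>) \<longleftrightarrow> (\<exists>a. sat A R (e(x := a)) \<phi>)"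
| "sat A R e (Mu X ys \<phi>) \<longleftrightarrow>
    map e ys \<in> lfp (\<lambda>S. {as. length as = length ys \<and> sat A (R(X := S)) (upds e ys as) \<phi>})"

text \<open>Syntactic positivity makes the operator monotone, so that \<open>lfp\<close> is indeed a fixed point.\<close>

lemma polarity_mono:
  assumes "S \<subseteq> T"
  shows "(polarity True X \<phi> \<longrightarrow> sat A (R(X := S)) e \<phi> \<longrightarrow> sat A (R(X := T)) e \<phi>) \<and>
    (polarity False X \<phi> \<longrightarrow> sat A (R(X := T)) e \<phi> \<longrightarrow> sat A (R(X := S)) e \<phi>)"
proof (induction \<phi> arbitrary: R e)
  case (RVar Y ts)
  then show ?case using assms by auto
next
  case (Neg \<phi>)
  show ?case using Neg.IH[of R e] by (simp del: fun_upd_apply) blast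
next
  case (And \<phi> \<psi>)
  show ?case using And.IH(1)[of R e] And.IH(2)[of R e] by (simp del: fun_upd_apply)
next
  case (Exists x \<phi>)
  have "(polarity True X \<phi> \<longrightarrow> sat A (R(X := S)) (e(x := a)) \<phi> \<longrightarrow> sat A (R(X := T)) (e(x := a)) \<phi>) \<and>
    (polarity False X \<phi> \<longrightarrow> sat A (R(X := T)) (e(x := a)) \<phi> \<longrightarrow> sat A (R(X := S)) (e(x := a)) \<phi>)" for a
    by (rule Exists.IH)
  then show ?case unfolding polarity.simps sat.simps by metis
next
  case (Mu Y ys \<phi>)
  show ?case
  proof (cases "X = Y")
    case True
    then show ?thesis by (simp only: sat.simps fun_upd_upd simp_thms)
  next
    case False
    let ?F = "\<lambda>U V. {as. length as = length ys \<and> sat A (R(X := U, Y := V)) (upds e ys as) \<phi>}"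
    have swap: "R(X := U, Y := V) = R(Y := V, X := U)" for U V
      using False by (rule fun_upd_twist)
    have IH: "(polarity True X \<phi> \<longrightarrow> sat A (R(X := S, Y := V)) e' \<phi> \<longrightarrow> sat A (R(X := T, Y := V)) e' \<phi>) \<and>
      (polarity False X \<phi> \<longrightarrow> sat A (R(X := T, Y := V)) e' \<phi> \<longrightarrow> sat A (R(X := S, Y := V)) e' \<phi>)" for V e'
      unfolding swap[of S V] swap[of T V] by (rule Mu.IH)
    have pos: "lfp (?F S) \<subseteq> lfp (?F T)" if "polarity True X \<phi>"
      using IH that by (intro lfp_mono Collect_mono) blast
    have neg: "lfp (?F T) \<subseteq> lfp (?F S)" if "polarity False X \<phi>"
      using IH that by (intro lfp_mono Collect_mono) blast
    show ?thesis
      unfolding polarity.simps sat.simps using False subsetD[OF pos] subsetD[OF neg] by simp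
  qed
qed simp_all

lemma mono_Mu:
  assumes "only_positive X \<phi>"
  shows "mono (\<lambda>S. {as. length as = length ys \<and> sat A (R(X := S)) (upds e ys as) \<phi>})"
proof (rule monoI, rule subsetI)
  fix S T as
  assume "S \<subseteq> T" "as \<in> {as. length as = length ys \<and> sat A (R(X := S)) (upds e ys as) \<phi>}"
  then show "as \<in> {as. length as = length ys \<and> sat A (R(X := T)) (upds e ys as) \<phi>}"
    using polarity_mono[of S T X \<phi> A R "upds e ys as"] assms by simp
qed

section \<open>Goedel numbering and theories\<close>

primrec tm_code :: "tm \<Rightarrow> nat" where
  "tm_code (Var x) = prod_encode (0, x)"
| "tm_code (Fun f ts) = prod_encode (1, prod_encode (f, list_encode (map tm_code ts)))"

primrec fm_code :: "fm \<Rightarrow> nat" where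
  "fm_code (Eq s t) = prod_encode (0, prod_encode (tm_code s, tm_code t))"
| "fm_code (Rel r ts) = prod_encode (1, prod_encode (r, list_encode (map tm_code ts)))"
| "fm_code (RVar X ts) = prod_encode (2, prod_encode (X, list_encode (map tm_code ts)))"
| "fm_code (Neg \<phi>) = prod_encode (3, fm_code \<phi>)"
| "fm_code (And \<phi> \<psi>) = prod_encode (4, prod_encode (fm_code \<phi>, fm_code \<psi>))"
| "fm_code (Exists x \<phi>) = prod_encode (5, prod_encode (x, fm_code \<phi>))"
| "fm_code (Mu X ys \<phi>) =
    prod_encode (6, prod_encode (X, prod_encode (list_encode ys, fm_code \<phi>)))"

lemma inj_tm_code: "inj tm_code"
proof
  fix s t
  show "tm_code s = tm_code t \<Longrightarrow> s = t"
  proof (induction s arbitrary: t)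
    case (Var x)
    then show ?case by (cases t) auto
  next
    case (Fun f ss)
    from Fun.prems obtain ts where t: "t = Fun f ts" and "map tm_code ss = map tm_code ts"
      by (cases t) (simp_all add: list_encode_eq)
    then have "ss = ts"
      by (metis list.inj_map_strong Fun.IH)
    then show ?case using t by simp
  qed
qed

lemma inj_fm_code: "inj fm_code"
proof -
  note [simp] = list_encode_eq inj_eq[OF inj_tm_code] inj_map_eq_map[OF inj_tm_code]
  have "fm_code \<phi> = fm_code \<psi> \<longleftrightarrow> \<phi> = \<psi>" for \<phi> \<psi>
    by (induction \<phi> arbitrary: \<psi>; case_tac \<psi>) simp_all
  then show ?thesis by (simp add: inj_def)
qed

abbreviation no_rels :: "nat \<Rightarrow> 'a list set" where
  "no_rels \<equiv> \<lambda>_. {}"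

definition sentence :: "'a fo_structure \<Rightarrow> fm \<Rightarrow> bool" where
  "sentence A \<phi> \<longleftrightarrow> wf_fm A Map.empty \<phi> \<and> fv \<phi> = {}"

definition mu_theory :: "'a fo_structure \<Rightarrow> fm set" where
  "mu_theory A = {\<phi>. sentence A \<phi> \<and> (\<forall>e. sat A no_rels e \<phi>)}"

end

theory Submission
  imports Defs
begin

text \<open>
  The stages of every fixed point close after boundedly many steps, uniformly in the parameters, and
  then fixed points can be unfolded into first order formulas from the inside out, relation variables
  of outer fixed points being replaced by first order definitions of their stages.

  For the bound, suppose that for every \<open>n\<close> some choice of parameters makes the stages of \<open>\<Phi>\<close> grow
  for more than \<open>n\<close> steps. The stage comparison relation is itself a fixed point, namely of
  \<open>L(x, y) \<longleftrightarrow> \<Phi>(x, {x'. \<not> \<Phi>(y, {y'. \<not> L(x', y')})})\<close>. On finite levels it defines zero and successor, so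
  every recursive function is represented, positively, by a fixed-point formula about levels, for all
  parameters with enough levels. A decision procedure for the theory would then be definable in the
  theory that it decides, contradicting Tarski's diagonal argument.
\<close>

section \<open>Environments and the coincidence lemma\<close>

text \<open>The comparison formula arises as follows. Write x \<preceq> y if x enters the stages no
  later than y. Then x \<preceq> y iff x lies in \<Phi> of the elements that enter strictly before
  y. As long as one of the two elements enters at a finite stage, x' enters strictly before y iff y
  \<preceq> x' fails, and by the same unfolding y \<preceq> x' says that y lies in \<Phi> of {y'.
  \<not> x' \<preceq> y'}. Unfolding twice produces two negations, so that the relation is positive
  in itself. The obstacle is that no single choice of parameters need have infinitely many levels:
  arithmetic exists only on initial segments whose length varies with the parameters. Representation
  is therefore one-sided. An output is never wrong, however few levels there are, but it exists only
  if there are enough of them. The diagonal argument gets by with this, because it asks only for the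
  output 1 and its sentence quantifies existentially over the parameters: any witness is
  trustworthy, and one with enough levels can be found.\<close>

definition push :: "'b list \<Rightarrow> (nat \<Rightarrow> 'b) \<Rightarrow> nat \<Rightarrow> 'b" where
  "push as e i = (if i < length as then as ! i else e (i - length as))"

lemma upds_notin: "x \<notin> set ys \<Longrightarrow> upds e ys as x = e x"
  by (auto simp: upds_def split: option.splits dest!: map_of_SomeD dest: set_zip_leftD)

lemma upds_nth:
  "distinct ys \<Longrightarrow> length as = length ys \<Longrightarrow> i < length ys \<Longrightarrow> upds e ys as (ys ! i) = as ! i"
  by (simp add: upds_def map_of_zip_nth)

lemma upds_upt:
  "length as = k \<Longrightarrow>
    upds e [m..<m + k] as i = (if m \<le> i \<and> i < m + k then as ! (i - m) else e i)"
  using upds_nth[of "[m..<m + k]" as "i - m" e] upds_notin[of i "[m..<m + k]" e as]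
  by (auto simp: not_less)

lemma upds_Nil [simp]: "upds e [] as = e"
  by (simp add: upds_def)

lemma upds_Cons: "x \<notin> set xs \<Longrightarrow> upds e (x # xs) (a # as) = upds (e(x := a)) xs as"
  by (rule ext) (auto simp: upds_def split: option.splits dest!: map_of_SomeD dest: set_zip_leftD)

lemma map_upds: "distinct ys \<Longrightarrow> length as = length ys \<Longrightarrow> map (upds e ys as) ys = as"
  by (simp add: list_eq_iff_nth_eq upds_nth)

lemma upds_map_id [simp]: "upds e ys (map e ys) = e"
  by (rule ext) (auto simp: upds_def map_of_zip_map split: option.splits)

lemma upds_cong: "e x = e' x \<Longrightarrow> upds e ys as x = upds e' ys as x"
  by (simp add: upds_def split: option.splits)

lemma finite_fv_tm [simp]: "finite (fv_tm t)"
  by (induction t) auto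

lemma finite_fv [simp]: "finite (fv \<phi>)"
  by (induction \<phi>) auto

lemma eval_cong: "(\<And>x. x \<in> fv_tm t \<Longrightarrow> e x = e' x) \<Longrightarrow> eval A e t = eval A e' t"
proof (induction t)
  case (Fun f ts)
  have "map (eval A e) ts = map (eval A e') ts"
    using Fun by auto
  then show ?case by (simp only: eval.simps)
qed simp

lemma map_eval_cong:
  "(\<And>x t. t \<in> set ts \<Longrightarrow> x \<in> fv_tm t \<Longrightarrow> e x = e' x) \<Longrightarrow> map (eval A e) ts = map (eval A e') ts"
  by (auto intro: eval_cong)

text \<open>The relations need to agree only on tuples of the arity recorded in
  \<open>\<Gamma>\<close>. Under \<open>Mu\<close> both sides give the bound variable the same set,
  so the two operators coincide and no induction along the fixed point is needed.\<close>

lemma sat_cong: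
  assumes "wf_fm A \<Gamma> \<phi>" "\<And>x. x \<in> fv \<phi> \<Longrightarrow> e x = e' x"
    "\<And>X k as. \<Gamma> X = Some k \<Longrightarrow> length as = k \<Longrightarrow> as \<in> R X \<longleftrightarrow> as \<in> R' X"
  shows "sat A R e \<phi> \<longleftrightarrow> sat A R' e' \<phi>"
  using assms
proof (induction \<phi> arbitrary: \<Gamma> R R' e e')
  case (Eq s t)
  then show ?case using eval_cong[of s e e' A] eval_cong[of t e e' A] by simp
next
  case (Rel r ts)
  have "map (eval A e) ts = map (eval A e') ts"
    using Rel by (intro map_eval_cong) auto
  then show ?case by (simp only: sat.simps)
next
  case (RVar X ts)
  have "map (eval A e) ts = map (eval A e') ts"
    using RVar by (intro map_eval_cong) auto
  then show ?case using RVar by (simp only: sat.simps) simp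
next
  case (Neg \<phi>)
  have "sat A R e \<phi> = sat A R' e' \<phi>"
    using Neg.prems by (intro Neg.IH[where \<Gamma>=\<Gamma>]) auto
  then show ?case by simp
next
  case (And \<phi> \<psi>)
  have "sat A R e \<phi> = sat A R' e' \<phi>"
    using And.prems by (intro And.IH(1)[where \<Gamma>=\<Gamma>]) auto
  moreover have "sat A R e \<psi> = sat A R' e' \<psi>"
    using And.prems by (intro And.IH(2)[where \<Gamma>=\<Gamma>]) auto
  ultimately show ?case by simp
next
  case (Exists x \<phi>)
  have "sat A R (e(x := a)) \<phi> = sat A R' (e'(x := a)) \<phi>" for a
    using Exists.prems by (intro Exists.IH[where \<Gamma>=\<Gamma>]) auto
  then show ?case by simp
next
  case (Mu X ys \<phi>)
  have "sat A (R(X := S)) (upds e ys as) \<phi> = sat A (R'(X := S)) (upds e' ys as) \<phi>" for S as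
  proof (rule Mu.IH[where \<Gamma>="\<Gamma>(X \<mapsto> length ys)"])
    show "wf_fm A (\<Gamma>(X \<mapsto> length ys)) \<phi>"
      using Mu.prems(1) by simp
  qed (use Mu.prems in \<open>auto intro: upds_cong split: if_splits\<close>)
  moreover have "map e ys = map e' ys"
    using Mu.prems by auto
  ultimately show ?case by (simp only: sat.simps)
qed

lemma sat_cong_closed:
  "wf_fm A Map.empty \<phi> \<Longrightarrow> (\<And>x. x \<in> fv \<phi> \<Longrightarrow> e x = e' x) \<Longrightarrow> sat A R e \<phi> \<longleftrightarrow> sat A R' e' \<phi>"
  by (rule sat_cong[where \<Gamma>=Map.empty]) auto

lemma wf_fm_mono: "wf_fm A \<Gamma> \<phi> \<Longrightarrow> \<Gamma> \<subseteq>\<^sub>m \<Delta> \<Longrightarrow> wf_fm A \<Delta> \<phi>"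
proof (induction \<phi> arbitrary: \<Gamma> \<Delta>)
  case (RVar X ts)
  then show ?case by (auto simp: map_le_def dom_def)
next
  case (Mu X ys \<phi>)
  have "\<Gamma>(X \<mapsto> length ys) \<subseteq>\<^sub>m \<Delta>(X \<mapsto> length ys)"
    using Mu.prems(2) by (rule map_le_upd)
  then show ?case using Mu by (auto simp del: fun_upd_apply)
qed auto

lemma polarity_fresh: "wf_fm A \<Gamma> \<phi> \<Longrightarrow> \<Gamma> X = None \<Longrightarrow> polarity b X \<phi>"
proof (induction \<phi> arbitrary: \<Gamma> b)
  case (Mu Y ys \<phi>)
  then show ?case by (cases "X = Y") auto
qed auto

section \<open>Derived connectives\<close>

definition Or :: "fm \<Rightarrow> fm \<Rightarrow> fm" where
  "Or \<phi> \<psi> = Neg (And (Neg \<phi>) (Neg \<psi>))"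

definition Falsum :: fm where
  "Falsum = Neg (Eq (Var 0) (Var 0))"

lemma Or_simps [simp]:
  "sat A R e (Or \<phi> \<psi>) \<longleftrightarrow> sat A R e \<phi> \<or> sat A R e \<psi>"
  "wf_fm A \<Gamma> (Or \<phi> \<psi>) \<longleftrightarrow> wf_fm A \<Gamma> \<phi> \<and> wf_fm A \<Gamma> \<psi>"
  "polarity b X (Or \<phi> \<psi>) \<longleftrightarrow> polarity b X \<phi> \<and> polarity b X \<psi>"
  by (auto simp: Or_def)

lemma Falsum_simps [simp]:
  "\<not> sat A R e Falsum" "wf_fm A \<Gamma> Falsum" "polarity b X Falsum" "first_order Falsum"
  by (auto simp: Falsum_def)

definition exs :: "nat list \<Rightarrow> fm \<Rightarrow> fm" where
  "exs xs \<phi> = foldr Exists xs \<phi>"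

lemma exs_simps [simp]:
  "wf_fm A \<Gamma> (exs xs \<phi>) \<longleftrightarrow> wf_fm A \<Gamma> \<phi>"
  "polarity b X (exs xs \<phi>) \<longleftrightarrow> polarity b X \<phi>"
  "first_order (exs xs \<phi>) \<longleftrightarrow> first_order \<phi>"
  "fv (exs xs \<phi>) = fv \<phi> - set xs"
  unfolding exs_def by (induction xs) auto

lemma sat_exs:
  "distinct xs \<Longrightarrow>
    sat A R e (exs xs \<phi>) \<longleftrightarrow> (\<exists>as. length as = length xs \<and> sat A R (upds e xs as) \<phi>)"
proof (induction xs arbitrary: e)
  case Nil
  then show ?case by (simp add: exs_def)
next
  case (Cons x xs)
  have "sat A R e (exs (x # xs) \<phi>) \<longleftrightarrow>
      (\<exists>a as. length as = length xs \<and> sat A R (upds (e(x := a)) xs as) \<phi>)"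
    using Cons by (simp add: exs_def)
  also have "\<dots> \<longleftrightarrow>
      (\<exists>a as. length as = length xs \<and> sat A R (upds e (x # xs) (a # as)) \<phi>)"
    using Cons.prems by (simp add: upds_Cons)
  finally show ?case
    by (simp add: length_Suc_conv) blast
qed

definition eqs :: "(nat \<times> tm) list \<Rightarrow> fm \<Rightarrow> fm" where
  "eqs xts \<phi> = foldr (\<lambda>(x, t). And (Eq (Var x) t)) xts \<phi>"

lemma eqs_simps [simp]:
  "sat A R e (eqs xts \<phi>) \<longleftrightarrow> (\<forall>(x, t)\<in>set xts. e x = eval A e t) \<and> sat A R e \<phi>"
  "wf_fm A \<Gamma> (eqs xts \<phi>) \<longleftrightarrow> (\<forall>(x, t)\<in>set xts. wf_tm A t) \<and> wf_fm A \<Gamma> \<phi>"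
  "polarity b X (eqs xts \<phi>) \<longleftrightarrow> polarity b X \<phi>"
  "first_order (eqs xts \<phi>) \<longleftrightarrow> first_order \<phi>"
  "fv (eqs xts \<phi>) = (\<Union>(x, t)\<in>set xts. insert x (fv_tm t)) \<union> fv \<phi>"
  unfolding eqs_def by (induction xts) (simp_all add: split_beta Un_assoc)

text \<open>Terms cannot replace the variables \<open>ys\<close> of \<open>Mu X ys\<close>, so
  substitution is simulated by quantifying \<open>xs\<close> and equating them with
  \<open>ts\<close>. As \<open>\<phi>\<close> stays intact, the code of the result is also easy to
  compute from that of \<open>\<phi>\<close>.\<close>

definition letin :: "nat list \<Rightarrow> tm list \<Rightarrow> fm \<Rightarrow> fm" where
  "letin xs ts \<phi> = exs xs (eqs (zip xs ts) \<phi>)"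

lemma letin_simps [simp]:
  "polarity b X (letin xs ts \<phi>) \<longleftrightarrow> polarity b X \<phi>"
  "first_order (letin xs ts \<phi>) \<longleftrightarrow> first_order \<phi>"
  by (simp_all add: letin_def)

lemma wf_letin:
  "\<forall>t\<in>set ts. wf_tm A t \<Longrightarrow> wf_fm A \<Gamma> \<phi> \<Longrightarrow> wf_fm A \<Gamma> (letin xs ts \<phi>)"
  by (auto simp: letin_def dest: set_zip_rightD)

lemma sat_letin:
  assumes "distinct xs" "length ts = length xs" "\<And>t. t \<in> set ts \<Longrightarrow> fv_tm t \<inter> set xs = {}"
  shows "sat A R e (letin xs ts \<phi>) \<longleftrightarrow> sat A R (upds e xs (map (eval A e) ts)) \<phi>"
proof -
  have ev: "eval A (upds e xs as) t = eval A e t" if "t \<in> set ts" for as t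
    using assms(3)[OF that] by (intro eval_cong upds_notin) auto
  have "(\<forall>(x, t)\<in>set (zip xs ts). upds e xs as x = eval A (upds e xs as) t) \<longleftrightarrow>
      as = map (eval A e) ts" if "length as = length xs" for as
  proof -
    have "(\<forall>(x, t)\<in>set (zip xs ts). upds e xs as x = eval A (upds e xs as) t) \<longleftrightarrow>
        (\<forall>i<length xs. upds e xs as (xs ! i) = eval A (upds e xs as) (ts ! i))"
      using assms(2) by (auto simp: set_zip)
    also have "\<dots> \<longleftrightarrow> (\<forall>i<length xs. as ! i = eval A e (ts ! i))"
      using assms(1,2) that by (simp add: upds_nth ev)
    finally show ?thesis
      using assms(2) that by (simp add: list_eq_iff_nth_eq)
  qed
  then have "length as = length xs \<and> sat A R (upds e xs as) (eqs (zip xs ts) \<phi>) \<longleftrightarrow>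
      as = map (eval A e) ts \<and> sat A R (upds e xs as) \<phi>" for as
    using assms(2) by (cases "length as = length xs") auto
  then show ?thesis
    unfolding letin_def sat_exs[OF assms(1)] by auto
qed

section \<open>Renaming of individual variables\<close>

primrec ren_tm :: "(nat \<Rightarrow> nat) \<Rightarrow> tm \<Rightarrow> tm" where
  "ren_tm \<sigma> (Var x) = Var (\<sigma> x)"
| "ren_tm \<sigma> (Fun f ts) = Fun f (map (ren_tm \<sigma>) ts)"

lemma eval_ren_tm [simp]: "eval A e (ren_tm \<sigma> t) = eval A (e \<circ> \<sigma>) t"
proof (induction t)
  case (Fun f ts)
  have "map (eval A e \<circ> ren_tm \<sigma>) ts = map (eval A (e \<circ> \<sigma>)) ts"
    unfolding comp_def[of "eval A e"] by (rule map_cong[OF refl]) (rule Fun.IH)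
  then show ?case by (simp only: ren_tm.simps eval.simps map_map)
qed simp

lemma wf_ren_tm [simp]: "wf_tm A (ren_tm \<sigma> t) = wf_tm A t"
  by (induction t) auto

definition fresh :: "nat set \<Rightarrow> nat" where
  "fresh S = Suc (Max (insert 0 S))"

lemma less_fresh: "finite S \<Longrightarrow> x \<in> S \<Longrightarrow> x < fresh S"
  by (simp add: fresh_def less_Suc_eq_le)

text \<open>A renaming need not be injective and could identify two of the variables
  \<open>ys\<close> of a fixed point, which must stay distinct. The fixed point is therefore formed
  over fresh variables \<open>zs\<close>, and \<open>letin\<close> hands them the current values of
  the renamed \<open>ys\<close>.\<close>

primrec ren :: "fm \<Rightarrow> (nat \<Rightarrow> nat) \<Rightarrow> fm" where
  "ren (Eq s t) \<sigma> = Eq (ren_tm \<sigma> s) (ren_tm \<sigma> t)"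
| "ren (Rel r ts) \<sigma> = Rel r (map (ren_tm \<sigma>) ts)"
| "ren (RVar X ts) \<sigma> = RVar X (map (ren_tm \<sigma>) ts)"
| "ren (Neg \<phi>) \<sigma> = Neg (ren \<phi> \<sigma>)"
| "ren (And \<phi> \<psi>) \<sigma> = And (ren \<phi> \<sigma>) (ren \<psi> \<sigma>)"
| "ren (Exists x \<phi>) \<sigma> = (let z = fresh (\<sigma> ` fv \<phi>) in Exists z (ren \<phi> (\<sigma>(x := z))))"
| "ren (Mu X ys \<phi>) \<sigma> =
    (let N = fresh (\<sigma> ` (set ys \<union> fv \<phi>)); zs = [N..<N + length ys]
     in letin zs (map (\<lambda>y. Var (\<sigma> y)) ys) (Mu X zs (ren \<phi> (upds \<sigma> ys zs))))"

lemma ren_simps [simp]: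
  "polarity b X (ren \<phi> \<sigma>) \<longleftrightarrow> polarity b X \<phi>"
  "first_order (ren \<phi> \<sigma>) \<longleftrightarrow> first_order \<phi>"
  by (induction \<phi> arbitrary: \<sigma> b) (auto simp: Let_def)

lemma wf_ren: "wf_fm A \<Gamma> \<phi> \<Longrightarrow> wf_fm A \<Gamma> (ren \<phi> \<sigma>)"
  by (induction \<phi> arbitrary: \<sigma> \<Gamma>) (auto simp: Let_def intro!: wf_letin)

lemma sat_ren: "wf_fm A \<Gamma> \<phi> \<Longrightarrow> sat A R e (ren \<phi> \<sigma>) \<longleftrightarrow> sat A R (e \<circ> \<sigma>) \<phi>"
proof (induction \<phi> arbitrary: \<Gamma> R e \<sigma>)
  case (Rel r ts)
  have "map (eval A e) (map (ren_tm \<sigma>) ts) = map (eval A (e \<circ> \<sigma>)) ts" by simp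
  then show ?case by (simp only: ren.simps sat.simps)
next
  case (RVar X ts)
  have "map (eval A e) (map (ren_tm \<sigma>) ts) = map (eval A (e \<circ> \<sigma>)) ts" by simp
  then show ?case by (simp only: ren.simps sat.simps)
next
  case (Exists x \<phi>)
  define z where "z = fresh (\<sigma> ` fv \<phi>)"
  have "sat A R (e(z := a)) (ren \<phi> (\<sigma>(x := z))) = sat A R ((e \<circ> \<sigma>)(x := a)) \<phi>" for a
    unfolding Exists.IH[OF wf_fm.simps(6)[THEN iffD1, OF Exists.prems]] using Exists.prems less_fresh[of "\<sigma> ` fv \<phi>" "\<sigma> _"]
    by (intro sat_cong[where \<Gamma>=\<Gamma>]) (auto simp: z_def dest: less_imp_neq)
  then show ?case
    by (simp only: ren.simps Let_def sat.simps flip: z_def)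
next
  case (Mu X ys \<phi>)
  define N where "N = fresh (\<sigma> ` (set ys \<union> fv \<phi>))"
  define zs where "zs = [N..<N + length ys]"
  have zs: "distinct zs" "length zs = length ys" "\<And>i. i < length ys \<Longrightarrow> zs ! i = N + i"
    by (simp_all add: zs_def)
  have N: "\<sigma> x < N" if "x \<in> set ys \<union> fv \<phi>" for x
    using that less_fresh[of "\<sigma> ` (set ys \<union> fv \<phi>)"] by (auto simp: N_def)
  have notin: "\<sigma> x \<notin> set zs" if "x \<in> set ys \<union> fv \<phi>" for x
    using N[OF that] by (simp add: zs_def)
  have wf: "distinct ys" "wf_fm A (\<Gamma>(X \<mapsto> length ys)) \<phi>"
    using Mu.prems by simp_all
  \<comment> \<open>The inner update overwrites the values \<open>bs\<close> left by
    \<open>letin\<close>, and no renamed variable of \<open>\<phi>\<close> outside \<open>ys\<close>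
    lands in \<open>zs\<close>.\<close>
  have body: "sat A R' (upds (upds e zs bs) zs as) (ren \<phi> (upds \<sigma> ys zs)) =
      sat A R' (upds (e \<circ> \<sigma>) ys as) \<phi>" if "length as = length ys" for R' as bs
  proof -
    have "(upds (upds e zs bs) zs as \<circ> upds \<sigma> ys zs) x = upds (e \<circ> \<sigma>) ys as x" if "x \<in> fv \<phi>" for x
    proof (cases "x \<in> set ys")
      case True
      then obtain i where "i < length ys" "x = ys ! i" by (auto simp: in_set_conv_nth)
      then show ?thesis
        using wf zs \<open>length as = length ys\<close> upds_nth[of zs as i] by (simp add: upds_nth)
    next
      case False
      then show ?thesis using notin that by (simp add: upds_notin)
    qed
    then show ?thesis
      unfolding Mu.IH[OF wf(2)] using wf(2) by (intro sat_cong) auto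
  qed
  define bs where "bs = map (e \<circ> \<sigma>) ys"
  have F: "{as. length as = length zs \<and>
        sat A (R(X := S)) (upds (upds e zs bs) zs as) (ren \<phi> (upds \<sigma> ys zs))} =
      {as. length as = length ys \<and> sat A (R(X := S)) (upds (e \<circ> \<sigma>) ys as) \<phi>}" for S
    using body[of _ "R(X := S)" bs] zs(2) by auto
  have "map (eval A e) (map (\<lambda>y. Var (\<sigma> y)) ys) = bs"
    by (simp add: bs_def)
  then have "sat A R e (ren (Mu X ys \<phi>) \<sigma>) =
      sat A R (upds e zs bs) (Mu X zs (ren \<phi> (upds \<sigma> ys zs)))"
    using notin zs(1,2) unfolding ren.simps Let_def N_def[symmetric] zs_def[symmetric]
    by (subst sat_letin) auto
  also have "map (upds e zs bs) zs = bs"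
    using zs by (simp add: map_upds bs_def)
  then have "sat A R (upds e zs bs) (Mu X zs (ren \<phi> (upds \<sigma> ys zs))) = sat A R (e \<circ> \<sigma>) (Mu X ys \<phi>)"
    by (simp only: sat.simps F flip: bs_def)
  finally show ?case .
next
  case (Neg \<phi>)
  then show ?case using Neg.IH[of \<Gamma> R e \<sigma>] by simp
next
  case (And \<phi> \<psi>)
  then show ?case using And.IH(1)[of \<Gamma> R e \<sigma>] And.IH(2)[of \<Gamma> R e \<sigma>] by simp
qed simp

section \<open>Substitution of formulas for relation variables\<close>

text \<open>
  In a formula that defines a \<open>k\<close>-ary relation the variables \<open>0, \<dots>, k - 1\<close> are the arguments and
  the variable \<open>k + i\<close> is the variable \<open>i\<close> of the surrounding context, as with de Bruijn indices.
\<close>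

lemma upds_push: "length as = k \<Longrightarrow> upds (push bs e) [0..<k] as = push as e"
  if "length bs = k" for bs
  using that by (auto simp: fun_eq_iff upds_upt[of _ _ _ 0, simplified] push_def)

lemma map_push: "length as = k \<Longrightarrow> map (push as e) [0..<k] = as"
  by (simp add: list_eq_iff_nth_eq push_def)

lemma push_map_upds:
  "length as = k \<Longrightarrow> (\<And>x. x \<in> S \<Longrightarrow> x < N) \<Longrightarrow> x \<in> S \<Longrightarrow>
    (upds e [N..<N + k] as \<circ> (\<lambda>i. if i < k then N + i else i - k)) x = push as e x"
  by (fastforce simp: upds_upt push_def)

text \<open>\<open>app\<close> and \<open>DExs\<close> lead from a formula with \<open>k\<close>
  argument variables back to the surrounding context: the former fixes the arguments by terms, the
  latter quantifies them. In both, the arguments move to fresh variables and the context variables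
  drop by \<open>k\<close>.\<close>

definition app :: "fm \<Rightarrow> tm list \<Rightarrow> fm" where
  "app \<phi> ts = (let N = fresh (fv \<phi> \<union> (\<Union>t\<in>set ts. fv_tm t)); k = length ts
    in letin [N..<N + k] ts (ren \<phi> (\<lambda>i. if i < k then N + i else i - k)))"

definition DExs :: "nat \<Rightarrow> fm \<Rightarrow> fm" where
  "DExs k \<phi> = (let N = fresh (fv \<phi>)
    in exs [N..<N + k] (ren \<phi> (\<lambda>i. if i < k then N + i else i - k)))"

lemma app_simps [simp]:
  "polarity b X (app \<phi> ts) \<longleftrightarrow> polarity b X \<phi>"
  "first_order (app \<phi> ts) \<longleftrightarrow> first_order \<phi>"
  by (simp_all add: app_def Let_def)

lemma DExs_simps [simp]:
  "polarity b X (DExs k \<phi>) \<longleftrightarrow> polarity b X \<phi>"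
  "first_order (DExs k \<phi>) \<longleftrightarrow> first_order \<phi>"
  by (simp_all add: DExs_def Let_def)

lemma wf_app: "\<forall>t\<in>set ts. wf_tm A t \<Longrightarrow> wf_fm A \<Gamma> \<phi> \<Longrightarrow> wf_fm A \<Gamma> (app \<phi> ts)"
  by (simp add: app_def Let_def wf_letin wf_ren)

lemma wf_DExs: "wf_fm A \<Gamma> \<phi> \<Longrightarrow> wf_fm A \<Gamma> (DExs k \<phi>)"
  by (simp add: DExs_def Let_def wf_ren)

lemma sat_ren_fresh:
  assumes "wf_fm A \<Gamma> \<phi>" "length as = k" "\<And>x. x \<in> fv \<phi> \<Longrightarrow> x < N"
  shows "sat A R (upds e [N..<N + k] as) (ren \<phi> (\<lambda>i. if i < k then N + i else i - k)) \<longleftrightarrow>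
    sat A R (push as e) \<phi>"
  unfolding sat_ren[OF assms(1)]
  using assms push_map_upds[of as k "fv \<phi>" N _ e] by (intro sat_cong) auto

lemma sat_app:
  assumes "wf_fm A \<Gamma> \<phi>"
  shows "sat A R e (app \<phi> ts) \<longleftrightarrow> sat A R (push (map (eval A e) ts) e) \<phi>"
proof -
  define N where "N = fresh (fv \<phi> \<union> (\<Union>t\<in>set ts. fv_tm t))"
  have N: "x < N" if "x \<in> fv \<phi> \<union> (\<Union>t\<in>set ts. fv_tm t)" for x
    unfolding N_def using that by (intro less_fresh) auto
  have "fv_tm t \<inter> set [N..<N + length ts] = {}" if "t \<in> set ts" for t
    using N that by fastforce
  then show ?thesis
    using N sat_ren_fresh[OF assms, of "map (eval A e) ts" "length ts" N R e]
    unfolding app_def Let_def N_def[symmetric] by (subst sat_letin) auto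
qed

lemma sat_DExs:
  assumes "wf_fm A \<Gamma> \<phi>"
  shows "sat A R e (DExs k \<phi>) \<longleftrightarrow> (\<exists>as. length as = k \<and> sat A R (push as e) \<phi>)"
proof -
  have "x < fresh (fv \<phi>)" if "x \<in> fv \<phi>" for x
    using that by (intro less_fresh) auto
  then show ?thesis
    using sat_ren_fresh[OF assms, of _ k "fresh (fv \<phi>)" R e]
    unfolding DExs_def Let_def by (subst sat_exs) auto
qed

text \<open>Weakening: the relation defined by \<open>\<phi>\<close> stays the same when
  \<open>j\<close> variables are pushed onto the context, behind its \<open>k\<close>
  arguments.\<close>

definition lift :: "nat \<Rightarrow> nat \<Rightarrow> fm \<Rightarrow> fm" where
  "lift k j \<phi> = ren \<phi> (\<lambda>i. if i < k then i else i + j)"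

lemma lift_simps [simp]:
  "polarity b X (lift k j \<phi>) \<longleftrightarrow> polarity b X \<phi>"
  "first_order (lift k j \<phi>) \<longleftrightarrow> first_order \<phi>"
  by (simp_all add: lift_def)

lemma wf_lift: "wf_fm A \<Gamma> \<phi> \<Longrightarrow> wf_fm A \<Gamma> (lift k j \<phi>)"
  by (simp add: lift_def wf_ren)

lemma sat_lift:
  assumes "wf_fm A \<Gamma> \<phi>" "length bs = k" "length as = j"
  shows "sat A R (push bs (push as e)) (lift k j \<phi>) \<longleftrightarrow> sat A R (push bs e) \<phi>"
proof -
  have "push bs (push as e) \<circ> (\<lambda>i. if i < k then i else i + j) = push bs e"
    using assms(2,3) by (auto simp: fun_eq_iff push_def)
  then show ?thesis
    by (simp only: lift_def sat_ren[OF assms(1)])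
qed

text \<open>
  \<open>sub \<phi> \<Gamma> \<psi> \<sigma> N\<close> renames the individual variables of \<open>\<phi>\<close> by \<open>\<sigma>\<close> and replaces each free relation
  variable \<open>X\<close>, of arity \<open>\<Gamma> X\<close>, by the relation defined by \<open>\<psi> X\<close>; relation variables from \<open>N\<close> on
  are fresh.
\<close>

primrec sub :: "fm \<Rightarrow> (nat \<rightharpoonup> nat) \<Rightarrow> (nat \<Rightarrow> fm) \<Rightarrow> (nat \<Rightarrow> nat) \<Rightarrow> nat \<Rightarrow> fm" where
  "sub (Eq s t) \<Gamma> \<psi> \<sigma> N = Eq (ren_tm \<sigma> s) (ren_tm \<sigma> t)"
| "sub (Rel r ts) \<Gamma> \<psi> \<sigma> N = Rel r (map (ren_tm \<sigma>) ts)"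
| "sub (RVar X ts) \<Gamma> \<psi> \<sigma> N = app (\<psi> X) (map (ren_tm \<sigma>) ts)"
| "sub (Neg \<phi>) \<Gamma> \<psi> \<sigma> N = Neg (sub \<phi> \<Gamma> \<psi> \<sigma> N)"
| "sub (And \<phi> \<phi>') \<Gamma> \<psi> \<sigma> N = And (sub \<phi> \<Gamma> \<psi> \<sigma> N) (sub \<phi>' \<Gamma> \<psi> \<sigma> N)"
| "sub (Exists x \<phi>) \<Gamma> \<psi> \<sigma> N =
    DExs 1 (sub \<phi> \<Gamma> (\<lambda>X. lift (the (\<Gamma> X)) 1 (\<psi> X)) (\<lambda>y. if y = x then 0 else Suc (\<sigma> y)) N)"
| "sub (Mu Y ys \<phi>) \<Gamma> \<psi> \<sigma> N = (let k = length ys in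
    app (Mu N [0..<k] (sub \<phi> (\<Gamma>(Y \<mapsto> k))
      ((\<lambda>X. lift (the (\<Gamma> X)) k (\<psi> X))(Y := RVar N (map Var [0..<k])))
      (upds (\<lambda>y. k + \<sigma> y) ys [0..<k]) (Suc N)))
    (map (\<lambda>y. Var (\<sigma> y)) ys))"

text \<open>Signs multiply: an occurrence of \<open>Z\<close> with polarity \<open>b = c\<close>,
  inside a formula put for an occurrence of \<open>X\<close> with polarity \<open>b\<close>, has
  polarity \<open>c\<close>. The first disjunct covers formulas without \<open>Z\<close>, whose
  variable \<open>X\<close> may occur in either polarity.\<close>

lemma polarity_sub:
  assumes "wf_fm A \<Gamma> \<phi>" "Z < N"
    "\<And>X. X \<in> dom \<Gamma> \<Longrightarrow>
      (\<forall>b. polarity b Z (\<psi> X)) \<or> (\<exists>b. polarity b X \<phi> \<and> polarity (b = c) Z (\<psi> X))"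
  shows "polarity c Z (sub \<phi> \<Gamma> \<psi> \<sigma> N)"
  using assms
proof (induction \<phi> arbitrary: \<Gamma> \<psi> \<sigma> N c)
  case (RVar X ts)
  then have "X \<in> dom \<Gamma>" by auto
  then show ?case using RVar.prems(3)[of X] by (cases c) auto
next
  case (Neg \<phi>)
  have "(\<forall>b. polarity b Z (\<psi> X)) \<or> (\<exists>b. polarity b X \<phi> \<and> polarity (b = (\<not> c)) Z (\<psi> X))"
    if "X \<in> dom \<Gamma>" for X
    using Neg.prems(3)[OF that]
  proof (elim disjE exE)
    fix b assume "polarity b X (Neg \<phi>) \<and> polarity (b = c) Z (\<psi> X)"
    then show ?thesis by (intro disjI2 exI[of _ "\<not> b"]) simp
  qed simp
  then show ?case using Neg.prems Neg.IH[of \<Gamma> N \<psi> "\<not> c"] by simp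
next
  case (And \<phi> \<phi>')
  have "polarity c Z (sub \<phi> \<Gamma> \<psi> \<sigma> N)"
    using And.prems by (intro And.IH(1)) (simp, simp, fastforce)
  moreover have "polarity c Z (sub \<phi>' \<Gamma> \<psi> \<sigma> N)"
    using And.prems by (intro And.IH(2)) (simp, simp, fastforce)
  ultimately show ?case by simp
next
  case (Exists x \<phi>)
  then show ?case by simp
next
  case (Mu Y ys \<phi>)
  define k where "k = length ys"
  define \<psi>' where "\<psi>' = (\<lambda>X. lift (the (\<Gamma> X)) k (\<psi> X))(Y := RVar N (map Var [0..<k]))"
  have "polarity c Z (sub \<phi> (\<Gamma>(Y \<mapsto> k)) \<psi>' \<sigma>' (Suc N))" for \<sigma>'
  proof (rule Mu.IH)
    show "wf_fm A (\<Gamma>(Y \<mapsto> k)) \<phi>" "Z < Suc N"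
      using Mu.prems(1,2) by (simp_all add: k_def)
    fix X assume "X \<in> dom (\<Gamma>(Y \<mapsto> k))"
    then show "(\<forall>b. polarity b Z (\<psi>' X)) \<or> (\<exists>b. polarity b X \<phi> \<and> polarity (b = c) Z (\<psi>' X))"
      using Mu.prems(2) Mu.prems(3)[of X] by (cases "X = Y") (auto simp: \<psi>'_def)
  qed
  then show ?case
    by (simp add: Let_def \<psi>'_def k_def)
qed simp_all

lemma wf_sub:
  assumes "wf_fm A \<Gamma> \<phi>" "dom \<Delta> \<subseteq> {..<N}" "\<And>X. X \<in> dom \<Gamma> \<Longrightarrow> wf_fm A \<Delta> (\<psi> X)"
  shows "wf_fm A \<Delta> (sub \<phi> \<Gamma> \<psi> \<sigma> N)"
  using assms
proof (induction \<phi> arbitrary: \<Gamma> \<Delta> \<psi> \<sigma> N)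
  case (RVar X ts)
  then show ?case by (auto intro!: wf_app)
next
  case (Exists x \<phi>)
  have "wf_fm A \<Delta> (lift (the (\<Gamma> X)) 1 (\<psi> X))" if "X \<in> dom \<Gamma>" for X
    using Exists.prems(3)[OF that] by (rule wf_lift)
  then show ?case
    using Exists.prems(1,2) unfolding sub.simps by (intro wf_DExs Exists.IH) simp_all
next
  case (Mu Y ys \<phi>)
  define k where "k = length ys"
  define \<psi>' where "\<psi>' = (\<lambda>X. lift (the (\<Gamma> X)) k (\<psi> X))(Y := RVar N (map Var [0..<k]))"
  define \<sigma>' where "\<sigma>' = upds (\<lambda>y. k + \<sigma> y) ys [0..<k]"
  have N: "\<Delta> N = None" "\<Delta> \<subseteq>\<^sub>m \<Delta>(N \<mapsto> k)"
    using Mu.prems(2) by (auto simp: map_le_def dom_def)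
  have wf: "wf_fm A (\<Gamma>(Y \<mapsto> k)) \<phi>"
    using Mu.prems(1) by (simp add: k_def)
  have "wf_fm A (\<Delta>(N \<mapsto> k)) (sub \<phi> (\<Gamma>(Y \<mapsto> k)) \<psi>' \<sigma>' (Suc N))"
  proof (rule Mu.IH[OF wf])
    show "dom (\<Delta>(N \<mapsto> k)) \<subseteq> {..<Suc N}" using Mu.prems(2) by fastforce
    show "wf_fm A (\<Delta>(N \<mapsto> k)) (\<psi>' X)" if "X \<in> dom (\<Gamma>(Y \<mapsto> k))" for X
    proof (cases "X = Y")
      case False
      then have "wf_fm A \<Delta> (\<psi> X)" using that Mu.prems(3) by auto
      then show ?thesis using False N(2) by (auto simp: \<psi>'_def intro!: wf_lift intro: wf_fm_mono)
    qed (auto simp: \<psi>'_def)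
  qed
  \<comment> \<open>\<open>N\<close> enters only through \<open>Y\<close>, in which
    \<open>\<phi>\<close> is positive; the other substituted formulas live over
    \<open>\<Delta>\<close>, which omits \<open>N\<close>.\<close>
  moreover have "only_positive N (sub \<phi> (\<Gamma>(Y \<mapsto> k)) \<psi>' \<sigma>' (Suc N))"
  proof (rule polarity_sub[OF wf])
    fix X assume "X \<in> dom (\<Gamma>(Y \<mapsto> k))"
    then show "(\<forall>b. polarity b N (\<psi>' X)) \<or> (\<exists>b. polarity b X \<phi> \<and> polarity (b = True) N (\<psi>' X))"
      using Mu.prems(1) polarity_fresh[OF Mu.prems(3) N(1), of X]
      by (cases "X = Y") (auto simp: \<psi>'_def)
  qed simp
  ultimately show ?case
    unfolding sub.simps Let_def k_def[symmetric] \<psi>'_def[symmetric] \<sigma>'_def[symmetric]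
    by (intro wf_app) (auto simp del: fun_upd_apply)
next
  case (And \<phi> \<phi>')
  then show ?case by simp
qed simp_all

text \<open>Below a quantifier, \<open>push\<close> extends the environment and \<open>lift\<close>
  keeps each \<open>\<psi> X\<close> defining the same relation. Below \<open>Mu\<close>, the
  variable \<open>Y\<close> becomes \<open>RVar N\<close>, and the operators on both sides agree on
  every set \<open>S\<close>, hence so do their least fixed points.\<close>

lemma sat_sub:
  fixes A :: "'a fo_structure"
  assumes "wf_fm A \<Gamma> \<phi>" "dom \<Delta> \<subseteq> {..<N}" "\<And>X. X \<in> dom \<Gamma> \<Longrightarrow> wf_fm A \<Delta> (\<psi> X)"
    "\<And>X k as. \<Gamma> X = Some k \<Longrightarrow> length as = k \<Longrightarrow> as \<in> R' X \<longleftrightarrow> sat A R (push as e) (\<psi> X)"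
  shows "sat A R e (sub \<phi> \<Gamma> \<psi> \<sigma> N) \<longleftrightarrow> sat A R' (e \<circ> \<sigma>) \<phi>"
  using assms
proof (induction \<phi> arbitrary: \<Gamma> \<Delta> \<psi> \<sigma> N R R' e)
  case (Rel r ts)
  have "map (eval A e) (map (ren_tm \<sigma>) ts) = map (eval A (e \<circ> \<sigma>)) ts" by simp
  then show ?case by (simp only: sub.simps sat.simps)
next
  case (RVar X ts)
  have "map (eval A e) (map (ren_tm \<sigma>) ts) = map (eval A (e \<circ> \<sigma>)) ts" by simp
  moreover have "wf_fm A \<Delta> (\<psi> X)" "\<Gamma> X = Some (length ts)"
    using RVar.prems(1) by (auto intro!: RVar.prems(3))
  ultimately show ?case
    using RVar.prems(4)[of X "length ts" "map (eval A (e \<circ> \<sigma>)) ts"]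
    by (simp only: sub.simps sat.simps sat_app length_map)
next
  case (Neg \<phi>)
  have "sat A R e (sub \<phi> \<Gamma> \<psi> \<sigma> N) = sat A R' (e \<circ> \<sigma>) \<phi>"
    using Neg.prems(1) by (intro Neg.IH[OF _ Neg.prems(2-4)]) simp_all
  then show ?case by (simp only: sub.simps sat.simps)
next
  case (And \<phi> \<phi>')
  have "sat A R e (sub \<phi> \<Gamma> \<psi> \<sigma> N) = sat A R' (e \<circ> \<sigma>) \<phi>"
    using And.prems(1) by (intro And.IH(1)[OF _ And.prems(2-4)]) simp_all
  moreover have "sat A R e (sub \<phi>' \<Gamma> \<psi> \<sigma> N) = sat A R' (e \<circ> \<sigma>) \<phi>'"
    using And.prems(1) by (intro And.IH(2)[OF _ And.prems(2-4)]) simp_all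
  ultimately show ?case by (simp only: sub.simps sat.simps)
next
  case (Exists x \<phi>)
  define \<psi>' where "\<psi>' = (\<lambda>X. lift (the (\<Gamma> X)) 1 (\<psi> X))"
  define \<sigma>' where "\<sigma>' = (\<lambda>y. if y = x then 0 else Suc (\<sigma> y))"
  have wf: "wf_fm A \<Gamma> \<phi>" using Exists.prems(1) by simp
  have wf': "wf_fm A \<Delta> (\<psi>' X)" if "X \<in> dom \<Gamma>" for X
    using Exists.prems(3)[OF that] by (simp add: \<psi>'_def wf_lift)
  have "sat A R (push [a] e) (sub \<phi> \<Gamma> \<psi>' \<sigma>' N) = sat A R' (push [a] e \<circ> \<sigma>') \<phi>" for a
  proof (rule Exists.IH[OF wf Exists.prems(2) wf'])
    fix X k and bs :: "'a list"
    assume "\<Gamma> X = Some k" "length bs = k"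
    moreover from this have "wf_fm A \<Delta> (\<psi> X)" by (intro Exists.prems(3)) auto
    ultimately show "bs \<in> R' X \<longleftrightarrow> sat A R (push bs (push [a] e)) (\<psi>' X)"
      using Exists.prems(4)[of X k bs] by (simp add: \<psi>'_def sat_lift)
  qed
  moreover have "push [a] e \<circ> \<sigma>' = (e \<circ> \<sigma>)(x := a)" for a
    by (auto simp: fun_eq_iff \<sigma>'_def push_def)
  ultimately have "sat A R (push [a] e) (sub \<phi> \<Gamma> \<psi>' \<sigma>' N) = sat A R' ((e \<circ> \<sigma>)(x := a)) \<phi>" for a
    by simp
  moreover have "sat A R e (sub (Exists x \<phi>) \<Gamma> \<psi> \<sigma> N) \<longleftrightarrow>
      (\<exists>a. sat A R (push [a] e) (sub \<phi> \<Gamma> \<psi>' \<sigma>' N))"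
    unfolding sub.simps \<psi>'_def[symmetric] \<sigma>'_def[symmetric]
    using sat_DExs[OF wf_sub[OF wf Exists.prems(2) wf', where \<sigma>=\<sigma>'], where R=R and e=e and k=1]
    by (auto simp: length_Suc_conv)
  ultimately show ?case by (simp only: sat.simps)
next
  case (Mu Y ys \<phi>)
  define k where "k = length ys"
  define \<psi>' where "\<psi>' = (\<lambda>X. lift (the (\<Gamma> X)) k (\<psi> X))(Y := RVar N (map Var [0..<k]))"
  define \<sigma>' where "\<sigma>' = upds (\<lambda>y. k + \<sigma> y) ys [0..<k]"
  define \<Phi> where "\<Phi> = sub \<phi> (\<Gamma>(Y \<mapsto> k)) \<psi>' \<sigma>' (Suc N)"
  define bs where "bs = map (e \<circ> \<sigma>) ys"
  have N: "\<Delta> N = None" "\<Delta> \<subseteq>\<^sub>m \<Delta>(N \<mapsto> k)" "dom (\<Delta>(N \<mapsto> k)) \<subseteq> {..<Suc N}"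
    using Mu.prems(2) by (auto simp: map_le_def dom_def less_Suc_eq)
  have wf: "distinct ys" "wf_fm A (\<Gamma>(Y \<mapsto> k)) \<phi>"
    using Mu.prems(1) by (simp_all add: k_def)
  have \<psi>X: "wf_fm A \<Delta> (\<psi> X)" if "X \<in> dom (\<Gamma>(Y \<mapsto> k))" "X \<noteq> Y" for X
    using that Mu.prems(3) by auto
  have wf': "wf_fm A (\<Delta>(N \<mapsto> k)) (\<psi>' X)" if "X \<in> dom (\<Gamma>(Y \<mapsto> k))" for X
    using \<psi>X[OF that] N(2) by (auto simp: \<psi>'_def intro!: wf_lift intro: wf_fm_mono)
  have body: "sat A (R(N := S)) (push as e) \<Phi> = sat A (R'(Y := S)) (upds (e \<circ> \<sigma>) ys as) \<phi>"
    if "length as = k" for S as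
  proof -
    have "sat A (R(N := S)) (push as e) \<Phi> = sat A (R'(Y := S)) (push as e \<circ> \<sigma>') \<phi>"
      unfolding \<Phi>_def
    proof (rule Mu.IH[OF wf(2) N(3) wf'])
      fix X l and cs :: "'a list"
      assume l: "(\<Gamma>(Y \<mapsto> k)) X = Some l" "length cs = l"
      show "cs \<in> (R'(Y := S)) X \<longleftrightarrow> sat A (R(N := S)) (push cs (push as e)) (\<psi>' X)"
      proof (cases "X = Y")
        case True
        then show ?thesis using l map_push[of cs k] by (simp add: \<psi>'_def comp_def)
      next
        case False
        then have X: "\<Gamma> X = Some l" "wf_fm A \<Delta> (\<psi> X)" using l \<psi>X by auto
        have "sat A (R(N := S)) (push cs (push as e)) (\<psi>' X) = sat A (R(N := S)) (push cs e) (\<psi> X)"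
          using X l that False by (simp add: \<psi>'_def sat_lift)
        also have "\<dots> = sat A R (push cs e) (\<psi> X)"
          using X(2) N(1) by (intro sat_cong) auto
        also have "\<dots> \<longleftrightarrow> cs \<in> R' X"
          using Mu.prems(4)[OF X(1) l(2)] by simp
        finally show ?thesis using False by simp
      qed
    qed
    also have "push as e \<circ> \<sigma>' = upds (e \<circ> \<sigma>) ys as"
    proof
      fix x show "(push as e \<circ> \<sigma>') x = upds (e \<circ> \<sigma>) ys as x"
      proof (cases "x \<in> set ys")
        case True
        then obtain i where "i < length ys" "x = ys ! i" by (auto simp: in_set_conv_nth)
        then show ?thesis
          using wf that by (simp add: upds_nth k_def \<sigma>'_def push_def)
      next
        case False
        then show ?thesis using that by (simp add: upds_notin \<sigma>'_def push_def)
      qed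
    qed
    finally show ?thesis .
  qed
  have F: "{as. length as = length [0..<k] \<and> sat A (R(N := S)) (upds (push bs e) [0..<k] as) \<Phi>} =
      {as. length as = length ys \<and> sat A (R'(Y := S)) (upds (e \<circ> \<sigma>) ys as) \<phi>}" for S
    using body upds_push[of bs k _ e] by (auto simp: k_def bs_def)
  have "only_positive N \<Phi>"
    unfolding \<Phi>_def
  proof (rule polarity_sub[OF wf(2)])
    fix X assume "X \<in> dom (\<Gamma>(Y \<mapsto> k))"
    then show "(\<forall>b. polarity b N (\<psi>' X)) \<or> (\<exists>b. polarity b X \<phi> \<and> polarity (b = True) N (\<psi>' X))"
      using Mu.prems(1) polarity_fresh[OF \<psi>X N(1), of X]
      by (cases "X = Y") (auto simp: \<psi>'_def)
  qed simp
  then have "wf_fm A \<Delta> (Mu N [0..<k] \<Phi>)"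
    using wf_sub[OF wf(2) N(3) wf', where \<sigma>=\<sigma>'] by (simp add: \<Phi>_def)
  then have "sat A R e (sub (Mu Y ys \<phi>) \<Gamma> \<psi> \<sigma> N) = sat A R (push bs e) (Mu N [0..<k] \<Phi>)"
    unfolding sub.simps Let_def k_def[symmetric] \<psi>'_def[symmetric] \<sigma>'_def[symmetric] \<Phi>_def[symmetric]
    by (subst sat_app) (auto simp: bs_def comp_def simp del: sat.simps)
  also have "map (push bs e) [0..<k] = bs"
    by (rule map_push) (simp add: bs_def k_def)
  then have "sat A R (push bs e) (Mu N [0..<k] \<Phi>) = sat A R' (e \<circ> \<sigma>) (Mu Y ys \<phi>)"
    by (simp only: sat.simps F flip: bs_def)
  finally show ?case .
qed simp

section \<open>Eliminating fixed points that close after boundedly many stages\<close>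

text \<open>Only \<open>X\<close> is interpreted: substitution removes all other relation variables
  before a fixed point is unfolded.\<close>

definition operator ::
  "'a fo_structure \<Rightarrow> nat \<Rightarrow> nat \<Rightarrow> fm \<Rightarrow> (nat \<Rightarrow> 'a) \<Rightarrow> 'a list set \<Rightarrow> 'a list set" where
  "operator A X k \<Phi> e S = {as. length as = k \<and> sat A (no_rels(X := S)) (push as e) \<Phi>}"

definition stage :: "'a fo_structure \<Rightarrow> nat \<Rightarrow> nat \<Rightarrow> fm \<Rightarrow> (nat \<Rightarrow> 'a) \<Rightarrow> nat \<Rightarrow> 'a list set" where
  "stage A X k \<Phi> e n = (operator A X k \<Phi> e ^^ n) {}"

lemma stage_simps [simp]:
  "stage A X k \<Phi> e 0 = {}"
  "stage A X k \<Phi> e (Suc n) = operator A X k \<Phi> e (stage A X k \<Phi> e n)"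
  by (simp_all add: stage_def)

lemma mono_operator: "only_positive X \<Phi> \<Longrightarrow> mono (operator A X k \<Phi> e)"
  unfolding operator_def using polarity_mono[of _ _ X \<Phi> A no_rels] by (intro monoI Collect_mono) blast

text \<open>The bound \<open>n\<close> precedes the parameters \<open>e\<close>, since the first
  order formula for the \<open>n\<close>-th stage must serve all environments.\<close>

definition bounded_closure :: "'a fo_structure \<Rightarrow> bool" where
  "bounded_closure A \<longleftrightarrow> (\<forall>X k \<Phi>. wf_fm A [X \<mapsto> k] \<Phi> \<longrightarrow> only_positive X \<Phi> \<longrightarrow>
    (\<exists>n. \<forall>e. stage A X k \<Phi> e n = stage A X k \<Phi> e (Suc n)))"

lemma sat_Mu_upt:
  assumes "length bs = k"
  shows "sat A no_rels (push bs e) (Mu X [0..<k] \<Phi>) \<longleftrightarrow> bs \<in> lfp (operator A X k \<Phi> e)"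
proof -
  have "{as. length as = length [0..<k] \<and>
      sat A (no_rels(X := S)) (upds (push bs e) [0..<k] as) \<Phi>} = operator A X k \<Phi> e S" for S
    using upds_push[OF assms, of _ e] by (auto simp: operator_def)
  then show ?thesis
    using map_push[OF assms] by (simp only: sat.simps)
qed

lemma lfp_operator:
  assumes "only_positive X \<Phi>" "stage A X k \<Phi> e n = stage A X k \<Phi> e (Suc n)"
  shows "lfp (operator A X k \<Phi> e) = stage A X k \<Phi> e n"
  unfolding stage_def using assms(2) mono_operator[OF assms(1)]
  by (intro lfp_Kleene_iter) (auto simp: stage_def)

text \<open>Unfolding a fixed point puts stage formulas of growing size in place of its variable, so
  an induction on the resulting formula would fail. The induction is on \<open>\<phi>\<close> with
  its relation variables still open and arbitrary first order formulas \<open>\<psi> X\<close> for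
  them; the hypothesis for the body of \<open>Mu\<close> then applies to every stage
  formula.\<close>

lemma first_order_sub:
  fixes A :: "'a fo_structure"
  assumes "bounded_closure A" "wf_fm A \<Gamma> \<phi>"
    "\<And>X. X \<in> dom \<Gamma> \<Longrightarrow> first_order (\<psi> X) \<and> wf_fm A Map.empty (\<psi> X)"
  shows "\<exists>\<chi>. first_order \<chi> \<and> wf_fm A Map.empty \<chi> \<and>
    (\<forall>e. sat A no_rels e \<chi> \<longleftrightarrow> sat A no_rels e (sub \<phi> \<Gamma> \<psi> \<sigma> N))"
  using assms(2,3)
proof (induction \<phi> arbitrary: \<Gamma> \<psi> \<sigma> N)
  case (Eq s t)
  then show ?case by (intro exI[of _ "sub (Eq s t) \<Gamma> \<psi> \<sigma> N"]) simp
next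
  case (Rel r ts)
  then show ?case by (intro exI[of _ "sub (Rel r ts) \<Gamma> \<psi> \<sigma> N"]) simp
next
  case (RVar X ts)
  then have "X \<in> dom \<Gamma>" by auto
  then show ?case
    using RVar by (intro exI[of _ "sub (RVar X ts) \<Gamma> \<psi> \<sigma> N"]) (simp add: wf_app)
next
  case (Neg \<phi>)
  obtain \<chi> where "first_order \<chi>" "wf_fm A Map.empty \<chi>"
    "\<And>e. sat A no_rels e \<chi> \<longleftrightarrow> sat A no_rels e (sub \<phi> \<Gamma> \<psi> \<sigma> N)"
    using Neg.IH[where \<Gamma>=\<Gamma> and \<psi>=\<psi> and \<sigma>=\<sigma> and N=N] Neg.prems by auto
  then show ?case by (intro exI[of _ "Neg \<chi>"]) simp
next
  case (And \<phi> \<phi>')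
  obtain \<chi> where \<chi>: "first_order \<chi>" "wf_fm A Map.empty \<chi>"
    "\<And>e. sat A no_rels e \<chi> \<longleftrightarrow> sat A no_rels e (sub \<phi> \<Gamma> \<psi> \<sigma> N)"
    using And.IH(1)[where \<Gamma>=\<Gamma> and \<psi>=\<psi> and \<sigma>=\<sigma> and N=N] And.prems by auto
  obtain \<chi>' where "first_order \<chi>'" "wf_fm A Map.empty \<chi>'"
    "\<And>e. sat A no_rels e \<chi>' \<longleftrightarrow> sat A no_rels e (sub \<phi>' \<Gamma> \<psi> \<sigma> N)"
    using And.IH(2)[where \<Gamma>=\<Gamma> and \<psi>=\<psi> and \<sigma>=\<sigma> and N=N] And.prems by auto
  then show ?case using \<chi> by (intro exI[of _ "And \<chi> \<chi>'"]) simp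
next
  case (Exists x \<phi>)
  define \<psi>' where "\<psi>' = (\<lambda>X. lift (the (\<Gamma> X)) 1 (\<psi> X))"
  define \<sigma>' where "\<sigma>' = (\<lambda>y. if y = x then 0 else Suc (\<sigma> y))"
  have \<psi>': "first_order (\<psi>' X) \<and> wf_fm A Map.empty (\<psi>' X)" if "X \<in> dom \<Gamma>" for X
    using Exists.prems(2)[OF that] by (simp add: \<psi>'_def wf_lift)
  have wf: "wf_fm A \<Gamma> \<phi>" using Exists.prems(1) by simp
  obtain \<chi> where \<chi>: "first_order \<chi>" "wf_fm A Map.empty \<chi>"
    "\<And>e. sat A no_rels e \<chi> \<longleftrightarrow> sat A no_rels e (sub \<phi> \<Gamma> \<psi>' \<sigma>' N)"
    using Exists.IH[where \<psi>=\<psi>', OF wf \<psi>', where \<sigma>=\<sigma>' and N=N] by auto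
  have "wf_fm A Map.empty (sub \<phi> \<Gamma> \<psi>' \<sigma>' N)"
    using \<psi>' by (intro wf_sub[OF wf]) auto
  then show ?case
    using \<chi> unfolding sub.simps \<psi>'_def[symmetric] \<sigma>'_def[symmetric]
    by (intro exI[of _ "DExs 1 \<chi>"]) (simp add: wf_DExs sat_DExs)
next
  case (Mu Y ys \<phi>)
  define k where "k = length ys"
  define \<psi>' where "\<psi>' = (\<lambda>\<theta>. (\<lambda>X. lift (the (\<Gamma> X)) k (\<psi> X))(Y := \<theta>))"
  define \<sigma>' where "\<sigma>' = upds (\<lambda>y. k + \<sigma> y) ys [0..<k]"
  define R where "R = (\<lambda>e X. {as. sat A no_rels (push as e) (\<psi> X)})"
  let ?\<Gamma> = "\<Gamma>(Y \<mapsto> k)"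
  define \<Phi> where "\<Phi> = sub \<phi> ?\<Gamma> (\<psi>' (RVar N (map Var [0..<k]))) \<sigma>' (Suc N)"
  have wf: "wf_fm A ?\<Gamma> \<phi>" "only_positive Y \<phi>"
    using Mu.prems(1) by (simp_all add: k_def)
  have \<psi>X: "first_order (\<psi> X)" "wf_fm A \<Delta> (\<psi> X)" if "X \<in> dom ?\<Gamma>" "X \<noteq> Y" for X \<Delta>
    using that Mu.prems(2)[of X] by (auto intro: wf_fm_mono)
  have \<psi>': "wf_fm A \<Delta> (\<psi>' \<theta> X)" if "X \<in> dom ?\<Gamma>" "wf_fm A \<Delta> \<theta>" for \<theta> X \<Delta>
    using that \<psi>X(2)[OF that(1)] by (simp add: \<psi>'_def wf_lift)
  have wf_\<Phi>: "wf_fm A [N \<mapsto> k] \<Phi>"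
    unfolding \<Phi>_def by (intro wf_sub[OF wf(1)] \<psi>') auto
  \<comment> \<open>The body depends on the formula \<open>\<theta>\<close> put for \<open>Y\<close>
    only through the set \<open>S\<close> that it defines. This is used with \<open>\<theta>\<close>
    the variable \<open>RVar N\<close>, to identify the operator, and with \<open>\<theta>\<close> a
    stage formula.\<close>
  have sat_sub': "sat A R' (push as e) (sub \<phi> ?\<Gamma> (\<psi>' \<theta>) \<sigma>' M) \<longleftrightarrow>
      sat A ((R e)(Y := S)) (push as e \<circ> \<sigma>') \<phi>"
    if "wf_fm A \<Delta> \<theta>" "dom \<Delta> \<subseteq> {..<M}" "length as = k"
      "\<And>bs. length bs = k \<Longrightarrow> bs \<in> S \<longleftrightarrow> sat A R' (push bs (push as e)) \<theta>" for \<theta> \<Delta> M as e S R'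
  proof (rule sat_sub[OF wf(1) that(2)])
    fix X l and cs :: "'a list" assume l: "?\<Gamma> X = Some l" "length cs = l"
    show "cs \<in> ((R e)(Y := S)) X \<longleftrightarrow> sat A R' (push cs (push as e)) (\<psi>' \<theta> X)"
    proof (cases "X = Y")
      case True
      then show ?thesis using that l by (simp add: \<psi>'_def)
    next
      case False
      then have X: "\<Gamma> X = Some l" "wf_fm A Map.empty (\<psi> X)" using l \<psi>X by auto
      then have "sat A R' (push cs (push as e)) (\<psi>' \<theta> X) = sat A R' (push cs e) (\<psi> X)"
        using l that False by (simp add: \<psi>'_def sat_lift)
      also have "\<dots> = sat A no_rels (push cs e) (\<psi> X)"
        by (rule sat_cong_closed[OF X(2)]) simp
      finally show ?thesis using False by (simp add: R_def)
    qed
  qed (use \<psi>' that in auto)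
  have operator: "operator A N k \<Phi> e S =
      {as. length as = k \<and> sat A ((R e)(Y := S)) (push as e \<circ> \<sigma>') \<phi>}" for e S
    unfolding operator_def \<Phi>_def
    by (intro Collect_cong conj_cong refl sat_sub'[where \<Delta>="[N \<mapsto> k]"])
      (simp_all add: comp_def map_push)
  have pos: "only_positive N \<Phi>"
    unfolding \<Phi>_def
  proof (rule polarity_sub[OF wf(1)])
    fix X assume "X \<in> dom ?\<Gamma>"
    then show "(\<forall>b. polarity b N (\<psi>' (RVar N (map Var [0..<k])) X)) \<or>
        (\<exists>b. polarity b X \<phi> \<and> polarity (b = True) N (\<psi>' (RVar N (map Var [0..<k])) X))"
      using wf(2) polarity_fresh[OF \<psi>X(2)[of X Map.empty]]
      by (cases "X = Y") (auto simp: \<psi>'_def)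
  qed simp
  have "\<exists>\<theta>. first_order \<theta> \<and> wf_fm A Map.empty \<theta> \<and>
      (\<forall>e as. length as = k \<longrightarrow> (as \<in> stage A N k \<Phi> e n \<longleftrightarrow> sat A no_rels (push as e) \<theta>))" for n
  proof (induction n)
    case 0
    then show ?case by (intro exI[of _ Falsum]) simp
  next
    case (Suc n)
    then obtain \<theta> where \<theta>: "first_order \<theta>" "wf_fm A Map.empty \<theta>"
      "\<And>e as. length as = k \<Longrightarrow> as \<in> stage A N k \<Phi> e n \<longleftrightarrow> sat A no_rels (push as e) \<theta>"
      by auto
    \<comment> \<open>The stage formula reads its parameters from \<open>e\<close>, but inside the
      body the context is \<open>push as e\<close>.\<close>
    define \<theta>' where "\<theta>' = lift k k \<theta>"
    have fo: "first_order (\<psi>' \<theta>' X) \<and> wf_fm A Map.empty (\<psi>' \<theta>' X)" if "X \<in> dom ?\<Gamma>" for X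
      using \<psi>X[OF that] \<psi>'[OF that] \<theta> by (auto simp: \<theta>'_def \<psi>'_def wf_lift)
    obtain \<chi> where \<chi>: "first_order \<chi>" "wf_fm A Map.empty \<chi>"
      "\<And>e. sat A no_rels e \<chi> \<longleftrightarrow> sat A no_rels e (sub \<phi> ?\<Gamma> (\<psi>' \<theta>') \<sigma>' N)"
      using Mu.IH[where \<psi>="\<psi>' \<theta>'", OF wf(1) fo, where \<sigma>=\<sigma>' and N=N] by blast
    have "as \<in> stage A N k \<Phi> e (Suc n) \<longleftrightarrow> sat A no_rels (push as e) \<chi>" if "length as = k" for e as
    proof -
      have "sat A no_rels (push as e) \<chi> =
          sat A ((R e)(Y := stage A N k \<Phi> e n)) (push as e \<circ> \<sigma>') \<phi>"
        unfolding \<chi>(3) using \<theta> that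
        by (intro sat_sub'[where \<Delta>=Map.empty]) (simp_all add: \<theta>'_def wf_lift sat_lift)
      then show ?thesis using that by (simp add: operator)
    qed
    then show ?case using \<chi> by blast
  qed
  moreover obtain n where n: "\<And>e. stage A N k \<Phi> e n = stage A N k \<Phi> e (Suc n)"
    using assms(1) wf_\<Phi> pos unfolding bounded_closure_def by blast
  ultimately obtain \<theta> where \<theta>: "first_order \<theta>" "wf_fm A Map.empty \<theta>"
      "\<And>e as. length as = k \<Longrightarrow> as \<in> stage A N k \<Phi> e n \<longleftrightarrow> sat A no_rels (push as e) \<theta>"
    by blast
  have "sat A no_rels (push bs e) \<theta> = sat A no_rels (push bs e) (Mu N [0..<k] \<Phi>)"
    if "length bs = k" for bs e
    using \<theta>(3)[OF that] sat_Mu_upt[OF that] lfp_operator[OF pos n] by blast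
  moreover have "wf_fm A Map.empty (Mu N [0..<k] \<Phi>)"
    using wf_\<Phi> pos by simp
  ultimately have "sat A no_rels e (app \<theta> (map (\<lambda>y. Var (\<sigma> y)) ys)) =
      sat A no_rels e (sub (Mu Y ys \<phi>) \<Gamma> \<psi> \<sigma> N)" for e
    using \<theta>(2) unfolding sub.simps Let_def k_def[symmetric] \<sigma>'_def[symmetric]
      \<psi>'_def[THEN fun_cong, symmetric] \<Phi>_def[symmetric]
    by (simp add: sat_app k_def del: sat.simps wf_fm.simps)
  then show ?case
    using \<theta> by (intro exI[of _ "app \<theta> (map (\<lambda>y. Var (\<sigma> y)) ys)"]) (simp add: wf_app)
qed

lemma sat_exs_irrelevant:
  assumes "\<And>e e' . (\<And>x. x \<in> V \<Longrightarrow> e x = e' x) \<Longrightarrow> sat A R e \<phi> \<longleftrightarrow> sat A R e' \<phi>"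
    "distinct xs" "set xs \<inter> V = {}"
  shows "sat A R e (exs xs \<phi>) \<longleftrightarrow> sat A R e \<phi>"
proof -
  have "sat A R (upds e xs as) \<phi> = sat A R e \<phi>" for as
    using assms(3) by (intro assms(1) upds_notin) auto
  then show ?thesis
    using Ex_list_of_length[of "length xs"] by (auto simp: sat_exs[OF assms(2)])
qed

lemma bounded_closure_first_order:
  assumes "bounded_closure A" "wf_fm A Map.empty \<phi>"
  shows "\<exists>\<psi>. first_order \<psi> \<and> wf_fm A Map.empty \<psi> \<and> fv \<psi> \<subseteq> fv \<phi> \<and>
    (\<forall>e. sat A no_rels e \<phi> \<longleftrightarrow> sat A no_rels e \<psi>)"
proof -
  obtain \<chi> where \<chi>: "first_order \<chi>" "wf_fm A Map.empty \<chi>"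
    "\<And>e. sat A no_rels e \<chi> \<longleftrightarrow> sat A no_rels e (sub \<phi> Map.empty (\<lambda>_. Falsum) id 0)"
    using first_order_sub[OF assms, of "\<lambda>_. Falsum" id 0] by auto
  have \<chi>\<phi>: "sat A no_rels e \<chi> \<longleftrightarrow> sat A no_rels e \<phi>" for e
    unfolding \<chi>(3) using sat_sub[OF assms(2), of Map.empty 0 _ no_rels no_rels e id] by simp
  \<comment> \<open>Elimination may leave free variables on which the truth value does not depend,
    such as variable 0 of \<open>Falsum\<close>; they are quantified away.\<close>
  define xs where "xs = sorted_list_of_set (fv \<chi> - fv \<phi>)"
  have xs: "distinct xs" "set xs = fv \<chi> - fv \<phi>"
    by (simp_all add: xs_def)
  have "sat A no_rels e (exs xs \<chi>) \<longleftrightarrow> sat A no_rels e \<chi>" for e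
    using xs sat_cong_closed[OF assms(2)] by (intro sat_exs_irrelevant[where V="fv \<phi>"]) (auto simp: \<chi>\<phi>)
  then show ?thesis
    using \<chi> xs \<chi>\<phi> by (intro exI[of _ "exs xs \<chi>"]) auto
qed

section \<open>Recursive functions\<close>

text \<open>As a predicate of functions, \<open>recursive\<close> also constrains the values on
  lists of other lengths than \<open>n\<close>. Forgetting these values allows functions to be given
  in any convenient form.\<close>

definition computable :: "nat \<Rightarrow> (nat list \<Rightarrow> nat) \<Rightarrow> bool" where
  "computable n f \<longleftrightarrow> (\<exists>g. recursive n g \<and> (\<forall>xs. length xs = n \<longrightarrow> g xs = f xs))"

lemma computable_cong:
  "computable n f \<Longrightarrow> (\<And>xs. length xs = n \<Longrightarrow> f xs = g xs) \<Longrightarrow> computable n g"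
  unfolding computable_def by fastforce

lemma computable_proj: "i < n \<Longrightarrow> computable n (\<lambda>xs. xs ! i)"
  using recursive.proj unfolding computable_def by blast

lemma computable_comp:
  assumes "computable (length gs) f" "\<And>g. g \<in> set gs \<Longrightarrow> computable n g"
  shows "computable n (\<lambda>xs. f (map (\<lambda>g. g xs) gs))"
proof -
  from assms(1) obtain f' where f': "recursive (length gs) f'"
    "\<And>xs. length xs = length gs \<Longrightarrow> f' xs = f xs"
    unfolding computable_def by auto
  from assms(2) obtain h where h: "\<And>g. g \<in> set gs \<Longrightarrow> recursive n (h g)"
    "\<And>g xs. g \<in> set gs \<Longrightarrow> length xs = n \<Longrightarrow> h g xs = g xs"
    unfolding computable_def by metis
  have "recursive n (\<lambda>xs. f' (map (\<lambda>g. g xs) (map h gs)))"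
    using f' h by (intro recursive.comp) auto
  moreover have "f' (map (\<lambda>g. g xs) (map h gs)) = f (map (\<lambda>g. g xs) gs)" if "length xs = n" for xs
  proof -
    have "map (\<lambda>g. g xs) (map h gs) = map (\<lambda>g. g xs) gs" using h that by simp
    then show ?thesis using f'(2)[of "map (\<lambda>g. g xs) gs"] by (simp only: length_map)
  qed
  ultimately show ?thesis unfolding computable_def by blast
qed

lemma computable_comp1: "computable 1 f \<Longrightarrow> computable n g \<Longrightarrow> computable n (\<lambda>xs. f [g xs])"
  using computable_comp[of "[g]" f n] by simp

lemma computable_comp2:
  "computable 2 f \<Longrightarrow> computable n g \<Longrightarrow> computable n h \<Longrightarrow> computable n (\<lambda>xs. f [g xs, h xs])"
  using computable_comp[of "[g, h]" f n] by (auto simp: numeral_2_eq_2)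

lemma computable_prim_rec:
  assumes "computable n g" "computable (Suc (Suc n)) h"
  shows "computable (Suc n) (\<lambda>xs. rec_nat (g (tl xs)) (\<lambda>k r. h (k # r # tl xs)) (hd xs))"
proof -
  obtain g' h' where r: "recursive n g'" "recursive (Suc (Suc n)) h'"
    and eq: "\<And>xs. length xs = n \<Longrightarrow> g' xs = g xs" "\<And>xs. length xs = Suc (Suc n) \<Longrightarrow> h' xs = h xs"
    using assms unfolding computable_def by auto
  have "rec_nat (g' (tl xs)) (\<lambda>k r. h' (k # r # tl xs)) m =
      rec_nat (g (tl xs)) (\<lambda>k r. h (k # r # tl xs)) m" if "length xs = Suc n" for xs m
    using that by (induction m) (simp_all add: eq)
  then show ?thesis
    using recursive.prim_rec[OF r] unfolding computable_def by blast
qed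

lemma computable_Suc: "computable n f \<Longrightarrow> computable n (\<lambda>xs. Suc (f xs))"
proof -
  have "computable 1 (\<lambda>xs. Suc (hd xs))"
    using recursive.succ unfolding computable_def by blast
  then show "computable n f \<Longrightarrow> computable n (\<lambda>xs. Suc (f xs))"
    using computable_comp1[of "\<lambda>xs. Suc (hd xs)" n f] by simp
qed

lemma computable_const: "computable n (\<lambda>_. c)"
proof (induction c)
  case 0
  then show ?case using recursive.zero unfolding computable_def by blast
qed (rule computable_Suc)

lemma computable_add: "computable n f \<Longrightarrow> computable n g \<Longrightarrow> computable n (\<lambda>xs. f xs + g xs)"
proof -
  have "computable (Suc 1) (\<lambda>xs. rec_nat (tl xs ! 0) (\<lambda>k r. Suc ((k # r # tl xs) ! 1)) (hd xs))"
    by (intro computable_prim_rec computable_Suc computable_proj) auto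
  moreover have "rec_nat m (\<lambda>_. Suc) k = k + m" for k m
    by (induction k) auto
  ultimately have "computable 2 (\<lambda>xs. xs ! 0 + xs ! 1)"
    by (auto simp: numeral_2_eq_2 length_Suc_conv elim!: computable_cong)
  then show "computable n f \<Longrightarrow> computable n g \<Longrightarrow> computable n (\<lambda>xs. f xs + g xs)"
    using computable_comp2[of "\<lambda>xs. xs ! 0 + xs ! 1" n f g] by simp
qed

lemma computable_prod_encode:
  assumes "computable n f" "computable n g"
  shows "computable n (\<lambda>xs. prod_encode (f xs, g xs))"
proof -
  \<comment> \<open>\<open>prod_encode (m, n)\<close> is \<open>triangle (m + n) + m\<close>, and
    the triangle numbers arise from 0 by the step that takes \<open>r\<close> at index
    \<open>k\<close> to \<open>Suc (r + k)\<close>.\<close>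
  have "computable (Suc 0) (\<lambda>xs. rec_nat 0 (\<lambda>k r. Suc ((k # r # tl xs) ! 1 + (k # r # tl xs) ! 0)) (hd xs))"
    by (intro computable_prim_rec computable_Suc computable_add computable_proj computable_const) auto
  moreover have "rec_nat 0 (\<lambda>k r. Suc (r + k)) k = triangle k" for k
    by (induction k) auto
  ultimately have "computable 1 (\<lambda>xs. triangle (xs ! 0))"
    by (auto simp: length_Suc_conv elim!: computable_cong)
  then have "computable n (\<lambda>xs. triangle (f xs + g xs))"
    using computable_comp1[of "\<lambda>xs. triangle (xs ! 0)" n] computable_add[OF assms] by simp
  then show ?thesis
    using assms(1) by (simp add: prod_encode_def computable_add)
qed

text \<open>The diagonal argument uses a number both as a code and as an iteration count.\<close>

lemma computable_funpow_diag:
  assumes "computable 1 h"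
  shows "computable 1 (\<lambda>xs. ((\<lambda>m. h [m]) ^^ (xs ! 0)) (xs ! 0))"
proof -
  have "computable (Suc 1) (\<lambda>xs. rec_nat (tl xs ! 0) (\<lambda>k r. h [(k # r # tl xs) ! 1]) (hd xs))"
    by (intro computable_prim_rec computable_comp1[OF assms] computable_proj) auto
  moreover have "rec_nat m (\<lambda>_ r. h [r]) k = ((\<lambda>m. h [m]) ^^ k) m" for k m
    by (induction k) auto
  ultimately have "computable 2 (\<lambda>xs. ((\<lambda>m. h [m]) ^^ (xs ! 0)) (xs ! 1))"
    by (auto simp: numeral_2_eq_2 length_Suc_conv elim!: computable_cong)
  moreover have "computable 1 (\<lambda>xs. xs ! 0)"
    by (rule computable_proj) simp
  ultimately show ?thesis
    using computable_comp2[of "\<lambda>xs. ((\<lambda>m. h [m]) ^^ (xs ! 0)) (xs ! 1)" 1 "\<lambda>xs. xs ! 0" "\<lambda>xs. xs ! 0"]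
    by simp
qed

lemma computable_is_zero: "computable n f \<Longrightarrow> computable n (\<lambda>xs. if f xs = 0 then 1 else 0)"
proof -
  have "computable (Suc 0) (\<lambda>xs. rec_nat 1 (\<lambda>k r. 0) (hd xs))"
    using computable_prim_rec[of 0 "\<lambda>_. 1" "\<lambda>_. 0"] by (simp add: computable_const)
  moreover have "rec_nat 1 (\<lambda>k r. 0) k = (if k = 0 then 1 else 0::nat)" for k
    by (cases k) auto
  ultimately have "computable 1 (\<lambda>xs. if hd xs = 0 then 1 else 0)"
    by (auto elim!: computable_cong)
  then show "computable n f \<Longrightarrow> computable n (\<lambda>xs. if f xs = 0 then 1 else 0)"
    using computable_comp1[of "\<lambda>xs. if hd xs = 0 then 1 else 0" n f] by simp
qed

section \<open>Operations on formulas computed on their codes\<close>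

definition code_computable :: "(fm \<Rightarrow> fm) \<Rightarrow> bool" where
  "code_computable H \<longleftrightarrow> (\<exists>h. computable 1 h \<and> (\<forall>\<theta>. fm_code (H \<theta>) = h [fm_code \<theta>]))"

lemma code_computable_id: "code_computable (\<lambda>\<theta>. \<theta>)"
  unfolding code_computable_def using computable_proj[of 0 1] by (intro exI[of _ "\<lambda>xs. xs ! 0"]) simp

lemma code_computable_Exists: "code_computable H \<Longrightarrow> code_computable (\<lambda>\<theta>. Exists x (H \<theta>))"
  unfolding code_computable_def
  by (elim exE, rule_tac x="\<lambda>xs. prod_encode (5, prod_encode (x, h xs))" in exI)
    (simp add: computable_prod_encode computable_const)

lemma code_computable_And: "code_computable H \<Longrightarrow> code_computable (\<lambda>\<theta>. And \<chi> (H \<theta>))"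
  unfolding code_computable_def
  by (elim exE, rule_tac x="\<lambda>xs. prod_encode (4, prod_encode (fm_code \<chi>, h xs))" in exI)
    (simp add: computable_prod_encode computable_const)

lemma code_computable_exs: "code_computable H \<Longrightarrow> code_computable (\<lambda>\<theta>. exs xs (H \<theta>))"
  unfolding exs_def by (induction xs) (simp_all add: code_computable_Exists)

lemma code_computable_eqs: "code_computable H \<Longrightarrow> code_computable (\<lambda>\<theta>. eqs xts (H \<theta>))"
  unfolding eqs_def by (induction xts) (auto simp: split_beta intro: code_computable_And)

lemma fm_code_funpow:
  assumes "\<And>\<theta>. fm_code (H \<theta>) = h (fm_code \<theta>)"
  shows "fm_code ((H ^^ n) \<theta>) = (h ^^ n) (fm_code \<theta>)"
  by (induction n) (simp_all add: assms)

section \<open>Representing recursive functions on levels\<close>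

text \<open>The only recursion that the class \<open>D\<close> below has to support. Pairs suffice:
  primitive recursion carries a counter and a value, and minimisation a counter with an idle second
  component.\<close>

inductive reach :: "'u set \<Rightarrow> ('u \<Rightarrow> 'u \<Rightarrow> bool) \<Rightarrow> ('u \<Rightarrow> 'u \<Rightarrow> 'u \<Rightarrow> 'u \<Rightarrow> bool) \<Rightarrow> 'u \<Rightarrow> 'u \<Rightarrow> bool"
  for U P Q where
  base: "u \<in> U \<Longrightarrow> v \<in> U \<Longrightarrow> P u v \<Longrightarrow> reach U P Q u v"
| step: "reach U P Q u v \<Longrightarrow> u' \<in> U \<Longrightarrow> v' \<in> U \<Longrightarrow> Q u v u' v' \<Longrightarrow> reach U P Q u' v'"

definition reachable ::
  "'u set \<Rightarrow> ('p \<Rightarrow> (nat \<Rightarrow> 'u) \<Rightarrow> bool) \<Rightarrow> ('p \<Rightarrow> (nat \<Rightarrow> 'u) \<Rightarrow> bool) \<Rightarrow> 'p \<Rightarrow> (nat \<Rightarrow> 'u) \<Rightarrow> bool" where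
  "reachable U P Q p b = reach U (\<lambda>u v. P p (push [u, v] (\<lambda>i. b (i + 2))))
    (\<lambda>u v u' v'. Q p (push [u, v, u', v'] (\<lambda>i. b (i + 2)))) (b 0) (b 1)"

lemma push_simps [simp]:
  "push [] e = e"
  "push (a # as) e 0 = a"
  "push (a # as) e (Suc i) = push as e i"
  by (auto simp: push_def fun_eq_iff)

text \<open>
  \<open>D\<close> is a class of relations on the universe \<open>U\<close>, uniform in a parameter \<open>p\<close>, in which the disjoint
  sets \<open>level p 0, level p 1, \<dots>\<close> behave like natural numbers up to the first empty level.
\<close>

locale counting =
  fixes U :: "'u set" and level :: "'p \<Rightarrow> nat \<Rightarrow> 'u set"
    and D :: "('p \<Rightarrow> (nat \<Rightarrow> 'u) \<Rightarrow> bool) \<Rightarrow> bool" and S :: "'p \<Rightarrow> 'u \<Rightarrow> 'u \<Rightarrow> bool"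
  assumes level_U: "level p i \<subseteq> U"
    and level_unique: "u \<in> level p i \<Longrightarrow> u \<in> level p j \<Longrightarrow> i = j"
    and D_zero: "D (\<lambda>p b. b 0 \<in> level p 0)"
    and D_nonzero: "D (\<lambda>p b. b 0 \<notin> level p 0)"
    and D_S: "D (\<lambda>p b. S p (b 0) (b 1))"
    and S_level: "u \<in> level p i \<Longrightarrow> v \<in> U \<Longrightarrow> S p u v \<longleftrightarrow> v \<in> level p (Suc i)"
    and D_eq: "D (\<lambda>p b. b 0 = b 1)"
    and D_conj: "D P \<Longrightarrow> D Q \<Longrightarrow> D (\<lambda>p b. P p b \<and> Q p b)"
    and D_ex: "D P \<Longrightarrow> D (\<lambda>p b. \<exists>a\<in>U. P p (push [a] b))"
    and D_ren: "D P \<Longrightarrow> D (\<lambda>p b. P p (\<lambda>i. b (\<sigma> i)))"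
    and D_reach: "D P \<Longrightarrow> D Q \<Longrightarrow> D (reachable U P Q)"
begin

text \<open>Position 0 is the output, and the arguments follow it. Soundness is demanded for all
  \<open>p\<close>, however few its levels; completeness only if the levels up to some
  \<open>B\<close>, which depends on \<open>xs\<close>, are inhabited. A computation may thus find
  no output, but never a wrong one.\<close>

definition represents :: "('p \<Rightarrow> (nat \<Rightarrow> 'u) \<Rightarrow> bool) \<Rightarrow> nat \<Rightarrow> (nat list \<Rightarrow> nat) \<Rightarrow> bool" where
  "represents P n f \<longleftrightarrow> D P \<and>
    (\<forall>xs p b. length xs = n \<longrightarrow> range b \<subseteq> U \<longrightarrow> (\<forall>i<n. b (Suc i) \<in> level p (xs ! i)) \<longrightarrow>
      P p b \<longrightarrow> b 0 \<in> level p (f xs)) \<and>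
    (\<forall>xs. length xs = n \<longrightarrow> (\<exists>B. \<forall>p b. (\<forall>i\<le>B. level p i \<noteq> {}) \<longrightarrow> range b \<subseteq> U \<longrightarrow>
      (\<forall>i<n. b (Suc i) \<in> level p (xs ! i)) \<longrightarrow> (\<exists>u\<in>level p (f xs). P p (b(0 := u)))))"

lemma representsI:
  assumes "D P"
    "\<And>xs p b. length xs = n \<Longrightarrow> range b \<subseteq> U \<Longrightarrow> (\<And>i. i < n \<Longrightarrow> b (Suc i) \<in> level p (xs ! i)) \<Longrightarrow>
      P p b \<Longrightarrow> b 0 \<in> level p (f xs)"
    "\<And>xs. length xs = n \<Longrightarrow> \<exists>B. \<forall>p b. (\<forall>i\<le>B. level p i \<noteq> {}) \<longrightarrow> range b \<subseteq> U \<longrightarrow>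
      (\<forall>i<n. b (Suc i) \<in> level p (xs ! i)) \<longrightarrow> (\<exists>u\<in>level p (f xs). P p (b(0 := u)))"
  shows "represents P n f"
  using assms unfolding represents_def by blast

lemma represents_D: "represents P n f \<Longrightarrow> D P"
  by (simp add: represents_def)

lemma represents_sound:
  "represents P n f \<Longrightarrow> length xs = n \<Longrightarrow> range b \<subseteq> U \<Longrightarrow>
    (\<And>i. i < n \<Longrightarrow> b (Suc i) \<in> level p (xs ! i)) \<Longrightarrow> P p b \<Longrightarrow> b 0 \<in> level p (f xs)"
  unfolding represents_def by blast

lemma represents_complete:
  assumes "represents P n f" "length xs = n"
  obtains B where "\<And>p b. (\<And>i. i \<le> B \<Longrightarrow> level p i \<noteq> {}) \<Longrightarrow> range b \<subseteq> U \<Longrightarrow>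
      (\<And>i. i < n \<Longrightarrow> b (Suc i) \<in> level p (xs ! i)) \<Longrightarrow> \<exists>u\<in>level p (f xs). P p (b(0 := u))"
  using assms unfolding represents_def by metis

lemma range_push: "set as \<subseteq> U \<Longrightarrow> range b \<subseteq> U \<Longrightarrow> range (push as b) \<subseteq> U"
  by (auto simp: push_def)

section \<open>Closure of representability under the schemes that generate the recursive
  functions\<close>

lemma represents_zero: "represents (\<lambda>p b. b 0 \<in> level p 0) n (\<lambda>_. 0)"
  by (rule representsI[OF D_zero]) (auto intro!: exI[of _ 0])

lemma represents_succ: "represents (\<lambda>p b. S p (b 1) (b 0)) 1 (\<lambda>xs. Suc (hd xs))"
proof (rule representsI)
  show "D (\<lambda>p b. S p (b 1) (b 0))"
    using D_ren[OF D_S, of "\<lambda>i. 1 - i"] by simp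
next
  fix xs p b
  assume "length xs = 1" "range b \<subseteq> U" "\<And>i. i < 1 \<Longrightarrow> b (Suc i) \<in> level p (xs ! i)" "S p (b 1) (b 0)"
  then show "b 0 \<in> level p (Suc (hd xs))"
    using S_level[of "b 1" p "hd xs" "b 0"] by (auto simp: length_Suc_conv image_subset_iff)
next
  fix xs :: "nat list"
  assume xs: "length xs = 1"
  have "\<exists>u\<in>level p (Suc (hd xs)). S p (b 1) u"
    if "\<forall>i\<le>Suc (hd xs). level p i \<noteq> {}" "\<forall>i<1. b (Suc i) \<in> level p (xs ! i)" for p b
  proof -
    have "level p (Suc (hd xs)) \<noteq> {}" using that(1) by simp
    then obtain u where "u \<in> level p (Suc (hd xs))" by blast
    moreover from this have "u \<in> U" using level_U by blast
    ultimately show ?thesis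
      using that xs S_level[of "b 1" p "hd xs" u] by (auto simp: length_Suc_conv)
  qed
  then show "\<exists>B. \<forall>p b. (\<forall>i\<le>B. level p i \<noteq> {}) \<longrightarrow> range b \<subseteq> U \<longrightarrow>
      (\<forall>i<1. b (Suc i) \<in> level p (xs ! i)) \<longrightarrow>
      (\<exists>u\<in>level p (Suc (hd xs)). S p ((b(0 := u)) 1) ((b(0 := u)) 0))"
    by (intro exI[of _ "Suc (hd xs)"]) simp
qed

lemma represents_proj: "i < n \<Longrightarrow> represents (\<lambda>p b. b 0 = b (Suc i)) n (\<lambda>xs. xs ! i)"
  using D_ren[OF D_eq, of "\<lambda>j. if j = 0 then 0 else Suc i"]
  by (intro representsI) auto

lemma D_exs: "D P \<Longrightarrow> D (\<lambda>p b. \<exists>ys. length ys = m \<and> set ys \<subseteq> U \<and> P p (push ys b))"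
proof (induction m arbitrary: P)
  case 0
  then show ?case by (simp add: push_def)
next
  case (Suc m)
  have push: "push ys (push [a] b) = push (ys @ [a]) b" for ys a and b :: "nat \<Rightarrow> 'u"
    by (auto simp: fun_eq_iff push_def nth_append less_Suc_eq)
  have "(\<exists>a\<in>U. \<exists>ys. length ys = m \<and> set ys \<subseteq> U \<and> P p (push ys (push [a] b))) \<longleftrightarrow>
      (\<exists>ys. length ys = Suc m \<and> set ys \<subseteq> U \<and> P p (push ys b))" for p b
    unfolding push
  proof (intro iffI)
    assume "\<exists>ys. length ys = Suc m \<and> set ys \<subseteq> U \<and> P p (push ys b)"
    then obtain ys a where "length (ys @ [a]) = Suc m" "set (ys @ [a]) \<subseteq> U" "P p (push (ys @ [a]) b)"
      by (metis length_Suc_conv_rev)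
    then show "\<exists>a\<in>U. \<exists>ys. length ys = m \<and> set ys \<subseteq> U \<and> P p (push (ys @ [a]) b)"
      by (intro bexI[of _ a] exI[of _ ys]) auto
  next
    assume "\<exists>a\<in>U. \<exists>ys. length ys = m \<and> set ys \<subseteq> U \<and> P p (push (ys @ [a]) b)"
    then obtain a ys where "a \<in> U" "length ys = m" "set ys \<subseteq> U" "P p (push (ys @ [a]) b)"
      by blast
    then show "\<exists>ys. length ys = Suc m \<and> set ys \<subseteq> U \<and> P p (push ys b)"
      by (intro exI[of _ "ys @ [a]"]) auto
  qed
  then show ?case
    using D_ex[OF Suc.IH[OF Suc.prems]] by simp
qed

lemma D_True: "D (\<lambda>_ _. True)"
  using D_ren[OF D_eq, of "\<lambda>_. 0"] by simp

lemma D_all: "(\<And>i. i < m \<Longrightarrow> D (P i)) \<Longrightarrow> D (\<lambda>p b. \<forall>i<m. P i p b)" for m :: nat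
proof (induction m)
  case 0
  then show ?case using D_True by simp
next
  case (Suc m)
  have "(\<forall>i<Suc m. P i p b) \<longleftrightarrow> (\<forall>i<m. P i p b) \<and> P m p b" for p b
    by (auto simp: less_Suc_eq)
  then show ?case
    using D_conj[of "\<lambda>p b. \<forall>i<m. P i p b" "P m"] Suc by simp
qed

lemma D_S02: "D (\<lambda>p b. S p (b 0) (b 2))"
  using D_ren[OF D_S, of "\<lambda>j. if j = 0 then 0 else 2"] by simp

text \<open>Intermediate values range over all of \<open>U\<close>, which may have elements outside
  the levels; soundness of each \<open>Pg i\<close> forces them into the right ones.\<close>

lemma represents_comp:
  assumes f: "represents Pf (length gs) f" and gs: "\<forall>g\<in>set gs. \<exists>P. represents P n g"
  shows "\<exists>P. represents P n (\<lambda>xs. f (map (\<lambda>g. g xs) gs))"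
proof -
  define m where "m = length gs"
  have "\<forall>i. \<exists>P. i < m \<longrightarrow> represents P n (gs ! i)"
    using gs by (auto simp: m_def)
  then obtain Pg where Pg: "\<And>i. i < m \<Longrightarrow> represents (Pg i) n (gs ! i)"
    by metis
  \<comment> \<open>In \<open>push ys b\<close> the intermediate values are at
    \<open>0, \<dots>, m - 1\<close>, the output at \<open>m\<close> and the arguments from
    \<open>m + 1\<close> on. Positions of \<open>Pf\<close> beyond its \<open>m\<close> arguments
    are filled with an arbitrary entry.\<close>
  define Q where "Q = (\<lambda>p c. (\<forall>i<m. Pg i p (\<lambda>j. c (if j = 0 then i else m + j))) \<and>
    Pf p (\<lambda>j. c (if j = 0 then m else if j \<le> m then j - 1 else Suc m)))"
  define P where "P = (\<lambda>p b. \<exists>ys. length ys = m \<and> set ys \<subseteq> U \<and> Q p (push ys b))"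
  have arg: "(\<lambda>j. push ys b (if j = 0 then i else m + j)) = b(0 := ys ! i)"
    if "length ys = m" "i < m" for ys i and b :: "nat \<Rightarrow> 'u"
    using that by (auto simp: fun_eq_iff push_def)
  define out where "out = (\<lambda>ys (b :: nat \<Rightarrow> 'u) j. if j = 0 then b 0 else if j \<le> m then ys ! (j - 1) else b 1)"
  have out: "(\<lambda>j. push ys b (if j = 0 then m else if j \<le> m then j - 1 else Suc m)) = out ys b"
    if "length ys = m" for ys b
    using that by (auto simp: fun_eq_iff push_def out_def)
  have Q: "Q p (push ys b) \<longleftrightarrow> (\<forall>i<m. Pg i p (b(0 := ys ! i))) \<and> Pf p (out ys b)"
    if "length ys = m" for ys p b
    using arg[OF that] out[OF that] by (simp add: Q_def)
  have range_out: "range (out ys b) \<subseteq> U" if "length ys = m" "set ys \<subseteq> U" "range b \<subseteq> U" for ys b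
    unfolding out[OF that(1), symmetric] using range_push[OF that(2,3)] by auto
  have "represents P n (\<lambda>xs. f (map (\<lambda>g. g xs) gs))"
  proof (rule representsI)
    have "D Q"
      unfolding Q_def
      by (intro D_conj D_all) (rule D_ren[OF represents_D[OF Pg]], assumption, rule D_ren[OF represents_D[OF f]])
    then show "D P"
      unfolding P_def by (rule D_exs)
  next
    fix xs p b
    assume xs: "length xs = n" "range b \<subseteq> U" "\<And>i. i < n \<Longrightarrow> b (Suc i) \<in> level p (xs ! i)" and "P p b"
    then obtain ys where ys: "length ys = m" "set ys \<subseteq> U"
      "\<And>i. i < m \<Longrightarrow> Pg i p (b(0 := ys ! i))" "Pf p (out ys b)"
      using Q unfolding P_def by blast
    have "ys ! i \<in> level p ((gs ! i) xs)" if "i < m" for i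
    proof -
      have "ys ! i \<in> U" using ys(1,2) that by auto
      then show ?thesis
        using represents_sound[OF Pg[OF that] xs(1) _ _ ys(3)[OF that]] xs
        by (auto simp: image_subset_iff)
    qed
    then have "out ys b 0 \<in> level p (f (map (\<lambda>g. g xs) gs))"
      using ys xs range_out[of ys b]
      by (intro represents_sound[OF f _ _ _ ys(4)]) (auto simp: m_def out_def)
    then show "b 0 \<in> level p (f (map (\<lambda>g. g xs) gs))"
      by (simp add: out_def)
  next
    fix xs :: "nat list"
    assume xs: "length xs = n"
    define zs where "zs = map (\<lambda>g. g xs) gs"
    have "\<exists>B. \<forall>p b. (\<forall>i\<le>B. level p i \<noteq> {}) \<longrightarrow> range b \<subseteq> U \<longrightarrow>
        (\<forall>i<n. b (Suc i) \<in> level p (xs ! i)) \<longrightarrow> (\<exists>u\<in>level p (zs ! i). Pg i p (b(0 := u)))"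
      if "i < m" for i
      using Pg[OF that] xs that unfolding represents_def by (simp add: zs_def m_def)
    then obtain B where B: "\<And>i p b. i < m \<Longrightarrow> (\<forall>j\<le>B i. level p j \<noteq> {}) \<Longrightarrow> range b \<subseteq> U \<Longrightarrow>
        (\<forall>j<n. b (Suc j) \<in> level p (xs ! j)) \<Longrightarrow> (\<exists>u\<in>level p (zs ! i). Pg i p (b(0 := u)))"
      by metis
    obtain B' where B': "\<And>p b. (\<And>i. i \<le> B' \<Longrightarrow> level p i \<noteq> {}) \<Longrightarrow> range b \<subseteq> U \<Longrightarrow>
        (\<And>i. i < m \<Longrightarrow> b (Suc i) \<in> level p (zs ! i)) \<Longrightarrow> \<exists>u\<in>level p (f zs). Pf p (b(0 := u))"
      using represents_complete[OF f, of zs, unfolded zs_def length_map, OF refl]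
      unfolding m_def zs_def by blast
    define C where "C = B' + (\<Sum>i<m. B i)"
    have C: "B' \<le> C" "i < m \<Longrightarrow> B i \<le> C" for i
      using member_le_sum[of i "{..<m}" B] by (simp_all add: C_def)
    have "\<exists>u\<in>level p (f zs). P p (b(0 := u))"
      if C': "\<forall>i\<le>C. level p i \<noteq> {}" and b: "range b \<subseteq> U" "\<forall>i<n. b (Suc i) \<in> level p (xs ! i)" for p b
    proof -
      have "\<exists>u. i < m \<longrightarrow> u \<in> level p (zs ! i) \<and> Pg i p (b(0 := u))" for i
        using B[of i p b] b C(2)[of i] C' by auto
      then obtain u where u: "\<And>i. i < m \<Longrightarrow> u i \<in> level p (zs ! i) \<and> Pg i p (b(0 := u i))"
        by metis
      define ys where "ys = map u [0..<m]"
      have ys: "length ys = m" "set ys \<subseteq> U"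
        using u level_U by (fastforce simp: ys_def)+
      have "\<exists>v\<in>level p (f zs). Pf p ((out ys b)(0 := v))"
        using C(1) C' u range_out[OF ys b(1)] by (intro B') (auto simp: out_def ys_def)
      then obtain v where v: "v \<in> level p (f zs)" "Pf p ((out ys b)(0 := v))"
        by blast
      have "(out ys b)(0 := v) = out ys (b(0 := v))"
        by (auto simp: fun_eq_iff out_def)
      then have "Q p (push ys (b(0 := v)))"
        using Q[OF ys(1), of p "b(0 := v)"] u v by (simp add: ys_def)
      then show ?thesis
        using ys v unfolding P_def by blast
    qed
    then show "\<exists>C. \<forall>p b. (\<forall>i\<le>C. level p i \<noteq> {}) \<longrightarrow> range b \<subseteq> U \<longrightarrow>
        (\<forall>i<n. b (Suc i) \<in> level p (xs ! i)) \<longrightarrow>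
        (\<exists>u\<in>level p (f (map (\<lambda>g. g xs) gs)). P p (b(0 := u)))"
      unfolding zs_def by blast
  qed
  then show ?thesis by blast
qed

text \<open>\<open>reach\<close> traces pairs of counter and value. The number of steps need not be
  recorded: the counter is the first argument \<open>b 1\<close>, and since levels are disjoint, its
  level determines how often the recursion was unfolded.\<close>

lemma represents_prim_rec:
  assumes g: "represents Pg n g" and h: "represents Ph (Suc (Suc n)) h"
  shows "\<exists>P. represents P (Suc n) (\<lambda>xs. rec_nat (g (tl xs)) (\<lambda>k r. h (k # r # tl xs)) (hd xs))"
proof -
  define Base where "Base = (\<lambda>p c. c 0 \<in> level p 0 \<and> Pg p (\<lambda>j. c (Suc j)))"
  \<comment> \<open>The entries of \<open>c\<close> are the old counter, the old value, the new
    counter, the new value and then the parameters; \<open>Ph\<close> takes the new value as output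
    and the old pair as its first two arguments.\<close>
  define Step where "Step = (\<lambda>p c. S p (c 0) (c 2) \<and>
    Ph p (\<lambda>j. c (if j = 0 then 3 else if j \<le> 2 then j - 1 else j + 1)))"
  define P where "P = (\<lambda>p b. reachable U Base Step p (\<lambda>j. b (if j = 0 then 1 else if j = 1 then 0 else j)))"
  define R where "R = (\<lambda>p par. reach U (\<lambda>u v. u \<in> level p 0 \<and> Pg p (push [v] par))
    (\<lambda>u v u' v'. S p u u' \<and> Ph p (push [v', u, v] par)))"
  have env: "(\<lambda>j. push [u, v] par (Suc j)) = push [v] par"
    "(\<lambda>j. push [u, v, u', v'] par (if j = 0 then 3 else if j \<le> 2 then j - 1 else j + 1)) = push [v', u, v] par"
    for u v u' v' and par :: "nat \<Rightarrow> 'u"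
    by (auto simp: fun_eq_iff push_def nth_Cons' numeral_eq_Suc)
  have P: "P p b \<longleftrightarrow> R p (\<lambda>i. b (i + 2)) (b 1) (b 0)" for p b
    unfolding P_def R_def reachable_def Base_def Step_def env
    by (simp add: push_def nth_Cons' numeral_eq_Suc)
  define F where "F = (\<lambda>xs k. rec_nat (g xs) (\<lambda>k r. h (k # r # xs)) k)"
  have F: "F xs 0 = g xs" "F xs (Suc k) = h (k # F xs k # xs)" for xs k
    by (simp_all add: F_def)
  have sound: "\<exists>k. u \<in> level p k \<and> v \<in> level p (F xs k)"
    if "R p par u v" "length xs = n" "range par \<subseteq> U" "\<And>i. i < n \<Longrightarrow> par i \<in> level p (xs ! i)" for p par u v xs
    using that(1) unfolding R_def
  proof induction
    case (base u v)
    have "push [v] par 0 \<in> level p (g xs)"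
      using base that by (intro represents_sound[OF g, of xs] range_push) auto
    then show ?case using base by (auto simp: F)
  next
    case (step u v u' v')
    then obtain k where k: "u \<in> level p k" "v \<in> level p (F xs k)" by blast
    have u': "u' \<in> level p (Suc k)"
      using S_level[OF k(1) step(2)] step(4) by blast
    have "push [v', u, v] par (Suc i) \<in> level p ((k # F xs k # xs) ! i)" if "i < Suc (Suc n)" for i
      using k \<open>\<And>i. i < n \<Longrightarrow> par i \<in> level p (xs ! i)\<close> that
      by (auto simp: less_Suc_eq_0_disj)
    moreover have "u \<in> U" "v \<in> U" using k level_U by blast+
    ultimately have "push [v', u, v] par 0 \<in> level p (h (k # F xs k # xs))"
      using that step by (intro represents_sound[OF h] range_push) auto
    then show ?case using u' by (auto simp: F intro!: exI[of _ "Suc k"])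
  qed
  have complete: "\<exists>B. \<forall>p par. (\<forall>i\<le>B. level p i \<noteq> {}) \<longrightarrow> range par \<subseteq> U \<longrightarrow>
      (\<forall>i<n. par i \<in> level p (xs ! i)) \<longrightarrow> (\<forall>u\<in>level p k. \<exists>v\<in>level p (F xs k). R p par u v)"
    if xs: "length xs = n" for xs k
  proof (induction k)
    case 0
    obtain B where B: "\<And>p b. (\<And>i. i \<le> B \<Longrightarrow> level p i \<noteq> {}) \<Longrightarrow> range b \<subseteq> U \<Longrightarrow>
      (\<And>i. i < n \<Longrightarrow> b (Suc i) \<in> level p (xs ! i)) \<Longrightarrow> \<exists>u\<in>level p (g xs). Pg p (b(0 := u))"
      using represents_complete[OF g xs] by blast
    have "\<exists>v\<in>level p (F xs 0). R p par u v"
      if "\<forall>i\<le>B. level p i \<noteq> {}" "range par \<subseteq> U" "\<forall>i<n. par i \<in> level p (xs ! i)" "u \<in> level p 0"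
      for p par u
    proof -
      have "u \<in> U" using that level_U by blast
      have "\<exists>v\<in>level p (g xs). Pg p ((push [u] par)(0 := v))"
        using that \<open>u \<in> U\<close> by (intro B range_push) auto
      then obtain v where v: "v \<in> level p (g xs)" "Pg p ((push [u] par)(0 := v))" by blast
      have "(push [u] par)(0 := v) = push [v] par"
        by (auto simp: fun_eq_iff push_def)
      moreover have "v \<in> U" using v level_U by blast
      ultimately have "R p par u v"
        unfolding R_def using v \<open>u \<in> U\<close> that by (intro reach.base) auto
      then show ?thesis using v by (auto simp: F)
    qed
    then show ?case by blast
  next
    case (Suc k)
    then obtain B where B: "\<And>p par u. (\<forall>i\<le>B. level p i \<noteq> {}) \<Longrightarrow> range par \<subseteq> U \<Longrightarrow>
        (\<forall>i<n. par i \<in> level p (xs ! i)) \<Longrightarrow> u \<in> level p k \<Longrightarrow> \<exists>v\<in>level p (F xs k). R p par u v"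
      by blast
    obtain B' where B': "\<And>p b. (\<And>i. i \<le> B' \<Longrightarrow> level p i \<noteq> {}) \<Longrightarrow> range b \<subseteq> U \<Longrightarrow>
        (\<And>i. i < Suc (Suc n) \<Longrightarrow> b (Suc i) \<in> level p ((k # F xs k # xs) ! i)) \<Longrightarrow>
        \<exists>u\<in>level p (h (k # F xs k # xs)). Ph p (b(0 := u))"
      using represents_complete[OF h, of "k # F xs k # xs", unfolded length_Cons xs, OF refl] by blast
    \<comment> \<open>\<open>B\<close> serves the steps up to \<open>k\<close>, \<open>B'\<close>
      the last one, and the summand \<open>k\<close> guarantees a counter at level \<open>k\<close>
      to step from.\<close>
    have "\<exists>v\<in>level p (F xs (Suc k)). R p par u' v"
      if C: "\<forall>i\<le>B + B' + k. level p i \<noteq> {}" and par: "range par \<subseteq> U"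
        "\<forall>i<n. par i \<in> level p (xs ! i)" and u': "u' \<in> level p (Suc k)" for p par u'
    proof -
      have "level p k \<noteq> {}" using C by simp
      then obtain u where u: "u \<in> level p k" by blast
      obtain v where v: "v \<in> level p (F xs k)" "R p par u v"
        using B[OF _ par u] C by auto
      have U: "u \<in> U" "v \<in> U" "u' \<in> U" using u u' v level_U by blast+
      \<comment> \<open>The first \<open>u\<close> only fills the output position and is overwritten
        by \<open>v'\<close> below.\<close>
      have "push [u, u, v] par (Suc i) \<in> level p ((k # F xs k # xs) ! i)" if "i < Suc (Suc n)" for i
        using u v par that by (auto simp: less_Suc_eq_0_disj)
      then have "\<exists>v'\<in>level p (h (k # F xs k # xs)). Ph p ((push [u, u, v] par)(0 := v'))"
        using C par U by (intro B' range_push) auto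
      then obtain v' where v': "v' \<in> level p (h (k # F xs k # xs))" "Ph p ((push [u, u, v] par)(0 := v'))"
        by blast
      have "(push [u, u, v] par)(0 := v') = push [v', u, v] par"
        by (auto simp: fun_eq_iff push_def nth_Cons')
      then have "S p u u' \<and> Ph p (push [v', u, v] par)"
        using S_level[OF u U(3)] u' v'(2) by simp
      then have "R p par u' v'"
        using subsetD[OF level_U v'(1)] unfolding R_def
        by (intro reach.step[OF v(2)[unfolded R_def] U(3)])
      then show ?thesis using v' by (auto simp: F)
    qed
    then show ?case by blast
  qed
  have "represents P (Suc n) (\<lambda>xs. F (tl xs) (hd xs))"
  proof (rule representsI)
    have "D Base"
      unfolding Base_def by (rule D_conj[OF D_zero D_ren[OF represents_D[OF g]]])
    moreover have "D Step"
      unfolding Step_def by (rule D_conj[OF D_S02 D_ren[OF represents_D[OF h]]])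
    ultimately show "D P"
      unfolding P_def by (rule D_ren[OF D_reach])
  next
    fix xs p b
    assume xs: "length xs = Suc n" "range b \<subseteq> U" "\<And>i. i < Suc n \<Longrightarrow> b (Suc i) \<in> level p (xs ! i)"
      and "P p b"
    obtain k ys where k: "xs = k # ys" using xs(1) by (cases xs) auto
    have par: "b (i + 2) \<in> level p (ys ! i)" if "i < n" for i
      using xs(3)[of "Suc i"] that k by simp
    obtain j where "b 1 \<in> level p j" "b 0 \<in> level p (F ys j)"
      using sound[of p "\<lambda>i. b (i + 2)" "b 1" "b 0" ys] \<open>P p b\<close> par xs k unfolding P
      by (auto simp: image_subset_iff)
    moreover have "b 1 \<in> level p k"
      using xs(3)[of 0] k by simp
    ultimately show "b 0 \<in> level p (F (tl xs) (hd xs))"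
      using level_unique k by auto
  next
    fix xs :: "nat list"
    assume "length xs = Suc n"
    then obtain k ys where k: "xs = k # ys" "length ys = n" by (cases xs) auto
    obtain B where B: "\<And>p par u. (\<forall>i\<le>B. level p i \<noteq> {}) \<Longrightarrow> range par \<subseteq> U \<Longrightarrow>
        (\<forall>i<n. par i \<in> level p (ys ! i)) \<Longrightarrow> u \<in> level p k \<Longrightarrow> \<exists>v\<in>level p (F ys k). R p par u v"
      using complete[OF k(2), of k] by blast
    have "\<exists>u\<in>level p (F ys k). P p (b(0 := u))"
      if "\<forall>i\<le>B. level p i \<noteq> {}" "range b \<subseteq> U" "\<forall>i<Suc n. b (Suc i) \<in> level p (xs ! i)" for p b
    proof -
      have "b 1 \<in> level p k" using that(3) k by force
      moreover have "\<forall>i<n. b (i + 2) \<in> level p (ys ! i)" using that(3) k by force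
      ultimately show ?thesis
        using B[OF that(1), of "\<lambda>i. b (i + 2)" "b 1"] that(2)
        by (auto simp: P image_subset_iff)
    qed
    then show "\<exists>B. \<forall>p b. (\<forall>i\<le>B. level p i \<noteq> {}) \<longrightarrow> range b \<subseteq> U \<longrightarrow>
        (\<forall>i<Suc n. b (Suc i) \<in> level p (xs ! i)) \<longrightarrow> (\<exists>u\<in>level p (F (tl xs) (hd xs)). P p (b(0 := u)))"
      unfolding k(1) list.sel by blast
  qed
  then show ?thesis unfolding F_def by blast
qed

text \<open>The search moves its counter past \<open>i\<close> only with a witness \<open>r\<close>
  that \<open>f (i # xs)\<close> is not zero. By soundness \<open>r\<close> lies in the level of
  that value, so being outside level 0 is a reliable test and \<open>Pf\<close> itself is never
  negated. A separate condition tests that \<open>f\<close> vanishes at the final counter.\<close>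

lemma represents_minimise:
  assumes f: "represents Pf (Suc n) f" and total: "\<forall>xs. length xs = n \<longrightarrow> (\<exists>k. f (k # xs) = 0)"
  shows "\<exists>P. represents P n (\<lambda>xs. LEAST k. f (k # xs) = 0)"
proof -
  define Base where "Base = (\<lambda>p (c :: nat \<Rightarrow> 'u). c 0 \<in> level p 0)"
  \<comment> \<open>The second components of the pairs are idle. \<open>Pf\<close> reads
    \<open>r\<close> as output, the old counter as its first argument and then the parameters, which
    come after \<open>r\<close> and the four entries of the two pairs.\<close>
  define Step where "Step = (\<lambda>p c. S p (c 0) (c 2) \<and>
    (\<exists>r\<in>U. Pf p (\<lambda>j. push [r] c (if j \<le> 1 then j else j + 3)) \<and> push [r] c 0 \<notin> level p 0))"
  define P where "P = (\<lambda>p b.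
    (\<exists>v\<in>U. reachable U Base Step p (\<lambda>j. push [v] b (if j = 0 then 1 else if j = 1 then 0 else j))) \<and>
    (\<exists>z\<in>U. Pf p (push [z] b) \<and> push [z] b 0 \<in> level p 0))"
  define R where "R = (\<lambda>p par. reach U (\<lambda>u v. u \<in> level p 0)
    (\<lambda>u v u' v'. S p u u' \<and> (\<exists>r\<in>U. Pf p (push [r, u] par) \<and> r \<notin> level p 0)))"
  have env: "(\<lambda>j. push [r] (push [u, v, u', v'] par) (if j \<le> 1 then j else j + 3)) = push [r, u] par"
    for r u v u' v' and par :: "nat \<Rightarrow> 'u"
    by (auto simp: fun_eq_iff push_def nth_Cons' numeral_eq_Suc)
  have P: "P p b \<longleftrightarrow> (\<exists>v\<in>U. R p (\<lambda>i. b (Suc i)) (b 0) v) \<and> (\<exists>z\<in>level p 0. Pf p (push [z] b))" for p b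
    unfolding P_def R_def reachable_def Base_def Step_def env using level_U
    by (auto simp: push_def nth_Cons' numeral_eq_Suc)
  have sound: "\<exists>k. u \<in> level p k \<and> (\<forall>i<k. f (i # xs) \<noteq> 0)"
    if "R p par u v" "length xs = n" "range par \<subseteq> U" "\<And>i. i < n \<Longrightarrow> par i \<in> level p (xs ! i)" for p par u v xs
    using that(1) unfolding R_def
  proof induction
    case (base u v)
    then show ?case by (intro exI[of _ 0]) simp
  next
    case (step u v u' v')
    then obtain k where k: "u \<in> level p k" "\<forall>i<k. f (i # xs) \<noteq> 0" by blast
    obtain r where r: "r \<in> U" "Pf p (push [r, u] par)" "r \<notin> level p 0" using step by blast
    have u': "u' \<in> level p (Suc k)"
      using S_level[OF k(1) step(2)] step(4) by blast
    have "push [r, u] par (Suc i) \<in> level p ((k # xs) ! i)" if "i < Suc n" for i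
      using k \<open>\<And>i. i < n \<Longrightarrow> par i \<in> level p (xs ! i)\<close> that
      by (auto simp: less_Suc_eq_0_disj)
    moreover have "u \<in> U" using k level_U by blast
    ultimately have "push [r, u] par 0 \<in> level p (f (k # xs))"
      using that r by (intro represents_sound[OF f] range_push) auto
    then have "f (k # xs) \<noteq> 0" using r(3) by (metis push_simps(2))
    then show ?case using k u' by (intro exI[of _ "Suc k"]) (simp add: less_Suc_eq)
  qed
  have complete: "\<exists>B. \<forall>p par. (\<forall>i\<le>B. level p i \<noteq> {}) \<longrightarrow> range par \<subseteq> U \<longrightarrow>
      (\<forall>i<n. par i \<in> level p (xs ! i)) \<longrightarrow> (\<forall>u\<in>level p k. R p par u u)"
    if xs: "length xs = n" and nz: "\<forall>i<k. f (i # xs) \<noteq> 0" for xs k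
    using nz
  proof (induction k)
    case 0
    have "R p par u u" if "u \<in> level p 0" for p par u
      using that subsetD[OF level_U that] unfolding R_def by (intro reach.base)
    then show ?case by blast
  next
    case (Suc k)
    then obtain B where B: "\<And>p par u. (\<forall>i\<le>B. level p i \<noteq> {}) \<Longrightarrow> range par \<subseteq> U \<Longrightarrow>
        (\<forall>i<n. par i \<in> level p (xs ! i)) \<Longrightarrow> u \<in> level p k \<Longrightarrow> R p par u u"
      by (metis less_SucI)
    obtain B' where B': "\<And>p b. (\<And>i. i \<le> B' \<Longrightarrow> level p i \<noteq> {}) \<Longrightarrow> range b \<subseteq> U \<Longrightarrow>
        (\<And>i. i < Suc n \<Longrightarrow> b (Suc i) \<in> level p ((k # xs) ! i)) \<Longrightarrow>
        \<exists>u\<in>level p (f (k # xs)). Pf p (b(0 := u))"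
      using represents_complete[OF f, of "k # xs", unfolded length_Cons xs, OF refl] by blast
    have "R p par u' u'"
      if C: "\<forall>i\<le>B + B' + k. level p i \<noteq> {}" and par: "range par \<subseteq> U"
        "\<forall>i<n. par i \<in> level p (xs ! i)" and u': "u' \<in> level p (Suc k)" for p par u'
    proof -
      have "level p k \<noteq> {}" using C by simp
      then obtain u where u: "u \<in> level p k" by blast
      have v: "R p par u u"
        using B[OF _ par u] C by auto
      have U: "u \<in> U" "u' \<in> U" using u u' level_U by blast+
      have "push [u, u] par (Suc i) \<in> level p ((k # xs) ! i)" if "i < Suc n" for i
        using u par that by (auto simp: less_Suc_eq_0_disj)
      then have "\<exists>r\<in>level p (f (k # xs)). Pf p ((push [u, u] par)(0 := r))"
        using C par U by (intro B' range_push) auto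
      then obtain r where r: "r \<in> level p (f (k # xs))" "Pf p ((push [u, u] par)(0 := r))"
        by blast
      have "(push [u, u] par)(0 := r) = push [r, u] par"
        by (auto simp: fun_eq_iff push_def nth_Cons')
      moreover have "r \<notin> level p 0" using level_unique[OF r(1), of 0] Suc.prems by auto
      moreover have "r \<in> U" using r level_U by blast
      moreover have "S p u u'" using S_level[OF u U(2)] u' by blast
      ultimately have "S p u u' \<and> (\<exists>r\<in>U. Pf p (push [r, u] par) \<and> r \<notin> level p 0)"
        using r(2) by (intro conjI bexI[of _ r]) simp_all
      then show ?thesis
        unfolding R_def by (intro reach.step[OF v[unfolded R_def] U(2) U(2)])
    qed
    then show ?case by blast
  qed
  have "represents P n (\<lambda>xs. LEAST k. f (k # xs) = 0)"
  proof (rule representsI)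
    have "D Base"
      unfolding Base_def by (rule D_zero)
    moreover have "D Step"
      unfolding Step_def
      by (rule D_conj[OF D_S02 D_ex[OF D_conj[OF D_ren[OF represents_D[OF f]] D_nonzero]]])
    ultimately have "D (\<lambda>p b. reachable U Base Step p (\<lambda>j. b (if j = 0 then 1 else if j = 1 then 0 else j)))"
      by (rule D_ren[OF D_reach])
    then show "D P"
      unfolding P_def by (rule D_conj[OF D_ex D_ex[OF D_conj[OF represents_D[OF f] D_zero]]])
  next
    fix xs p b
    assume xs: "length xs = n" "range b \<subseteq> U" "\<And>i. i < n \<Longrightarrow> b (Suc i) \<in> level p (xs ! i)"
      and "P p b"
    then obtain v z where v: "R p (\<lambda>i. b (Suc i)) (b 0) v" and z: "z \<in> level p 0" "Pf p (push [z] b)"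
      unfolding P by blast
    obtain k where k: "b 0 \<in> level p k" "\<forall>i<k. f (i # xs) \<noteq> 0"
      using sound[OF v xs(1)] xs by (auto simp: image_subset_iff)
    have "push [z] b (Suc i) \<in> level p ((k # xs) ! i)" if "i < Suc n" for i
      using k xs(3)[of "i - 1"] that by (auto simp: less_Suc_eq_0_disj)
    then have "push [z] b 0 \<in> level p (f (k # xs))"
      using xs z subsetD[OF level_U z(1)] by (intro represents_sound[OF f] range_push) auto
    then have "f (k # xs) = 0"
      using z level_unique[of z p 0] by (auto simp: push_def)
    then have "(LEAST k. f (k # xs) = 0) = k"
      using k(2) by (intro Least_equality) (auto simp: not_less[symmetric])
    then show "b 0 \<in> level p (LEAST k. f (k # xs) = 0)"
      using k by simp
  next
    fix xs :: "nat list"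
    assume xs: "length xs = n"
    define k where "k = (LEAST k. f (k # xs) = 0)"
    have k: "f (k # xs) = 0" "\<forall>i<k. f (i # xs) \<noteq> 0"
      using total xs not_less_Least[of _ "\<lambda>k. f (k # xs) = 0"]
      unfolding k_def by (auto intro: LeastI_ex)
    obtain B where B: "\<And>p par u. (\<forall>i\<le>B. level p i \<noteq> {}) \<Longrightarrow> range par \<subseteq> U \<Longrightarrow>
        (\<forall>i<n. par i \<in> level p (xs ! i)) \<Longrightarrow> u \<in> level p k \<Longrightarrow> R p par u u"
      using complete[OF xs k(2)] by blast
    obtain B' where B': "\<And>p b. (\<And>i. i \<le> B' \<Longrightarrow> level p i \<noteq> {}) \<Longrightarrow> range b \<subseteq> U \<Longrightarrow>
        (\<And>i. i < Suc n \<Longrightarrow> b (Suc i) \<in> level p ((k # xs) ! i)) \<Longrightarrow>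
        \<exists>u\<in>level p 0. Pf p (b(0 := u))"
      using represents_complete[OF f, of "k # xs", unfolded length_Cons xs k(1), OF refl] by blast
    have "\<exists>u\<in>level p k. P p (b(0 := u))"
      if C: "\<forall>i\<le>B + B' + k. level p i \<noteq> {}" and b: "range b \<subseteq> U" "\<forall>i<n. b (Suc i) \<in> level p (xs ! i)"
      for p b
    proof -
      have "level p k \<noteq> {}" using C by simp
      then obtain u where u: "u \<in> level p k" by blast
      have "u \<in> U" using u level_U by blast
      have "R p (\<lambda>i. b (Suc i)) u u"
        using C b by (intro B u) auto
      have "push [u] (b(0 := u)) (Suc i) \<in> level p ((k # xs) ! i)" if "i < Suc n" for i
        using u b(2) that by (auto simp: less_Suc_eq_0_disj)
      then have "\<exists>z\<in>level p 0. Pf p ((push [u] (b(0 := u)))(0 := z))"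
        using C b \<open>u \<in> U\<close> by (intro B' range_push) (auto simp: image_subset_iff)
      moreover have "(push [u] (b(0 := u)))(0 := z) = push [z] (b(0 := u))" for z
        by (auto simp: fun_eq_iff push_def)
      ultimately show ?thesis
        using u \<open>u \<in> U\<close> \<open>R p (\<lambda>i. b (Suc i)) u u\<close> unfolding P
        by (intro bexI[OF _ u]) auto
    qed
    then show "\<exists>B. \<forall>p b. (\<forall>i\<le>B. level p i \<noteq> {}) \<longrightarrow> range b \<subseteq> U \<longrightarrow>
        (\<forall>i<n. b (Suc i) \<in> level p (xs ! i)) \<longrightarrow>
        (\<exists>u\<in>level p (LEAST k. f (k # xs) = 0). P p (b(0 := u)))"
      unfolding k_def[symmetric] by blast
  qed
  then show ?thesis by blast
qed

theorem recursive_represents: "recursive n f \<Longrightarrow> \<exists>P. represents P n f"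
proof (induction rule: recursive.induct)
  case (comp gs f n)
  then show ?case using represents_comp by blast
next
  case (prim_rec n g h)
  then show ?case using represents_prim_rec by blast
next
  case (minimise n f)
  then show ?case using represents_minimise by blast
qed (use represents_zero represents_succ represents_proj in blast)+

end

section \<open>Stage comparison\<close>

text \<open>Only finite stages are compared, so any fixed point \<open>L\<close> of the comparison operator will do.\<close>

lemma stage_comparison:
  fixes F :: "'u set \<Rightarrow> 'u set" and L :: "'u \<Rightarrow> 'u \<Rightarrow> bool"
  assumes "mono F" "\<And>S. F S \<subseteq> U"
    and L: "\<And>x y. x \<in> U \<Longrightarrow> y \<in> U \<Longrightarrow> L x y \<longleftrightarrow> x \<in> F {x' \<in> U. y \<notin> F {y' \<in> U. \<not> L x' y'}}"
  shows "x \<in> U \<Longrightarrow> y \<in> (F ^^ Suc j) {} \<Longrightarrow> L x y \<Longrightarrow> x \<in> (F ^^ Suc j) {}"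
    and "x \<in> (F ^^ Suc j) {} \<Longrightarrow> y \<in> U \<Longrightarrow> y \<notin> (F ^^ j) {} \<Longrightarrow> L x y"
proof -
  have U: "(F ^^ j) {} \<subseteq> U" for j
    using assms(2) by (cases j) auto
  have F: "x \<in> F S \<Longrightarrow> S \<subseteq> T \<Longrightarrow> x \<in> F T" for x S T
    using assms(1) by (meson monoD subsetD)
  \<comment> \<open>Here \<open>{y' \<in> U. \<not> L x' y'}\<close> plays the role of the elements
    entering before \<open>x'\<close>, and \<open>y\<close> lying outside \<open>F\<close> of this
    set says that \<open>x'\<close> enters before \<open>y\<close>.\<close>
  show "x \<in> (F ^^ Suc j) {}" if "x \<in> U" "y \<in> (F ^^ Suc j) {}" "L x y"
    using that
  proof (induction j arbitrary: x y)
    case 0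
    have "y \<in> F {y' \<in> U. \<not> L x' y'}" for x'
      using 0(2) by (auto elim: F)
    then have "x \<in> F {}"
      using 0 L[of x y] U[of 1] by auto
    then show ?case by simp
  next
    case (Suc j)
    \<comment> \<open>If \<open>x'\<close> were missing from stage \<open>Suc j\<close>, the
      induction hypothesis would make that stage part of
      \<open>{y' \<in> U. \<not> L x' y'}\<close>, and monotonicity would put \<open>y\<close> into
      \<open>F\<close> of the latter.\<close>
    have "{x' \<in> U. y \<notin> F {y' \<in> U. \<not> L x' y'}} \<subseteq> (F ^^ Suc j) {}"
    proof (rule ccontr)
      assume "\<not> ?thesis"
      then obtain x' where x': "x' \<in> U" "y \<notin> F {y' \<in> U. \<not> L x' y'}" "x' \<notin> (F ^^ Suc j) {}"
        by blast
      have "(F ^^ Suc j) {} \<subseteq> {y' \<in> U. \<not> L x' y'}"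
        using Suc.IH[of x'] x' U by blast
      moreover have "y \<in> F ((F ^^ Suc j) {})"
        using Suc.prems(2) by simp
      ultimately show False using x'(2) F by blast
    qed
    moreover have "y \<in> U" using Suc.prems(2) U by blast
    ultimately have "x \<in> F ((F ^^ Suc j) {})"
      using Suc.prems L F by blast
    then show ?case by simp
  qed
  \<comment> \<open>The indices differ by one: \<open>x\<close> enters at level \<open>j\<close> or
    before, while \<open>y\<close> enters at level \<open>j\<close> or later, or never.\<close>
  show "L x y" if "x \<in> (F ^^ Suc j) {}" "y \<in> U" "y \<notin> (F ^^ j) {}"
    using that
  proof (induction j arbitrary: x y)
    case 0
    then show ?case using L U[of 1] F[of x "{}"] by auto
  next
    case (Suc j)
    have "(F ^^ Suc j) {} \<subseteq> {x' \<in> U. y \<notin> F {y' \<in> U. \<not> L x' y'}}"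
    proof
      fix x' assume x': "x' \<in> (F ^^ Suc j) {}"
      have "{y' \<in> U. \<not> L x' y'} \<subseteq> (F ^^ j) {}"
        using Suc.IH[OF x'] by blast
      then have "y \<notin> F {y' \<in> U. \<not> L x' y'}"
        using Suc.prems(3) F by auto
      then show "x' \<in> {x' \<in> U. y \<notin> F {y' \<in> U. \<not> L x' y'}}"
        using x' U by blast
    qed
    moreover have "x \<in> F ((F ^^ Suc j) {})" "x \<in> U"
      using Suc.prems(1) U[of "Suc (Suc j)"] by auto
    ultimately show ?case using L Suc.prems(2) F by blast
  qed
qed

section \<open>Defining levels when the stages are unbounded\<close>

text \<open>Each \<open>n\<close> may need its own parameters, so everything below is kept uniform
  in \<open>e\<close>.\<close>

locale unbounded_stages =
  fixes A :: "'a fo_structure" and X k :: nat and \<Phi> :: fm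
  assumes wf: "wf_fm A [X \<mapsto> k] \<Phi>" and pos: "only_positive X \<Phi>"
    and unbounded: "\<And>n. \<exists>e. stage A X k \<Phi> e n \<noteq> stage A X k \<Phi> e (Suc n)"
begin

abbreviation F :: "(nat \<Rightarrow> 'a) \<Rightarrow> 'a list set \<Rightarrow> 'a list set" where
  "F \<equiv> operator A X k \<Phi>"

abbreviation stg :: "(nat \<Rightarrow> 'a) \<Rightarrow> nat \<Rightarrow> 'a list set" where
  "stg \<equiv> stage A X k \<Phi>"

definition U :: "'a list set" where
  "U = {as. length as = k}"

definition M :: nat where
  "M = fresh (fv \<Phi>)"

lemma fv_less_M: "x \<in> fv \<Phi> \<Longrightarrow> x < M"
  unfolding M_def by (rule less_fresh) simp_all

lemma F_U: "F e S \<subseteq> U"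
  by (auto simp: operator_def U_def)

lemma F_cong: "(\<And>x. x < M \<Longrightarrow> e x = e' x) \<Longrightarrow> F e = F e'"
proof -
  assume e: "\<And>x. x < M \<Longrightarrow> e x = e' x"
  have "push as e x = push as e' x" if "x \<in> fv \<Phi>" for as x
    using e fv_less_M[OF that] by (auto simp: push_def)
  then have "sat A (no_rels(X := S)) (push as e) \<Phi> = sat A (no_rels(X := S)) (push as e') \<Phi>" for S as
    by (intro sat_cong[OF wf]) auto
  then show ?thesis by (auto simp: operator_def fun_eq_iff)
qed

lemma stg_mono: "i \<le> j \<Longrightarrow> stg e i \<subseteq> stg e j"
  unfolding stage_def using funpow_decreasing[OF _ mono_operator[OF pos]] by (simp add: bot_set_def)

text \<open>For \<open>k = 0\<close> every stage is \<open>{}\<close> or \<open>{[]}\<close>, and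
  the stages close after one step. Positive \<open>k\<close> is needed to locate a variable in its
  block by division.\<close>

lemma k_pos: "0 < k"
proof (rule ccontr)
  assume "\<not> 0 < k"
  then have "F e S \<subseteq> {[]}" for e S
    by (auto simp: operator_def)
  then have "F e {} = {} \<or> F e {} = {[]}" for e
    by blast
  moreover have "F e {} \<subseteq> F e (F e {})" "F e (F e {}) \<subseteq> {[]}" for e
    using stg_mono[of 1 2 e] \<open>\<And>e S. F e S \<subseteq> {[]}\<close> by (simp_all add: numeral_2_eq_2)
  ultimately have "stg e 1 = stg e (Suc 1)" for e
    by (metis One_nat_def stage_simps subset_antisym)
  then show False using unbounded by blast
qed

definition level :: "(nat \<Rightarrow> 'a) \<Rightarrow> nat \<Rightarrow> 'a list set" where
  "level e i = stg e (Suc i) - stg e i"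

lemma level_cong: "(\<And>x. x < M \<Longrightarrow> e x = e' x) \<Longrightarrow> level e = level e'"
  using F_cong[of e e'] by (auto simp: level_def stage_def)

lemma level_U: "level e i \<subseteq> U"
  using F_U by (auto simp: level_def)

lemma level_unique: "u \<in> level e i \<Longrightarrow> u \<in> level e j \<Longrightarrow> i = j"
  using stg_mono[of "Suc i" j e] stg_mono[of "Suc j" i e] unfolding level_def
  by (metis Diff_iff Suc_leI linorder_neqE_nat subsetD)

text \<open>Stages that repeat once are constant from there on, so growth at step \<open>n\<close>
  forces growth at all earlier steps.\<close>

lemma levels_nonempty: "\<exists>e. \<forall>i\<le>n. level e i \<noteq> {}"
proof -
  obtain e where e: "stg e n \<noteq> stg e (Suc n)"
    using unbounded by blast
  have "level e i \<noteq> {}" if "i \<le> n" for i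
  proof
    assume "level e i = {}"
    then have eq: "stg e (Suc i) = stg e i"
      using stg_mono[of i "Suc i" e] by (auto simp: level_def)
    have "stg e (i + m) = stg e i" for m
      using eq by (induction m) auto
    from this[of "n - i"] this[of "Suc n - i"] show False
      using e that by simp
  qed
  then show ?thesis by blast
qed

text \<open>
  The variables below \<open>M\<close> hold the parameters \<open>p\<close>; from \<open>M\<close> on, consecutive blocks of \<open>k\<close> variables
  hold the tuples \<open>b 0, b 1, \<dots>\<close>.
\<close>

definition vars :: "nat \<Rightarrow> nat list" where
  "vars i = [M + k * i..<M + k * i + k]"

definition blk :: "(nat \<Rightarrow> 'a) \<Rightarrow> nat \<Rightarrow> 'a list" where
  "blk e i = map e (vars i)"

definition env :: "(nat \<Rightarrow> 'a) \<Rightarrow> (nat \<Rightarrow> 'a list) \<Rightarrow> nat \<Rightarrow> 'a" where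
  "env p b x = (if x < M then p x else b ((x - M) div k) ! ((x - M) mod k))"

lemma blk_U: "blk e i \<in> U"
  by (simp add: blk_def vars_def U_def)

lemma blk_nth: "i < k \<Longrightarrow> blk e q ! i = e (M + k * q + i)"
  by (simp add: blk_def vars_def)

lemma env_blk: "env e (blk e) = e"
  using k_pos by (auto simp: fun_eq_iff env_def blk_nth add.assoc)

lemma blk_env: "range b \<subseteq> U \<Longrightarrow> blk (env p b) i = b i"
  by (auto simp: blk_def vars_def env_def list_eq_iff_nth_eq U_def image_subset_iff)

lemma level_env: "level (env p b) = level p"
  by (rule level_cong) (simp add: env_def)

lemma map_vars01: "map e [M..<M + 2 * k] = blk e 0 @ blk e 1"
proof -
  have "[M..<M + 2 * k] = vars 0 @ vars 1"
    using upt_add_eq_append[of M "M + k" k] by (simp add: vars_def mult_2 add.assoc)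
  then show ?thesis by (simp add: blk_def)
qed

subsection \<open>The comparison relation\<close>

definition Lop :: "(nat \<Rightarrow> 'a) \<Rightarrow> 'a list set \<Rightarrow> 'a list set" where
  "Lop e S = {as. length as = 2 * k \<and>
    take k as \<in> F e {x \<in> U. drop k as \<notin> F e {y \<in> U. x @ y \<notin> S}}}"

definition L :: "(nat \<Rightarrow> 'a) \<Rightarrow> 'a list \<Rightarrow> 'a list \<Rightarrow> bool" where
  "L e x y \<longleftrightarrow> x @ y \<in> lfp (Lop e)"

lemma mono_Lop: "mono (Lop e)"
proof (rule monoI)
  fix S T :: "'a list set" assume "S \<subseteq> T"
  then have "F e {y \<in> U. x @ y \<notin> T} \<subseteq> F e {y \<in> U. x @ y \<notin> S}" for x
    by (intro monoD[OF mono_operator[OF pos]]) auto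
  then have "F e {x \<in> U. z \<notin> F e {y \<in> U. x @ y \<notin> S}} \<subseteq> F e {x \<in> U. z \<notin> F e {y \<in> U. x @ y \<notin> T}}" for z
    by (intro monoD[OF mono_operator[OF pos]]) auto
  then show "Lop e S \<subseteq> Lop e T"
    by (auto simp: Lop_def)
qed

lemma L_unfold:
  assumes "x \<in> U" "y \<in> U"
  shows "L e x y \<longleftrightarrow> x \<in> F e {x' \<in> U. y \<notin> F e {y' \<in> U. \<not> L e x' y'}}"
  using assms unfolding L_def by (subst lfp_unfold[OF mono_Lop]) (simp add: Lop_def U_def)

lemma L_cong: "(\<And>x. x < M \<Longrightarrow> e x = e' x) \<Longrightarrow> L e = L e'"
  using F_cong[of e e'] by (simp add: L_def Lop_def[abs_def] fun_eq_iff)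

lemma L_stg:
  "x \<in> U \<Longrightarrow> y \<in> stg e (Suc j) \<Longrightarrow> L e x y \<Longrightarrow> x \<in> stg e (Suc j)"
  "x \<in> stg e (Suc j) \<Longrightarrow> y \<in> U \<Longrightarrow> y \<notin> stg e j \<Longrightarrow> L e x y"
  unfolding stage_def
  by (rule stage_comparison[of "F e" U "L e", OF mono_operator[OF pos] F_U];
      (assumption | rule L_unfold)+)+

text \<open>For \<open>u\<close> in level \<open>i\<close> the set
  \<open>{x \<in> U. L e x u}\<close> is stage \<open>i + 1\<close>; one application of the operator
  gives stage \<open>i + 2\<close>, and the negation removes stage \<open>i + 1\<close> again.
  Negating \<open>L\<close> is legitimate, as it is a completed fixed point here.\<close>

definition succ :: "(nat \<Rightarrow> 'a) \<Rightarrow> 'a list \<Rightarrow> 'a list \<Rightarrow> bool" where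
  "succ e u v \<longleftrightarrow> v \<in> F e {x \<in> U. L e x u} \<and> \<not> L e v u"

lemma succ_level:
  assumes "u \<in> level e i" "v \<in> U"
  shows "succ e u v \<longleftrightarrow> v \<in> level e (Suc i)"
proof -
  have "L e x u \<longleftrightarrow> x \<in> stg e (Suc i)" if "x \<in> U" for x
    using L_stg(1)[OF that, of u e i] L_stg(2)[of x e i u] assms level_U
    by (auto simp: level_def simp del: stage_simps)
  moreover from this have "{x \<in> U. L e x u} = stg e (Suc i)"
    using F_U by auto
  ultimately show ?thesis
    using assms(2) by (simp add: succ_def level_def)
qed

text \<open>Substituting \<open>\<psi>\<close> for \<open>X\<close> applies the operator to the set
  that \<open>\<psi>\<close> defines. Relation variable 0 is reserved for the comparison fixed
  point, hence \<open>dom \<Delta> \<subseteq> {0}\<close> and fresh variables from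
  \<open>Suc 0\<close> on.\<close>

lemma sat_sub_\<Phi>:
  assumes "wf_fm A \<Delta> \<psi>" "dom \<Delta> \<subseteq> {0}" "length x = k" "\<And>i. i \<in> fv \<Phi> \<Longrightarrow> e (\<sigma> i) = push x p i"
  shows "sat A R e (sub \<Phi> [X \<mapsto> k] (\<lambda>_. \<psi>) \<sigma> (Suc 0)) \<longleftrightarrow> x \<in> F p {as \<in> U. sat A R (push as e) \<psi>}"
proof -
  let ?S = "{as \<in> U. sat A R (push as e) \<psi>}"
  have "sat A R e (sub \<Phi> [X \<mapsto> k] (\<lambda>_. \<psi>) \<sigma> (Suc 0)) \<longleftrightarrow> sat A (no_rels(X := ?S)) (e \<circ> \<sigma>) \<Phi>"
    using assms(1,2) by (intro sat_sub[OF wf, of \<Delta>]) (auto simp: U_def split: if_splits)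
  also have "\<dots> \<longleftrightarrow> sat A (no_rels(X := ?S)) (push x p) \<Phi>"
    using assms(4) by (intro sat_cong[OF wf]) auto
  finally show ?thesis using assms(3) by (simp add: operator_def)
qed

lemma wf_sub_\<Phi>: "wf_fm A \<Delta> \<psi> \<Longrightarrow> dom \<Delta> \<subseteq> {0} \<Longrightarrow> wf_fm A \<Delta> (sub \<Phi> [X \<mapsto> k] (\<lambda>_. \<psi>) \<sigma> (Suc 0))"
  by (intro wf_sub[OF wf]) auto

text \<open>In the context of this formula \<open>y'\<close> is in front and \<open>x'\<close>
  behind it, so the pair \<open>x' @ y'\<close> is read from the second block and then the
  first.\<close>

definition \<psi>\<^sub>2 :: fm where
  "\<psi>\<^sub>2 = Neg (RVar 0 (map Var ([k..<2 * k] @ [0..<k])))"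

text \<open>With \<open>x'\<close> pushed, the variables of \<open>y\<close>, which start at
  \<open>M + k\<close>, start at \<open>2 * k + M\<close>, and the parameter at \<open>i - k\<close>
  is at \<open>i\<close>.\<close>

definition \<psi>\<^sub>1 :: fm where
  "\<psi>\<^sub>1 = Neg (sub \<Phi> [X \<mapsto> k] (\<lambda>_. \<psi>\<^sub>2) (\<lambda>i. if i < k then 2 * k + M + i else i) (Suc 0))"

definition L_body :: fm where
  "L_body = sub \<Phi> [X \<mapsto> k] (\<lambda>_. \<psi>\<^sub>1) (\<lambda>i. if i < k then M + i else i - k) (Suc 0)"

definition L_fm :: fm where
  "L_fm = Mu 0 [M..<M + 2 * k] L_body"

lemma wf_L_fm: "wf_fm A Map.empty L_fm"
proof -
  let ?\<Delta> = "[0 \<mapsto> 2 * k]"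
  have \<psi>2: "wf_fm A ?\<Delta> \<psi>\<^sub>2" "polarity False 0 \<psi>\<^sub>2"
    by (auto simp: \<psi>\<^sub>2_def)
  \<comment> \<open>\<open>X\<close> is positive in \<open>\<Phi>\<close>, so substitution keeps the
    sign of variable 0; the negations of \<open>\<psi>\<^sub>2\<close> and
    \<open>\<psi>\<^sub>1\<close> then cancel.\<close>
  have "polarity False 0 (sub \<Phi> [X \<mapsto> k] (\<lambda>_. \<psi>\<^sub>2) \<sigma> (Suc 0))" for \<sigma>
    using \<psi>2 pos by (intro polarity_sub[OF wf]) (auto split: if_splits)
  then have \<psi>1: "wf_fm A ?\<Delta> \<psi>\<^sub>1" "polarity True 0 \<psi>\<^sub>1"
    using wf_sub_\<Phi>[OF \<psi>2(1)] by (auto simp: \<psi>\<^sub>1_def)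
  then have "wf_fm A ?\<Delta> L_body" "only_positive 0 L_body"
    using pos unfolding L_body_def by (auto intro!: wf_sub_\<Phi> polarity_sub[OF wf] split: if_splits)
  then show ?thesis by (simp add: L_fm_def)
qed

lemma sat_L_body:
  assumes "length x = k" "length y = k"
  shows "sat A (R(0 := S)) (upds e [M..<M + 2 * k] (x @ y)) L_body \<longleftrightarrow>
    x \<in> F e {x' \<in> U. y \<notin> F e {y' \<in> U. x' @ y' \<notin> S}}"
proof -
  let ?R = "R(0 := S)" and ?e = "upds e [M..<M + 2 * k] (x @ y)" and ?\<Delta> = "[0 \<mapsto> 2 * k]"
  have \<psi>2: "wf_fm A ?\<Delta> \<psi>\<^sub>2"
    by (auto simp: \<psi>\<^sub>2_def)
  then have \<psi>1: "wf_fm A ?\<Delta> \<psi>\<^sub>1"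
    by (auto simp: \<psi>\<^sub>1_def intro!: wf_sub_\<Phi> split: if_splits)
  have e: "?e (M + i) = (x @ y) ! i" if "i < 2 * k" for i
    using upds_upt[of "x @ y" "2 * k" e M] assms that by simp
  have e2: "?e (k + (M + i)) = y ! i" if "i < k" for i
    using e[of "k + i"] assms that by (simp add: nth_append add.left_commute)
  have e': "?e i = e i" if "i < M" for i
    using that by (intro upds_notin) simp
  have "sat A ?R (push y' (push x' ?e)) \<psi>\<^sub>2 \<longleftrightarrow> x' @ y' \<notin> S" if "x' \<in> U" "y' \<in> U" for x' y'
  proof -
    have "map (push y' (push x' ?e)) ([k..<2 * k] @ [0..<k]) = x' @ y'"
      using that by (auto simp: list_eq_iff_nth_eq nth_append push_def U_def)
    then have "map (eval A (push y' (push x' ?e))) (map Var ([k..<2 * k] @ [0..<k])) = x' @ y'"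
      by (simp add: comp_def)
    then show ?thesis by (simp only: \<psi>\<^sub>2_def sat.simps) simp
  qed
  moreover have "sat A ?R (push x' ?e) \<psi>\<^sub>1 \<longleftrightarrow>
      y \<notin> F e {y' \<in> U. sat A ?R (push y' (push x' ?e)) \<psi>\<^sub>2}" if "x' \<in> U" for x'
    unfolding \<psi>\<^sub>1_def sat.simps using that assms e2 e'
    by (subst sat_sub_\<Phi>[OF \<psi>2, of y _ _ e])
      (auto simp: push_def U_def nth_append add.assoc dest!: fv_less_M)
  ultimately have "{x' \<in> U. sat A ?R (push x' ?e) \<psi>\<^sub>1} = {x' \<in> U. y \<notin> F e {y' \<in> U. x' @ y' \<notin> S}}"
    by (auto cong: conj_cong)
  moreover have "sat A ?R ?e L_body \<longleftrightarrow> x \<in> F e {x' \<in> U. sat A ?R (push x' ?e) \<psi>\<^sub>1}"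
    unfolding L_body_def using assms e e'
    by (intro sat_sub_\<Phi>[OF \<psi>1]) (auto simp: push_def nth_append dest!: fv_less_M)
  ultimately show ?thesis by simp
qed

lemma sat_L_fm: "sat A R e L_fm \<longleftrightarrow> L e (blk e 0) (blk e 1)"
proof -
  have "{as. length as = length [M..<M + 2 * k] \<and>
      sat A (R(0 := S)) (upds e [M..<M + 2 * k] as) L_body} = Lop e S" for S
    using sat_L_body[of "take k as" "drop k as" R S e for as]
    by (auto simp: Lop_def)
  then show ?thesis
    unfolding L_fm_def L_def map_vars01[symmetric] by (simp only: sat.simps)
qed

text \<open>Stage 0 is empty, so level 0 is the operator applied to the empty set.\<close>

definition zero_fm :: fm where
  "zero_fm = sub \<Phi> [X \<mapsto> k] (\<lambda>_. Falsum) (\<lambda>i. if i < k then M + i else i - k) (Suc 0)"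

lemma wf_zero_fm: "wf_fm A Map.empty zero_fm"
  unfolding zero_fm_def by (rule wf_sub_\<Phi>) auto

lemma sat_zero_fm: "sat A R e zero_fm \<longleftrightarrow> blk e 0 \<in> level e 0"
  unfolding zero_fm_def using fv_less_M
  by (subst sat_sub_\<Phi>[of Map.empty _ "blk e 0" _ _ e]) (auto simp: level_def blk_def vars_def push_def)

text \<open>The first renaming places \<open>L_fm\<close> in the context with a tuple
  \<open>x\<close> pushed: its parameters move up by \<open>k\<close>, its first block becomes
  \<open>x\<close>, and its second block keeps its indices and thereby denotes block 0. The second
  renaming exchanges the two blocks.\<close>

definition succ_fm :: fm where
  "succ_fm = And
    (sub \<Phi> [X \<mapsto> k] (\<lambda>_. ren L_fm (\<lambda>i. if i < M then k + i else if i < M + k then i - M else i))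
      (\<lambda>i. if i < k then M + k + i else i - k) (Suc 0))
    (Neg (ren L_fm (\<lambda>i. if i < M then i else if i < M + k then i + k else i - k)))"

lemma wf_succ_fm: "wf_fm A Map.empty succ_fm"
  unfolding succ_fm_def using wf_L_fm by (auto intro!: wf_sub_\<Phi> wf_ren)

lemma sat_succ_fm: "sat A R e succ_fm \<longleftrightarrow> succ e (blk e 0) (blk e 1)"
proof -
  define \<rho> where "\<rho> = (\<lambda>i. if i < M then k + i else if i < M + k then i - M else i)"
  define \<tau> where "\<tau> = (\<lambda>i. if i < M then i else if i < M + k then i + k else i - k)"
  have "sat A R (push x e) (ren L_fm \<rho>) \<longleftrightarrow> L e x (blk e 0)" if "x \<in> U" for x
  proof -
    have "L (push x e \<circ> \<rho>) = L e"
      using that by (intro L_cong) (auto simp: \<rho>_def push_def U_def)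
    moreover have "blk (push x e \<circ> \<rho>) 0 = x" "blk (push x e \<circ> \<rho>) 1 = blk e 0"
      using that by (auto simp: blk_def vars_def list_eq_iff_nth_eq \<rho>_def push_def U_def)
    ultimately show ?thesis
      by (simp only: sat_ren[OF wf_L_fm] sat_L_fm)
  qed
  then have "{x \<in> U. sat A R (push x e) (ren L_fm \<rho>)} = {x \<in> U. L e x (blk e 0)}"
    by auto
  moreover have "sat A R e (ren L_fm \<tau>) \<longleftrightarrow> L e (blk e 1) (blk e 0)"
  proof -
    have "L (e \<circ> \<tau>) = L e"
      by (intro L_cong) (auto simp: \<tau>_def)
    moreover have "blk (e \<circ> \<tau>) 0 = blk e 1" "blk (e \<circ> \<tau>) 1 = blk e 0"
      by (auto simp: blk_def vars_def list_eq_iff_nth_eq \<tau>_def add_ac)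
    ultimately show ?thesis
      by (simp only: sat_ren[OF wf_L_fm] sat_L_fm)
  qed
  moreover have "sat A R e (sub \<Phi> [X \<mapsto> k] (\<lambda>_. ren L_fm \<rho>) (\<lambda>i. if i < k then M + k + i else i - k) (Suc 0)) \<longleftrightarrow>
      blk e 1 \<in> F e {x \<in> U. sat A R (push x e) (ren L_fm \<rho>)}"
    using wf_ren[OF wf_L_fm, of \<rho>]
    by (intro sat_sub_\<Phi>) (auto simp: blk_def vars_def push_def)
  ultimately show ?thesis
    by (simp add: succ_fm_def succ_def flip: \<rho>_def \<tau>_def)
qed


subsection \<open>Definable relations on blocks of variables\<close>

definition defined_by :: "fm \<Rightarrow> ((nat \<Rightarrow> 'a) \<Rightarrow> (nat \<Rightarrow> 'a list) \<Rightarrow> bool) \<Rightarrow> bool" where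
  "defined_by \<theta> P \<longleftrightarrow> wf_fm A Map.empty \<theta> \<and>
    (\<forall>p b R. range b \<subseteq> U \<longrightarrow> (sat A R (env p b) \<theta> \<longleftrightarrow> P p b))"

definition D :: "((nat \<Rightarrow> 'a) \<Rightarrow> (nat \<Rightarrow> 'a list) \<Rightarrow> bool) \<Rightarrow> bool" where
  "D P \<longleftrightarrow> (\<exists>\<theta>. defined_by \<theta> P)"

lemma defined_byI:
  "wf_fm A Map.empty \<theta> \<Longrightarrow> (\<And>p b R. range b \<subseteq> U \<Longrightarrow> sat A R (env p b) \<theta> \<longleftrightarrow> P p b) \<Longrightarrow> defined_by \<theta> P"
  by (simp add: defined_by_def)

text \<open>The quantified tuple becomes the new block 0. Parameters move up by \<open>k\<close>
  past it, while later blocks keep their indices, which in the longer context denote the preceding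
  blocks.\<close>

definition BEx :: "fm \<Rightarrow> fm" where
  "BEx \<theta> = DExs k (ren \<theta> (\<lambda>x. if x < M then x + k else if x < M + k then x - M else x))"

lemma wf_BEx: "wf_fm A \<Gamma> \<theta> \<Longrightarrow> wf_fm A \<Gamma> (BEx \<theta>)"
  by (simp add: BEx_def wf_DExs wf_ren)

lemma polarity_BEx [simp]: "polarity c Y (BEx \<theta>) \<longleftrightarrow> polarity c Y \<theta>"
  by (simp add: BEx_def)

lemma sat_BEx:
  assumes "wf_fm A \<Gamma> \<theta>"
  shows "sat A R (env p b) (BEx \<theta>) \<longleftrightarrow> (\<exists>a\<in>U. sat A R (env p (push [a] b)) \<theta>)"
proof -
  define \<rho> where "\<rho> = (\<lambda>x. if x < M then x + k else if x < M + k then x - M else x)"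
  have "push a (env p b) \<circ> \<rho> = env p (push [a] b)" if "a \<in> U" for a
  proof
    fix x
    consider "x < M" | "M \<le> x" "x < M + k" | "M + k \<le> x" by linarith
    then show "(push a (env p b) \<circ> \<rho>) x = env p (push [a] b) x"
    proof cases
      case 2
      then have "x - M < k" by linarith
      then show ?thesis using 2 that by (simp add: \<rho>_def push_def env_def U_def)
    next
      case 3
      then have "(x - M) div k = Suc ((x - k - M) div k)" "(x - M) mod k = (x - k - M) mod k"
        using k_pos le_div_geq[of k "x - M"] le_mod_geq[of k "x - M"] by (simp_all add: add.commute[of k M])
      moreover have "\<not> x - k < M" using 3 by simp
      ultimately show ?thesis using 3 that by (simp add: \<rho>_def push_def env_def U_def)
    qed (use that in \<open>simp_all add: \<rho>_def push_def env_def U_def\<close>)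
  qed
  then have "sat A R (push a (env p b)) (ren \<theta> \<rho>) = sat A R (env p (push [a] b)) \<theta>" if "a \<in> U" for a
    using that by (simp only: sat_ren[OF assms])
  then show ?thesis
    unfolding BEx_def \<rho>_def[symmetric] sat_DExs[OF wf_ren[OF assms]] by (auto simp: U_def)
qed

lemma D_zero: "D (\<lambda>p b. b 0 \<in> level p 0)"
  unfolding D_def
  by (intro exI[of _ zero_fm] defined_byI wf_zero_fm) (simp add: sat_zero_fm blk_env level_env)

lemma D_nonzero: "D (\<lambda>p b. b 0 \<notin> level p 0)"
  unfolding D_def using wf_zero_fm
  by (intro exI[of _ "Neg zero_fm"] defined_byI) (simp_all add: sat_zero_fm blk_env level_env)

lemma succ_cong: "(\<And>x. x < M \<Longrightarrow> e x = e' x) \<Longrightarrow> succ e = succ e'"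
  using F_cong[of e e'] L_cong[of e e'] by (simp add: succ_def fun_eq_iff)

lemma succ_env: "succ (env p b) = succ p"
  by (rule succ_cong) (simp add: env_def)

lemma D_succ: "D (\<lambda>p b. succ p (b 0) (b 1))"
  unfolding D_def
  by (intro exI[of _ succ_fm] defined_byI wf_succ_fm) (simp add: sat_succ_fm blk_env succ_env)

lemma D_eq: "D (\<lambda>p b. b 0 = b 1)"
  unfolding D_def
proof (intro exI defined_byI)
  let ?\<theta> = "eqs (map (\<lambda>i. (M + i, Var (M + k + i))) [0..<k]) (Neg Falsum)"
  show "wf_fm A Map.empty ?\<theta>" by auto
  fix p R and b :: "nat \<Rightarrow> 'a list" assume b: "range b \<subseteq> U"
  have "sat A R e ?\<theta> \<longleftrightarrow> blk e 0 = blk e 1" for e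
    by (auto simp: blk_def vars_def list_eq_iff_nth_eq)
  then show "sat A R (env p b) ?\<theta> \<longleftrightarrow> b 0 = b 1"
    by (simp only: blk_env[OF b])
qed

lemma D_conj: "D P \<Longrightarrow> D Q \<Longrightarrow> D (\<lambda>p b. P p b \<and> Q p b)"
  unfolding D_def defined_by_def by (metis sat.simps(5) wf_fm.simps(5))

lemma range_push1: "a \<in> U \<Longrightarrow> range b \<subseteq> U \<Longrightarrow> range (push [a] b) \<subseteq> U"
  by (auto simp: push_def)

lemma D_ex: "D P \<Longrightarrow> D (\<lambda>p b. \<exists>a\<in>U. P p (push [a] b))"
  unfolding D_def
proof (elim exE)
  fix \<theta> assume \<theta>: "defined_by \<theta> P"
  then have "defined_by (BEx \<theta>) (\<lambda>p b. \<exists>a\<in>U. P p (push [a] b))"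
    unfolding defined_by_def
    using sat_BEx[of Map.empty \<theta>] wf_BEx[of Map.empty \<theta>] range_push1 by metis
  then show "\<exists>\<theta>. defined_by \<theta> (\<lambda>p b. \<exists>a\<in>U. P p (push [a] b))" by blast
qed

lemma D_ren: "D P \<Longrightarrow> D (\<lambda>p b. P p (\<lambda>i. b (\<sigma> i)))"
  unfolding D_def
proof (elim exE)
  fix \<theta> assume \<theta>: "defined_by \<theta> P"
  define \<rho> where "\<rho> = (\<lambda>x. if x < M then x else M + (\<sigma> ((x - M) div k) * k + (x - M) mod k))"
  have "env p b \<circ> \<rho> = env p (\<lambda>i. b (\<sigma> i))" for p b
    using k_pos by (auto simp: fun_eq_iff env_def \<rho>_def)
  then have "defined_by (ren \<theta> \<rho>) (\<lambda>p b. P p (\<lambda>i. b (\<sigma> i)))"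
    using \<theta> by (auto simp: defined_by_def sat_ren image_subset_iff intro: wf_ren)
  then show "\<exists>\<theta>. defined_by \<theta> (\<lambda>p b. P p (\<lambda>i. b (\<sigma> i)))" by blast
qed

text \<open>Pairs are stored as concatenated tuples. The order of the quantifiers is that of two
  nested \<open>BEx\<close>, the inner of which supplies the front block \<open>u\<close>.\<close>

lemma lfp_reach:
  fixes P :: "'a list \<Rightarrow> 'a list \<Rightarrow> bool" and Q :: "'a list \<Rightarrow> 'a list \<Rightarrow> 'a list \<Rightarrow> 'a list \<Rightarrow> bool"
  defines "G \<equiv> \<lambda>S. {as. length as = 2 * k \<and> (P (take k as) (drop k as) \<or>
    (\<exists>v\<in>U. \<exists>u\<in>U. Q u v (take k as) (drop k as) \<and> u @ v \<in> S))}"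
  assumes "u \<in> U" "v \<in> U"
  shows "u @ v \<in> lfp G \<longleftrightarrow> reach U P Q u v"
proof
  have "mono G"
    unfolding G_def by (intro monoI) blast
  have "G {as. length as = 2 * k \<and> reach U P Q (take k as) (drop k as)} \<subseteq>
      {as. length as = 2 * k \<and> reach U P Q (take k as) (drop k as)}"
    by (auto simp: G_def U_def intro: reach.intros)
  then have "lfp G \<subseteq> {as. length as = 2 * k \<and> reach U P Q (take k as) (drop k as)}"
    by (rule lfp_lowerbound)
  then show "reach U P Q u v" if "u @ v \<in> lfp G"
    using that assms(2,3) by (auto simp: U_def)
  assume "reach U P Q u v"
  then show "u @ v \<in> lfp G"
  proof induction
    case (base u v)
    then show ?case
      by (subst lfp_unfold[OF \<open>mono G\<close>]) (simp add: G_def U_def)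
  next
    case (step u v u' v')
    from step.hyps(1) have "u \<in> U" "v \<in> U" by (auto elim: reach.cases)
    then have "u' @ v' \<in> G (lfp G)"
      using step by (auto simp: G_def U_def)
    then show ?case
      by (subst lfp_unfold[OF \<open>mono G\<close>])
  qed
qed

lemma upds_env:
  assumes "u \<in> U" "v \<in> U"
  shows "upds (env p b) [M..<M + 2 * k] (u @ v) = env p (push [u, v] (\<lambda>i. b (i + 2)))"
proof
  fix x
  have uv: "length (u @ v) = 2 * k" "length u = k" using assms by (simp_all add: U_def)
  consider "x < M" | "M \<le> x" "x < M + k" | "M + k \<le> x" "x < M + 2 * k" | "M + 2 * k \<le> x" by linarith
  then show "upds (env p b) [M..<M + 2 * k] (u @ v) x = env p (push [u, v] (\<lambda>i. b (i + 2))) x"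
  proof cases
    case 2
    then have "x - M < k" by linarith
    then show ?thesis using 2 uv by (simp add: upds_upt[OF uv(1)] env_def nth_append)
  next
    case 3
    then have "(x - M) div k = 1" "(x - M) mod k = x - M - k"
      using k_pos le_div_geq[of k "x - M"] le_mod_geq[of k "x - M"] by simp_all
    moreover have "\<not> x - M < k" using 3 by simp
    ultimately show ?thesis using 3 uv by (simp add: upds_upt[OF uv(1)] env_def nth_append)
  next
    case 4
    then have "(x - M) div k = Suc (Suc ((x - M - k - k) div k))"
      using k_pos le_div_geq[of k "x - M"] le_div_geq[of k "x - M - k"] by simp
    then show ?thesis using 4 by (simp add: upds_upt[OF uv(1)] env_def)
  qed (use uv in \<open>simp_all add: upds_upt[OF uv(1)] env_def nth_append\<close>)
qed

lemma D_reach: "D P \<Longrightarrow> D Q \<Longrightarrow> D (reachable U P Q)"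
  unfolding D_def
proof (elim exE)
  fix \<theta> \<chi> assume "defined_by \<theta> P" "defined_by \<chi> Q"
  then have \<theta>: "wf_fm A Map.empty \<theta>" "\<And>R p b. range b \<subseteq> U \<Longrightarrow> sat A R (env p b) \<theta> \<longleftrightarrow> P p b"
    and \<chi>: "wf_fm A Map.empty \<chi>" "\<And>R p b. range b \<subseteq> U \<Longrightarrow> sat A R (env p b) \<chi> \<longleftrightarrow> Q p b"
    by (auto simp: defined_by_def)
  let ?vs = "[M..<M + 2 * k]" and ?\<Gamma> = "[0 \<mapsto> 2 * k]"
  \<comment> \<open>Below the two quantifiers the blocks are \<open>u, v, u', v'\<close> and then
    the parameters, as \<open>Q\<close> expects; the variables \<open>?vs\<close> now denote the old
    pair \<open>u, v\<close>.\<close>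
  define \<rho> where "\<rho> = And \<chi> (RVar 0 (map Var ?vs))"
  define \<beta> where "\<beta> = Or \<theta> (BEx (BEx \<rho>))"
  have wf_\<rho>: "wf_fm A ?\<Gamma> \<rho>"
    using \<chi>(1) by (auto simp: \<rho>_def intro: wf_fm_mono)
  then have wf_\<beta>: "wf_fm A ?\<Gamma> \<beta>"
    using \<theta>(1) by (auto simp: \<beta>_def intro!: wf_BEx intro: wf_fm_mono)
  have pos_\<beta>: "only_positive 0 \<beta>"
    using polarity_fresh[OF \<theta>(1)] polarity_fresh[OF \<chi>(1)] by (simp add: \<beta>_def \<rho>_def)
  have push: "push [u] (push [v] (push as b)) = push (u # v # as) b" for u v as and b :: "nat \<Rightarrow> 'a list"
    by (auto simp: fun_eq_iff push_def nth_Cons')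
  have \<rho>: "sat A R (env p b) \<rho> \<longleftrightarrow> Q p b \<and> b 0 @ b 1 \<in> R 0" if "range b \<subseteq> U" for R p b
    using \<chi>(2)[OF that] by (simp add: \<rho>_def comp_def map_vars01 blk_env[OF that])
  have \<beta>: "sat A R (env p b) \<beta> \<longleftrightarrow> P p b \<or> (\<exists>v\<in>U. \<exists>u\<in>U. Q p (push [u] (push [v] b)) \<and> u @ v \<in> R 0)"
    if b: "range b \<subseteq> U" for R p b
  proof -
    have "sat A R (env p (push [u] (push [v] b))) \<rho> \<longleftrightarrow> Q p (push [u] (push [v] b)) \<and> u @ v \<in> R 0"
      if "u \<in> U" "v \<in> U" for u v
      using \<rho>[OF range_push1[OF that(1) range_push1[OF that(2) b]]] by (simp add: push_def)
    then show ?thesis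
      using \<theta>(2)[OF b] by (simp add: \<beta>_def sat_BEx[OF wf_\<rho>] sat_BEx[OF wf_BEx[OF wf_\<rho>]] cong: bex_cong)
  qed
  have "sat A R (env p b) (Mu 0 ?vs \<beta>) \<longleftrightarrow> reachable U P Q p b" if b: "range b \<subseteq> U" for R p b
  proof -
    define b' where "b' = (\<lambda>i. b (i + 2))"
    have b': "range b' \<subseteq> U" using b by (auto simp: b'_def)
    have "sat A (R(0 := S)) (upds (env p b) ?vs as) \<beta> \<longleftrightarrow>
        P p (push [take k as, drop k as] b') \<or>
        (\<exists>v\<in>U. \<exists>u\<in>U. Q p (push [u, v, take k as, drop k as] b') \<and> u @ v \<in> S)"
      if "length as = 2 * k" for as S
    proof -
      have U: "take k as \<in> U" "drop k as \<in> U" using that by (simp_all add: U_def)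
      then have "range (push [take k as, drop k as] b') \<subseteq> U"
        using b' by (auto simp: push_def nth_Cons')
      then show ?thesis
        using \<beta>[of "push [take k as, drop k as] b'" "R(0 := S)" p] upds_env[OF U, of p b]
        by (simp add: push b'_def)
    qed
    then have "{as. length as = length ?vs \<and> sat A (R(0 := S)) (upds (env p b) ?vs as) \<beta>} =
        {as. length as = 2 * k \<and> (P p (push [take k as, drop k as] b') \<or>
          (\<exists>v\<in>U. \<exists>u\<in>U. Q p (push [u, v, take k as, drop k as] b') \<and> u @ v \<in> S))}" for S
      by auto
    moreover have "map (env p b) ?vs = b 0 @ b 1"
      by (simp only: map_vars01 blk_env[OF b])
    moreover have "b 0 \<in> U" "b 1 \<in> U" using b by auto
    ultimately show ?thesis
      using lfp_reach[of "b 0" "b 1" "\<lambda>u v. P p (push [u, v] b')" "\<lambda>u v u' v'. Q p (push [u, v, u', v'] b')"]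
      unfolding reachable_def b'_def by (simp only: sat.simps)
  qed
  moreover have "wf_fm A Map.empty (Mu 0 ?vs \<beta>)"
    using wf_\<beta> pos_\<beta> by simp
  ultimately have "defined_by (Mu 0 ?vs \<beta>) (reachable U P Q)"
    by (intro defined_byI)
  then show "\<exists>\<theta>. defined_by \<theta> (reachable U P Q)" by blast
qed

sublocale counting U level D succ
  by unfold_locales
    (use level_U level_unique D_zero D_nonzero D_succ succ_level D_eq D_conj D_ex D_ren D_reach in blast)+

subsection \<open>Diagonalisation\<close>

text \<open>
  \<open>shift \<theta>\<close> says that some successor of block 0 satisfies \<open>\<theta>\<close>. Iterating it replaces the substitution
  of a numeral, so that the code of the resulting sentence is easily computed.
\<close>

definition shift :: "fm \<Rightarrow> fm" where
  "shift \<theta> = exs (vars 1) (And succ_fm (letin (vars 0) (map Var (vars 1)) \<theta>))"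

definition W :: nat where
  "W = fresh (fv zero_fm \<union> fv succ_fm \<union> {..<M + 2 * k})"

text \<open>The quantified variables include the parameters: the sentence asks for some parameters
  under which \<open>n\<close> successor steps from level 0 lead to an element satisfying
  \<open>\<theta>\<close>. Fixed parameters would not do for all \<open>n\<close>, as they may
  provide only finitely many levels.\<close>

definition instance_at :: "nat \<Rightarrow> fm \<Rightarrow> fm" where
  "instance_at n \<theta> = exs [0..<W] (And zero_fm ((shift ^^ n) \<theta>))"

lemma vars01: "distinct (vars i)" "length (vars i) = k" "set (vars 0) \<inter> set (vars 1) = {}"
  "set (vars 0) \<union> set (vars 1) \<subseteq> {..<M + 2 * k}" "set (vars i) \<inter> {..<M} = {}"
  by (auto simp: vars_def)

lemma fv_instance_at:
  assumes "fv \<theta> \<subseteq> {..<M + k}"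
  shows "fv (instance_at n \<theta>) = {}"
proof -
  have less_W: "x < W" if "x \<in> fv zero_fm \<union> fv succ_fm \<union> {..<M + 2 * k}" for x
    unfolding W_def using that by (intro less_fresh) simp_all
  then have "fv zero_fm \<union> fv succ_fm \<subseteq> {..<W}"
    by blast
  moreover have "{..<M + 2 * k} \<subseteq> {..<W}"
    by (rule subsetI) (simp add: less_W)
  ultimately have W: "fv zero_fm \<union> fv succ_fm \<subseteq> {..<W}" "{..<M + 2 * k} \<subseteq> {..<W}" .
  have letin: "fv (letin (vars 0) (map Var (vars 1)) \<chi>) \<subseteq> set (vars 0) \<union> set (vars 1) \<union> fv \<chi>" for \<chi>
    by (auto simp: letin_def set_zip vars01(2))
  have shift: "fv (shift \<chi>) \<subseteq> {..<W}" if "fv \<chi> \<subseteq> {..<W}" for \<chi>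
  proof -
    have "fv (shift \<chi>) \<subseteq> fv succ_fm \<union> (set (vars 0) \<union> set (vars 1) \<union> fv \<chi>)"
      using letin[of \<chi>] by (simp add: shift_def) blast
    also have "\<dots> \<subseteq> {..<W}"
      using that W(1) subset_trans[OF vars01(4) W(2)] by simp
    finally show ?thesis .
  qed
  have "fv ((shift ^^ n) \<theta>) \<subseteq> {..<W}"
  proof (induction n)
    case 0
    have "{..<M + k} \<subseteq> {..<M + 2 * k}" by auto
    from subset_trans[OF assms subset_trans[OF this W(2)]] show ?case by simp
  next
    case (Suc n)
    then show ?case using shift by simp
  qed
  then show ?thesis using W(1) by (auto simp: instance_at_def)
qed

lemma wf_instance_at: "wf_fm A Map.empty \<theta> \<Longrightarrow> wf_fm A Map.empty (instance_at n \<theta>)"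
proof -
  assume "wf_fm A Map.empty \<theta>"
  then have "wf_fm A Map.empty ((shift ^^ n) \<theta>)"
    by (induction n) (auto simp: shift_def wf_succ_fm intro!: wf_letin)
  then show ?thesis by (simp add: instance_at_def wf_zero_fm)
qed

lemma blk_upds0:
  assumes "a \<in> U"
  shows "blk (upds e (vars 0) a) 0 = a" "level (upds e (vars 0) a) = level e"
proof -
  show "blk (upds e (vars 0) a) 0 = a"
    using assms vars01 by (simp add: blk_def map_upds U_def)
  show "level (upds e (vars 0) a) = level e"
    using vars01(5) by (intro level_cong upds_notin) auto
qed

lemma sat_shift:
  assumes "blk e 0 \<in> level e i"
  shows "sat A R e (shift \<theta>) \<longleftrightarrow>
    (\<exists>a\<in>level e (Suc i). sat A R (upds (upds e (vars 1) a) (vars 0) a) \<theta>)"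
proof -
  have "sat A R (upds e (vars 1) a) succ_fm \<longleftrightarrow> a \<in> level e (Suc i)" if "a \<in> U" for a
  proof -
    have "blk (upds e (vars 1) a) 0 = blk e 0"
      using vars01(3) by (auto simp: blk_def intro!: upds_notin)
    moreover have "blk (upds e (vars 1) a) 1 = a"
      using that vars01 by (auto simp: blk_def map_upds U_def)
    moreover have "succ (upds e (vars 1) a) = succ e"
      using vars01(5) by (intro succ_cong upds_notin) auto
    ultimately show ?thesis
      using succ_level[OF assms that] by (simp add: sat_succ_fm)
  qed
  moreover have "sat A R (upds e (vars 1) a) (letin (vars 0) (map Var (vars 1)) \<theta>) \<longleftrightarrow>
      sat A R (upds (upds e (vars 1) a) (vars 0) a) \<theta>" if "a \<in> U" for a
  proof -
    have "map (eval A (upds e (vars 1) a)) (map Var (vars 1)) = a"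
      using that vars01 by (simp add: comp_def map_upds U_def)
    then show ?thesis
      using vars01 by (subst sat_letin) auto
  qed
  ultimately have "sat A R (upds e (vars 1) a) (And succ_fm (letin (vars 0) (map Var (vars 1)) \<theta>)) \<longleftrightarrow>
      a \<in> level e (Suc i) \<and> sat A R (upds (upds e (vars 1) a) (vars 0) a) \<theta>" if "a \<in> U" for a
    using that by simp
  moreover have "length a = k \<longleftrightarrow> a \<in> U" for a :: "'a list"
    by (simp add: U_def)
  ultimately show ?thesis
    using level_U[of e "Suc i"] unfolding shift_def sat_exs[OF vars01(1)] vars01(2) by blast
qed

text \<open>A shift leaves the successor in block 1 as well, which does no harm: the free variables
  of \<open>\<theta>\<close> are below \<open>M + k\<close>, and block 0 is overwritten by the next
  update.\<close>

lemma sat_shift_step: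
  fixes e :: "nat \<Rightarrow> 'a"
  assumes "wf_fm A Map.empty \<theta>" "fv \<theta> \<subseteq> {..<M + k}" "a \<in> U" "b \<in> U"
  defines "e' \<equiv> upds (upds e (vars 1) a) (vars 0) a"
  shows "level e' = level e" "blk e' 0 = a"
    "sat A R (upds e' (vars 0) b) \<theta> \<longleftrightarrow> sat A R (upds e (vars 0) b) \<theta>"
proof -
  have "level (upds e (vars 1) a) = level e"
    using vars01(5) by (intro level_cong upds_notin) auto
  then show "level e' = level e" "blk e' 0 = a"
    using blk_upds0[OF assms(3)] by (simp_all add: e'_def)
  have "upds e' (vars 0) b x = upds e (vars 0) b x" if "x \<in> fv \<theta>" for x
  proof (cases "x \<in> set (vars 0)")
    case True
    then obtain i where "i < k" "x = vars 0 ! i"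
      using vars01(2)[of 0] by (auto simp: in_set_conv_nth)
    then show ?thesis
      using assms(4) vars01 by (simp add: upds_nth U_def)
  next
    case False
    moreover from this have "x \<notin> set (vars 1)"
      using that assms(2) by (auto simp: vars_def)
    ultimately show ?thesis by (simp add: e'_def upds_notin)
  qed
  then show "sat A R (upds e' (vars 0) b) \<theta> \<longleftrightarrow> sat A R (upds e (vars 0) b) \<theta>"
    by (intro sat_cong_closed[OF assms(1)])
qed

lemma shift_funpow_D:
  assumes "wf_fm A Map.empty \<theta>" "fv \<theta> \<subseteq> {..<M + k}"
    "blk e 0 \<in> level e i" "sat A R e ((shift ^^ n) \<theta>)"
  shows "\<exists>a\<in>level e (i + n). sat A R (upds e (vars 0) a) \<theta>"
  using assms(3,4)
proof (induction n arbitrary: e i)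
  case 0
  then show ?case by (intro bexI[of _ "blk e 0"]) (simp_all add: blk_def)
next
  case (Suc n)
  then obtain a where a: "a \<in> level e (Suc i)"
    "sat A R (upds (upds e (vars 1) a) (vars 0) a) ((shift ^^ n) \<theta>)"
    by (auto simp: sat_shift)
  then have "a \<in> U" using level_U by blast
  note step = sat_shift_step[OF assms(1,2) \<open>a \<in> U\<close>]
  obtain b where "b \<in> level e (Suc i + n)"
    "sat A R (upds (upds (upds e (vars 1) a) (vars 0) a) (vars 0) b) \<theta>"
    using Suc.IH[OF _ a(2), of "Suc i"] a(1) step(1,2)[OF \<open>a \<in> U\<close>] by auto
  moreover from this have "b \<in> U" using level_U by blast
  ultimately show ?case using step(3) by (intro bexI[of _ b]) simp_all
qed

text \<open>Inhabited levels are needed for the successors to exist. In contrast to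
  \<open>shift_funpow_D\<close>, all elements of the target level must satisfy
  \<open>\<theta>\<close>; the diagonal formula does so, since its completeness is proved for every
  element of a level.\<close>

lemma shift_funpow_I:
  assumes "wf_fm A Map.empty \<theta>" "fv \<theta> \<subseteq> {..<M + k}"
    "blk e 0 \<in> level e i" "\<And>j. j \<le> i + n \<Longrightarrow> level e j \<noteq> {}"
    "\<And>a. a \<in> level e (i + n) \<Longrightarrow> sat A R (upds e (vars 0) a) \<theta>"
  shows "sat A R e ((shift ^^ n) \<theta>)"
  using assms(3-5)
proof (induction n arbitrary: e i)
  case 0
  from 0(3)[of "blk e 0"] 0(1) show ?case by (simp add: blk_def)
next
  case (Suc n)
  obtain a where a: "a \<in> level e (Suc i)"
    using Suc.prems(2)[of "Suc i"] by auto
  then have "a \<in> U" using level_U by blast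
  let ?e = "upds (upds e (vars 1) a) (vars 0) a"
  note step = sat_shift_step[OF assms(1,2) \<open>a \<in> U\<close>]
  have "sat A R ?e ((shift ^^ n) \<theta>)"
  proof (rule Suc.IH)
    show "blk ?e 0 \<in> level ?e (Suc i)"
      using a step(1,2)[OF \<open>a \<in> U\<close>] by simp
    show "level ?e j \<noteq> {}" if "j \<le> Suc i + n" for j
      using Suc.prems(2)[of j] that step(1)[OF \<open>a \<in> U\<close>] by simp
    show "sat A R (upds ?e (vars 0) b) \<theta>" if "b \<in> level ?e (Suc i + n)" for b
    proof -
      have "b \<in> level e (i + Suc n)" using that step(1)[OF \<open>a \<in> U\<close>] by simp
      moreover from this have "b \<in> U" using level_U by blast
      ultimately show ?thesis using step(3) Suc.prems(3) by blast
    qed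
  qed
  then show ?case
    using a Suc.prems(1) by (auto simp: sat_shift)
qed

section \<open>The diagonal formula and the contradiction\<close>

lemma D_one: "D (\<lambda>p b. b 0 \<in> level p 1)"
proof -
  have "(\<exists>a\<in>U. push [a] b 0 \<in> level p 0 \<and> succ p (push [a] b 0) (push [a] b 1)) \<longleftrightarrow> b 0 \<in> level p 1"
    if "b 0 \<in> U" for p b
  proof -
    have "succ p a (b 0) \<longleftrightarrow> b 0 \<in> level p 1" if "a \<in> level p 0" for a
      using succ_level[OF that \<open>b 0 \<in> U\<close>] by simp
    \<comment> \<open>If level 0 is empty, so is stage 1, hence also stage 2 and level 1.\<close>
    moreover have "\<exists>a. a \<in> level p 0" if "b 0 \<in> level p 1"
    proof (rule ccontr)
      assume "\<nexists>a. a \<in> level p 0"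
      then show False using that by (auto simp: level_def)
    qed
    ultimately have "(\<exists>a\<in>U. a \<in> level p 0 \<and> succ p a (b 0)) \<longleftrightarrow> b 0 \<in> level p 1"
      using level_U[of p 0] by blast
    then show ?thesis by simp
  qed
  moreover obtain \<theta> where "defined_by \<theta>
      (\<lambda>p b. \<exists>a\<in>U. push [a] b 0 \<in> level p 0 \<and> succ p (push [a] b 0) (push [a] b 1))"
    using D_ex[OF D_conj[OF D_zero D_succ]] unfolding D_def by blast
  ultimately have "defined_by \<theta> (\<lambda>p b. b 0 \<in> level p 1)"
    unfolding defined_by_def by (simp add: image_subset_iff)
  then show ?thesis unfolding D_def by blast
qed

text \<open>Only the output 1 is asked for, by the positive statement that some output lies in level
  1. Disjointness of the levels turns soundness into \<open>g [m] = 1\<close>.\<close>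

lemma diagonal_formula:
  assumes "computable 1 g"
  obtains \<delta> where "wf_fm A Map.empty \<delta>" "fv \<delta> \<subseteq> {..<M + k}"
    "\<And>e m. blk e 0 \<in> level e m \<Longrightarrow> sat A no_rels e \<delta> \<Longrightarrow> g [m] = 1"
    "\<And>m. g [m] = 1 \<Longrightarrow>
      \<exists>B. \<forall>e. (\<forall>i\<le>B. level e i \<noteq> {}) \<longrightarrow> blk e 0 \<in> level e m \<longrightarrow> sat A no_rels e \<delta>"
proof -
  obtain g' where g': "recursive 1 g'" "\<And>m. g' [m] = g [m]"
    using assms by (auto simp: computable_def)
  obtain P where P: "represents P 1 g'"
    using recursive_represents[OF g'(1)] by blast
  define Q where "Q = (\<lambda>p b. \<exists>y\<in>U. P p (push [y] b) \<and> push [y] b 0 \<in> level p 1)"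
  have "D Q"
    unfolding Q_def by (rule D_ex[OF D_conj[OF represents_D[OF P] D_one]])
  then obtain \<theta> where wf_\<theta>: "wf_fm A Map.empty \<theta>"
    and \<theta>: "\<And>p b. range b \<subseteq> U \<Longrightarrow> sat A no_rels (env p b) \<theta> \<longleftrightarrow> Q p b"
    unfolding D_def defined_by_def by blast
  have sat_\<theta>: "sat A no_rels e \<theta> \<longleftrightarrow> Q e (blk e)" for e
    using \<theta>[of "blk e" e] blk_U by (auto simp: env_blk)
  \<comment> \<open>The representing formula may have further free variables. Soundness holds for
    all of their values, and completeness may use the current ones, so they can be quantified
    existentially.\<close>
  define xs where "xs = sorted_list_of_set (fv \<theta> - {..<M + k})"
  have xs: "distinct xs" "set xs = fv \<theta> - {..<M + k}"
    by (simp_all add: xs_def)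
  show thesis
  proof (rule that)
    show "wf_fm A Map.empty (exs xs \<theta>)" "fv (exs xs \<theta>) \<subseteq> {..<M + k}"
      using wf_\<theta> xs by auto
  next
    fix e m assume m: "blk e 0 \<in> level e m" and "sat A no_rels e (exs xs \<theta>)"
    then obtain as where as: "length as = length xs" "sat A no_rels (upds e xs as) \<theta>"
      using sat_exs[OF xs(1)] by blast
    define e' where "e' = upds e xs as"
    have "level e' = level e" "blk e' 0 = blk e 0"
      using xs(2) by (auto simp: e'_def blk_def vars_def intro!: level_cong upds_notin)
    with m have m': "blk e' 0 \<in> level e' m" by simp
    obtain y where y: "y \<in> U" "P e' (push [y] (blk e'))" "y \<in> level e' 1"
      using as(2) unfolding e'_def[symmetric] sat_\<theta> Q_def by auto
    have "push [y] (blk e') 0 \<in> level e' (g' [m])"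
      using y m' blk_U by (intro represents_sound[OF P _ _ _ y(2)] range_push1) auto
    then show "g [m] = 1"
      using y(3) level_unique g'(2) by fastforce
  next
    fix m assume m: "g [m] = 1"
    have "length [m] = 1" by simp
    from represents_complete[OF P this]
    obtain B where B: "\<And>p b. (\<And>i. i \<le> B \<Longrightarrow> level p i \<noteq> {}) \<Longrightarrow> range b \<subseteq> U \<Longrightarrow>
      (\<And>i. i < 1 \<Longrightarrow> b (Suc i) \<in> level p ([m] ! i)) \<Longrightarrow> \<exists>u\<in>level p (g' [m]). P p (b(0 := u))"
      by blast
    have "sat A no_rels e (exs xs \<theta>)" if e: "\<forall>i\<le>B. level e i \<noteq> {}" "blk e 0 \<in> level e m" for e
    proof -
      \<comment> \<open>The pushed \<open>blk e 0\<close> only fills the output position; the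
        argument is the copy of \<open>blk e 0\<close> behind it.\<close>
      have "\<exists>u\<in>level e (g' [m]). P e ((push [blk e 0] (blk e))(0 := u))"
        using e blk_U by (intro B range_push1) auto
      moreover have "(push [blk e 0] (blk e))(0 := u) = push [u] (blk e)" for u
        by (auto simp: fun_eq_iff push_def)
      ultimately obtain u where u: "u \<in> level e 1" "P e (push [u] (blk e))"
        using m g'(2) by auto
      then have "sat A no_rels (upds e xs (map e xs)) \<theta>"
        using level_U by (auto simp: sat_\<theta> Q_def)
      then show ?thesis
        unfolding sat_exs[OF xs(1)] using length_map by blast
    qed
    then show "\<exists>B. \<forall>e. (\<forall>i\<le>B. level e i \<noteq> {}) \<longrightarrow> blk e 0 \<in> level e m \<longrightarrow> sat A no_rels e (exs xs \<theta>)"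
      by blast
  qed
qed

lemma code_computable_shift: "code_computable shift"
  unfolding shift_def[abs_def] letin_def
  by (intro code_computable_exs code_computable_And code_computable_eqs code_computable_id)

lemma computable_code_instance_at:
  obtains t where "computable 1 t"
    "\<And>\<theta>. t [fm_code \<theta>] = fm_code (instance_at (fm_code \<theta>) \<theta>)"
proof -
  obtain h where h: "computable 1 h" "\<And>\<theta>. fm_code (shift \<theta>) = h [fm_code \<theta>]"
    using code_computable_shift unfolding code_computable_def by blast
  have "code_computable (\<lambda>\<theta>. exs [0..<W] (And zero_fm \<theta>))"
    by (intro code_computable_exs code_computable_And code_computable_id)
  then obtain h' where h': "computable 1 h'"
    "\<And>\<theta>. fm_code (exs [0..<W] (And zero_fm \<theta>)) = h' [fm_code \<theta>]"
    unfolding code_computable_def by blast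
  show thesis
  proof (rule that)
    show "computable 1 (\<lambda>xs. h' [((\<lambda>m. h [m]) ^^ (xs ! 0)) (xs ! 0)])"
      by (intro computable_comp1[OF h'(1)] computable_funpow_diag h(1))
    show "h' [((\<lambda>m. h [m]) ^^ ([fm_code \<theta>] ! 0)) ([fm_code \<theta>] ! 0)] =
        fm_code (instance_at (fm_code \<theta>) \<theta>)" for \<theta>
      unfolding instance_at_def h'(2) by (simp add: fm_code_funpow[of shift "\<lambda>m. h [m]"] h(2))
  qed
qed

text \<open>\<open>g\<close> takes the code of \<open>\<theta>\<close> to 1 iff
  \<open>instance_at (fm_code \<theta>) \<theta>\<close> is outside the theory, so \<open>T\<close>
  states its own absence. If \<open>T\<close> is true, soundness of \<open>\<delta>\<close> under
  any witnessing parameters gives \<open>g [d] = 1\<close>; if it is not, completeness under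
  parameters with enough levels makes it true.\<close>

theorem not_decidable: "\<not> decidable (fm_code ` mu_theory A)"
proof
  assume "decidable (fm_code ` mu_theory A)"
  then obtain f where f: "recursive 1 f"
    "\<And>n. f [n] = (if n \<in> fm_code ` mu_theory A then 1 else 0)"
    unfolding decidable_def by blast
  obtain t where t: "computable 1 t"
    "\<And>\<theta>. t [fm_code \<theta>] = fm_code (instance_at (fm_code \<theta>) \<theta>)"
    using computable_code_instance_at by blast
  define g where "g = (\<lambda>xs. if f [t xs] = 0 then 1 else 0 :: nat)"
  have "computable 1 f" using f(1) unfolding computable_def by blast
  then have "computable 1 g"
    unfolding g_def by (intro computable_is_zero computable_comp1 t(1))
  then obtain \<delta> where \<delta>: "wf_fm A Map.empty \<delta>" "fv \<delta> \<subseteq> {..<M + k}"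
    and sound: "\<And>e m. blk e 0 \<in> level e m \<Longrightarrow> sat A no_rels e \<delta> \<Longrightarrow> g [m] = 1"
    and complete: "\<And>m. g [m] = 1 \<Longrightarrow>
      \<exists>B. \<forall>e. (\<forall>i\<le>B. level e i \<noteq> {}) \<longrightarrow> blk e 0 \<in> level e m \<longrightarrow> sat A no_rels e \<delta>"
    by (rule diagonal_formula) blast
  define d where "d = fm_code \<delta>"
  define T where "T = instance_at d \<delta>"
  have T: "wf_fm A Map.empty T" "fv T = {}"
    using wf_instance_at[OF \<delta>(1)] fv_instance_at[OF \<delta>(2)] by (simp_all add: T_def)
  have closed: "sat A no_rels e T \<longleftrightarrow> sat A no_rels e' T" for e e'
    by (rule sat_cong_closed[OF T(1)]) (simp add: T(2))
  have g: "g [d] = 1 \<longleftrightarrow> T \<notin> mu_theory A"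
    using inj_image_mem_iff[OF inj_fm_code, of T "mu_theory A"]
    by (simp add: g_def f(2) t(2) d_def T_def)
  show False
  proof (cases "T \<in> mu_theory A")
    case True
    then have "sat A no_rels e T" for e by (simp add: mu_theory_def)
    then obtain e where e: "blk e 0 \<in> level e 0" "sat A no_rels e ((shift ^^ d) \<delta>)"
      unfolding T_def instance_at_def by (auto simp: sat_exs sat_zero_fm)
    then obtain a where a: "a \<in> level e d" "sat A no_rels (upds e (vars 0) a) \<delta>"
      using shift_funpow_D[OF \<delta> e] by auto
    have "a \<in> U" using a(1) level_U by blast
    then have "g [d] = 1"
      using a(1) blk_upds0[of a e] by (intro sound[OF _ a(2)]) simp
    then show False using g True by simp
  next
    case False
    then obtain B where B: "\<And>e. (\<forall>i\<le>B. level e i \<noteq> {}) \<Longrightarrow> blk e 0 \<in> level e d \<Longrightarrow> sat A no_rels e \<delta>"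
      using complete[of d] g by blast
    \<comment> \<open>Levels up to \<open>B\<close> make \<open>\<delta>\<close> complete, and
      levels up to \<open>d\<close> carry the chain of \<open>d\<close> successors.\<close>
    obtain e where e: "\<forall>i\<le>B + d. level e i \<noteq> {}"
      using levels_nonempty by blast
    then obtain z where z: "z \<in> level e 0" by blast
    then have "z \<in> U" using level_U by blast
    define e' where "e' = upds e (vars 0) z"
    have e': "blk e' 0 \<in> level e' 0" "level e' = level e"
      using z blk_upds0[OF \<open>z \<in> U\<close>, of e] by (simp_all add: e'_def)
    have "sat A no_rels (upds e' (vars 0) a) \<delta>" if "a \<in> level e' d" for a
    proof -
      have "a \<in> U" using that level_U by blast
      then show ?thesis
        using that e e'(2) blk_upds0[of a e'] by (intro B) simp_all
    qed
    then have "sat A no_rels e' (And zero_fm ((shift ^^ d) \<delta>))"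
      using e e' by (auto simp: sat_zero_fm intro!: shift_funpow_I[OF \<delta> e'(1)])
    then have "sat A no_rels (upds e' [0..<W] (map e' [0..<W])) (And zero_fm ((shift ^^ d) \<delta>))"
      by (simp only: upds_map_id)
    then have "sat A no_rels e' T"
      unfolding T_def instance_at_def sat_exs[OF distinct_upt] using length_map by blast
    then have "T \<in> mu_theory A"
      using T closed by (auto simp: mu_theory_def sentence_def)
    then show False using False by simp
  qed
qed

end

lemma decidable_bounded_closure:
  assumes "decidable (fm_code ` mu_theory A)"
  shows "bounded_closure A"
  unfolding bounded_closure_def
proof (intro allI impI, rule ccontr)
  fix X k \<Phi>
  assume "wf_fm A [X \<mapsto> k] \<Phi>" "only_positive X \<Phi>"
    "\<nexists>n. \<forall>e. stage A X k \<Phi> e n = stage A X k \<Phi> e (Suc n)"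
  then interpret unbounded_stages A X k \<Phi>
    by unfold_locales auto
  show False using not_decidable assms by blast
qed

theorem mainTheorem4:
  fixes A :: "'a fo_structure"
  assumes "decidable (fm_code ` mu_theory A)"
  shows "\<forall>X ys \<phi>. wf_fm A Map.empty (Mu X ys \<phi>) \<longrightarrow>
    (\<exists>\<psi>. first_order \<psi> \<and> wf_fm A Map.empty \<psi> \<and> fv \<psi> \<subseteq> fv (Mu X ys \<phi>) \<and>
      (\<forall>e. sat A no_rels e (Mu X ys \<phi>) \<longleftrightarrow> sat A no_rels e \<psi>))"
  using bounded_closure_first_order[OF decidable_bounded_closure[OF assms]] by blast

end
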